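(* Let $n\ge1$. Let $U\subseteq\mathrm{Hol}(\mathbb B^n,\mathbb C^n)$ be an open set containing $\mathcal S_n^0$ and let $\Phi:U\to\mathbb C$ be a continuous functional. Let $F\in\mathcal S_n^0$ be an extremal function for $\Phi$, i.e. $\mathrm{Re}\,\Phi(f)\le\mathrm{Re}\,\Phi(F)$ for every $f\in\mathcal S_n^0$, and suppose that $\Phi$ is complex differentiable at $F$ with complex derivative $L$ at $F$. Then $$\max_{h\in\mathcal M_n}\mathrm{Re}\,L\left(d(F)_z\cdot h\right)=-\mathrm{Re}\,L(F).$$
   Context: $\mathbb B^n=\{z\in\mathbb C^n:\|z\|<1\}$ is the Euclidean unit ball, $\mathrm{Hol}(\mathbb B^n,\mathbb C^n)$ is the Fréchet space of holomorphic maps $\mathbb B^n\to\mathbb C^n$ with the compact-open topology, $\langle\cdot,\cdot\rangle$ is the standard Euclidean (Hermitian) inner product of $\mathbb C^n$, $\mathbb R^+=(0,\infty)$, and $d(f)_z$ (also $df_z$) is the complex derivative (Jacobian) of $f$ at $z$. The expression $d(F)_z\cdot h$ as argument of $L$ denotes the map $z\mapsto d(F)_z\,h(z)$. $\mathcal M_n=\{h\in\mathrm{Hol}(\mathbb B^n,\mathbb C^n): h(0)=0,\ dh_0=-\mathrm{id},\ \mathrm{Re}\,\langle h(z),z\rangle\le 0 \text{ for all } z\in\mathbb B^n\}$. A Herglotz vector field in the class $\mathcal M_n$ is a mapping $G:\mathbb B^n\times\mathbb R^+\to\mathbb C^n$ such that $G(z,\cdot)$ is measurable on $\mathbb R^+$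 for every $z\in\mathbb B^n$ and $G(\cdot,t)\in\mathcal M_n$ for a.e. $t\in\mathbb R^+$. For such $G$, $\varphi^G_t$ denotes the unique (locally absolutely continuous in $t$) solution of $\dot\varphi_t(z)=G(\varphi_t(z),t)$ for a.e. $t\ge 0$, $\varphi_0(z)=z\in\mathbb B^n$. The limit $f^G:=\lim_{t\to\infty}e^t\varphi^G_t$ exists locally uniformly in $\mathbb B^n$, and $\mathcal S_n^0:=\{f^G : G \text{ a Herglotz vector field in the class } \mathcal M_n\}$. Complex derivative: let $U\subseteq\mathrm{Hol}(\mathbb B^n,\mathbb C^n)$ be open and $\Phi:U\to\mathbb C$ continuous. $\Phi$ is differentiable at $f\in U$ along $h\in\mathrm{Hol}(\mathbb B^n,\mathbb C^n)$ if $\Lambda(f;h):=\lim_{\mathbb C\ni\delta\to0}\frac{\Phi(f+\delta h)-\Phi(f)}{\delta}$ exists. $\Phi$ is complex differentiable at $F\in U$ if there is an open neighborhood $V\subseteq U$ of $F$ such that $\Phi$ is differentiable at every $f\in V$ along every $h\in\mathrm{Hol}(\mathbb B^n,\mathbb C^n)$ and $\Lambda:V\times\mathrm{Hol}(\mathbb B^n,\mathbb C^n)\to\mathbb C$ is continuous; then $L:=\Lambda(F;\cdot)$, a continuous linear functional, is called the complex derivative of $\Phi$ at $F$. *)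

theory Defs
  imports "HOL-Analysis.Analysis"
begin

text \<open>
  \<open>\<complex>\<^sup>n\<close> is the type \<open>complex^'n\<close>, with \<open>n = CARD('n) \<ge> 1\<close>; its library norm is the Euclidean one,
  and \<open>*s\<close> is multiplication by a complex scalar.  A map defined on the unit ball only is
  represented by a function that is \<open>undefined\<close> off the ball (\<open>extensional\<close>), so that equality of
  such maps is equality of functions.
\<close>

abbreviation unit_ball :: "(complex^'n) set" where
  "unit_ball \<equiv> ball 0 1"

definition cinner :: "complex^'n \<Rightarrow> complex^'n \<Rightarrow> complex" where
  "cinner v w = (\<Sum>i\<in>UNIV. v $ i * cnj (w $ i))"

text \<open>Holomorphy: a Frechet derivative exists at every point of the ball and is given by a complex
  matrix, i.e. it is complex linear.  The matrix is then the Jacobian, and its action on vectors is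
  \<open>frechet_derivative f (at z)\<close>.\<close>

definition Hol :: "(complex^'n \<Rightarrow> complex^'n) set" where
  "Hol = {f \<in> extensional unit_ball.
            \<forall>z\<in>unit_ball. \<exists>A :: complex^'n^'n. (f has_derivative (\<lambda>v. A *v v)) (at z)}"

definition compact_open_topology :: "(complex^'n \<Rightarrow> complex^'n) topology" where
  "compact_open_topology =
     topology_generated_by
       {{f \<in> Hol. f ` K \<subseteq> W} |K W. compact K \<and> K \<subseteq> unit_ball \<and> open W}"

lemma topspace_compact_open_topology [simp]: "topspace compact_open_topology = Hol"
proof -
  have "Hol \<in> {{f \<in> Hol. f ` K \<subseteq> W} |K W. compact K \<and> K \<subseteq> unit_ball \<and> open W}"
    by (force intro!: exI[of _ "{}"])
  then show ?thesis
    unfolding compact_open_topology_def topology_generated_by_topspace by blast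
qed

definition class_M :: "(complex^'n \<Rightarrow> complex^'n) set" where
  "class_M = {h \<in> Hol. h 0 = 0 \<and> (h has_derivative (\<lambda>v. - v)) (at 0) \<and>
                (\<forall>z\<in>unit_ball. Re (cinner (h z) z) \<le> 0)}"

definition herglotz_vector_field :: "(complex^'n \<Rightarrow> real \<Rightarrow> complex^'n) \<Rightarrow> bool" where
  "herglotz_vector_field G \<longleftrightarrow>
     (\<forall>z\<in>unit_ball. (\<lambda>t. G z t) \<in> borel_measurable (lebesgue_on {0<..})) \<and>
     (AE t in lebesgue_on {0<..}. (\<lambda>z\<in>unit_ball. G z t) \<in> class_M)"

text \<open>The finite families of nonoverlapping subintervals of \<open>S\<close> are the divisions of subsets of
  \<open>S\<close>; an interval \<open>k\<close> of such a family has end points \<open>Inf k\<close> and \<open>Sup k\<close>.\<close>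

definition absolutely_continuous_on :: "real set \<Rightarrow> (real \<Rightarrow> 'a::real_normed_vector) \<Rightarrow> bool" where
  "absolutely_continuous_on S f \<longleftrightarrow>
     (\<forall>\<epsilon>>0. \<exists>\<delta>>0. \<forall>D T. D division_of T \<and> T \<subseteq> S \<and> (\<Sum>k\<in>D. Sup k - Inf k) < \<delta> \<longrightarrow>
        (\<Sum>k\<in>D. norm (f (Sup k) - f (Inf k))) < \<epsilon>)"

text \<open>\<open>\<phi> t z\<close> is \<open>\<phi>\<^sub>t(z)\<close>; only its values for \<open>t \<ge> 0\<close> and \<open>z\<close> in the ball matter.\<close>

definition is_evolution ::
    "(complex^'n \<Rightarrow> real \<Rightarrow> complex^'n) \<Rightarrow> (real \<Rightarrow> complex^'n \<Rightarrow> complex^'n) \<Rightarrow> bool" where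
  "is_evolution G \<phi> \<longleftrightarrow>
     (\<forall>z\<in>unit_ball.
        \<phi> 0 z = z \<and>
        (\<forall>t\<ge>0. \<phi> t z \<in> unit_ball) \<and>
        (\<forall>T>0. absolutely_continuous_on {0..T} (\<lambda>t. \<phi> t z)) \<and>
        (AE t in lebesgue_on {0<..}.
           ((\<lambda>s. \<phi> s z) has_vector_derivative G (\<phi> t z) t) (at t)))"

text \<open>\<open>f = lim e\<^sup>t \<phi>\<^sub>t\<close> locally uniformly on the ball, \<open>\<phi>\<close> being the solution belonging to \<open>G\<close>.\<close>

definition is_herglotz_limit ::
    "(complex^'n \<Rightarrow> real \<Rightarrow> complex^'n) \<Rightarrow> (complex^'n \<Rightarrow> complex^'n) \<Rightarrow> bool" where
  "is_herglotz_limit G f \<longleftrightarrow>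
     f \<in> extensional unit_ball \<and>
     (\<exists>\<phi>. is_evolution G \<phi> \<and>
        (\<forall>K. compact K \<and> K \<subseteq> unit_ball \<longrightarrow>
           uniform_limit K (\<lambda>t z. exp t *\<^sub>R \<phi> t z) f at_top))"

definition class_S0 :: "(complex^'n \<Rightarrow> complex^'n) set" where
  "class_S0 = {f. \<exists>G. herglotz_vector_field G \<and> is_herglotz_limit G f}"

text \<open>The difference quotient of \<open>\<Phi>\<close> at \<open>f\<close> along \<open>h\<close>.  The perturbed map is the pointwise
  \<open>f + \<delta> h\<close>, restricted to the ball; it lies in a given open neighbourhood of \<open>f\<close> as soon as
  \<open>\<delta>\<close> is small, so values of \<open>\<Phi>\<close> outside that neighbourhood do not affect the limit.\<close>

definition diff_quotient ::
    "((complex^'n \<Rightarrow> complex^'n) \<Rightarrow> complex) \<Rightarrow> (complex^'n \<Rightarrow> complex^'n) \<Rightarrow>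
       (complex^'n \<Rightarrow> complex^'n) \<Rightarrow> complex \<Rightarrow> complex" where
  "diff_quotient \<Phi> f h \<delta> = (\<Phi> (\<lambda>z\<in>unit_ball. f z + \<delta> *s h z) - \<Phi> f) / \<delta>"

definition differentiable_along ::
    "((complex^'n \<Rightarrow> complex^'n) \<Rightarrow> complex) \<Rightarrow> (complex^'n \<Rightarrow> complex^'n) \<Rightarrow>
       (complex^'n \<Rightarrow> complex^'n) \<Rightarrow> bool" where
  "differentiable_along \<Phi> f h \<longleftrightarrow> (\<exists>l. (diff_quotient \<Phi> f h \<longlongrightarrow> l) (at 0))"

definition directional_derivative ::
    "((complex^'n \<Rightarrow> complex^'n) \<Rightarrow> complex) \<Rightarrow> (complex^'n \<Rightarrow> complex^'n) \<Rightarrow>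
       (complex^'n \<Rightarrow> complex^'n) \<Rightarrow> complex" where
  "directional_derivative \<Phi> f h = Lim (at 0) (diff_quotient \<Phi> f h)"

definition has_complex_derivative ::
    "(complex^'n \<Rightarrow> complex^'n) set \<Rightarrow> ((complex^'n \<Rightarrow> complex^'n) \<Rightarrow> complex) \<Rightarrow>
       (complex^'n \<Rightarrow> complex^'n) \<Rightarrow> ((complex^'n \<Rightarrow> complex^'n) \<Rightarrow> complex) \<Rightarrow> bool" where
  "has_complex_derivative U \<Phi> F L \<longleftrightarrow>
     (\<exists>V. openin compact_open_topology V \<and> F \<in> V \<and> V \<subseteq> U \<and>
        (\<forall>f\<in>V. \<forall>h\<in>Hol. differentiable_along \<Phi> f h) \<and>
        continuous_map
          (prod_topology (subtopology compact_open_topology V) compact_open_topology) euclidean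
          (\<lambda>(f, h). directional_derivative \<Phi> f h)) \<and>
     (\<forall>h\<in>Hol. L h = directional_derivative \<Phi> F h)"

text \<open>The map \<open>z \<mapsto> d(F)\<^sub>z h(z)\<close>.\<close>

definition derivative_applied ::
    "(complex^'n \<Rightarrow> complex^'n) \<Rightarrow> (complex^'n \<Rightarrow> complex^'n) \<Rightarrow> complex^'n \<Rightarrow> complex^'n" where
  "derivative_applied F h = (\<lambda>z\<in>unit_ball. frechet_derivative F (at z) (h z))"

end

theory Submission
  imports Defs "HOL-Complex_Analysis.Complex_Analysis" "HOL-Real_Asymp.Real_Asymp"
begin

text \<open>
  If \<open>\<xi>\<close> is the flow of \<open>h \<in> M\<^sub>n\<close>, then following \<open>h\<close> up to time \<open>s\<close> and afterwards the field that
  generates \<open>F\<close> produces the map \<open>e\<^sup>s F \<circ> \<xi>\<^sub>s = F + s (F + dF h) + o(s)\<close> of the class \<open>S\<^sub>n\<^sup>0\<close>, and extremality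
  gives \<open>Re L(F + dF h) \<le> 0\<close>.  Conversely \<open>F = e\<^sup>t F\<^sub>t \<circ> \<phi>\<^sub>t\<close>, where \<open>\<phi>\<close> is the evolution that generates \<open>F\<close>
  and \<open>F\<^sub>t\<close> belongs to the field shifted by \<open>t\<close>.  The quotients \<open>(\<phi>\<^sub>t - id) / t\<close> form a normal family;
  each of their limits \<open>h\<close> lies in \<open>M\<^sub>n\<close>, and \<open>(F - F\<^sub>t) / t\<close> tends to \<open>F + dF h\<close> along the same times,
  so \<open>Re L(F + dF h) \<ge> 0\<close> for this \<open>h\<close>.  The holomorphy of the maps in \<open>S\<^sub>n\<^sup>0\<close> need not be proved, since
  they belong to the open set \<open>U\<close> of the space of holomorphic maps.
\<close>

section \<open>Holomorphic maps of the ball\<close>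

text \<open>The two variations differ in where the difference quotient is based: the forward one at
  \<open>F\<close>, the backward one at comparison maps that move towards \<open>F\<close> while the
  direction moves as well. Differentiability at \<open>F\<close> along fixed directions would not
  control the second quotient; joint continuity of the directional derivative in base point and
  direction does. The same continuity yields additivity of \<open>L\<close>, which is not part of
  its definition and is needed to split \<open>L\<close> of the limit map. The estimates rest on
  growth bounds for \<open>class_M\<close> that depend on the radius only. Among them is the
  quadratic bound |h(z) + z| \<le> C |z|^2: it makes e^t \<phi>_t converge, and its version
  integrated in time survives the passage to a limit of the quotients, which is how such a limit
  acquires the derivative -id at 0. Fields are merely measurable in time. Flows are therefore built
  from an integral equation, and the fundamental theorem of calculus is needed in both directions
  for functions that are differentiable almost everywhere only.\<close>

lemma Re_cinner: "Re (cinner v w) = v \<bullet> w"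
  by (simp add: cinner_def inner_vec_def inner_complex_def)

lemma cinner_self: "cinner v v = of_real ((norm v)\<^sup>2)"
proof (rule complex_eqI)
  show "Re (cinner v v) = Re (of_real ((norm v)\<^sup>2))"
    by (simp add: Re_cinner power2_norm_eq_inner)
  show "Im (cinner v v) = Im (of_real ((norm v)\<^sup>2))"
    by (simp add: cinner_def)
qed

lemma cinner_diff_left: "cinner (u - v) w = cinner u w - cinner v w"
  by (simp add: cinner_def left_diff_distrib sum_subtractf)

lemma cinner_add_left: "cinner (u + v) w = cinner u w + cinner v w"
  by (simp add: cinner_def distrib_right sum.distrib)

lemma cinner_add_right: "cinner u (v + w) = cinner u v + cinner u w"
  by (simp add: cinner_def distrib_left sum.distrib)

lemma cinner_scale_left: "cinner (c *s v) w = c * cinner v w"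
  by (simp add: cinner_def sum_distrib_left mult.assoc)

lemma cinner_scale_right: "cinner v (c *s w) = cnj c * cinner v w"
  by (simp add: cinner_def sum_distrib_left mult.assoc mult.left_commute)

lemma scaleC_of_real: "(of_real c :: complex) *s v = c *\<^sub>R v"
  by (simp add: vec_eq_iff scaleR_conv_of_real[where 'a=complex])

lemma norm_scaleC: "norm ((c::complex) *s v) = norm c * norm v"
  by (simp add: norm_vec_def norm_mult L2_set_right_distrib)

text \<open>Multiplying \<open>v\<close> by the unimodular factor \<open>u\<close> turns the
  Hermitian product into its modulus, so that the real Cauchy-Schwarz inequality for its real part
  gives the complex one.\<close>

lemma norm_cinner_le: "norm (cinner v w) \<le> norm v * norm w"
proof (cases "cinner v w = 0")
  case False
  define u where "u = cnj (cinner v w) / of_real (norm (cinner v w))"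
  have "cinner (u *s v) w = of_real (norm (cinner v w))"
    using False by (simp add: cinner_scale_left u_def mult.commute[of "cnj _"] complex_norm_square[symmetric] power2_eq_square)
  then have "norm (cinner v w) = (u *s v) \<bullet> w"
    by (metis Re_cinner Re_complex_of_real)
  also have "\<dots> \<le> norm (u *s v) * norm w" by (rule norm_cauchy_schwarz)
  also have "norm (u *s v) = norm v"
    using False by (simp add: norm_scaleC u_def norm_divide)
  finally show ?thesis .
qed simp

lemma linear_scaleC: "linear (\<lambda>c::complex. c *s v)"
  by (rule linearI) (simp_all add: vec_eq_iff distrib_right scaleR_conv_of_real[where 'a=complex])

lemma linear_cinner_left: "linear (\<lambda>v. cinner v w)"
  by (rule linearI) (simp_all add: cinner_add_left cinner_scale_left scaleR_conv_of_real[where 'a=complex] flip: scaleC_of_real)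

lemma Hol_extensional: "f \<in> Hol \<Longrightarrow> f \<in> extensional unit_ball"
  by (simp add: Hol_def)

lemma Hol_has_derivative:
  fixes f :: "complex^'n \<Rightarrow> complex^'n"
  assumes "f \<in> Hol" "z \<in> unit_ball"
  shows "(f has_derivative frechet_derivative f (at z)) (at z)"
  proof -
  obtain A :: "complex^'n^'n" where "(f has_derivative (\<lambda>v. A *v v)) (at z)"
    using assms unfolding Hol_def by blast
  then have "f differentiable (at z)" by (rule differentiableI)
  then show ?thesis by (simp add: frechet_derivative_works)
qed

lemma Hol_derivative_matrix:
  fixes f :: "complex^'n \<Rightarrow> complex^'n"
  assumes "f \<in> Hol" "z \<in> unit_ball"
  shows "frechet_derivative f (at z) = (\<lambda>v. matrix (frechet_derivative f (at z)) *v v)"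
    and "\<exists>A::complex^'n^'n. frechet_derivative f (at z) = (\<lambda>v. A *v v)"
proof -
  obtain A :: "complex^'n^'n" where "(f has_derivative (\<lambda>v. A *v v)) (at z)"
    using assms unfolding Hol_def by blast
  then have A: "frechet_derivative f (at z) = (\<lambda>v. A *v v)"
    by (rule frechet_derivative_at[symmetric])
  then show "\<exists>A::complex^'n^'n. frechet_derivative f (at z) = (\<lambda>v. A *v v)" by blast
  show "frechet_derivative f (at z) = (\<lambda>v. matrix (frechet_derivative f (at z)) *v v)"
    unfolding A by simp
qed

lemma Hol_derivative_scaleC:
  assumes "f \<in> Hol" "z \<in> unit_ball"
  shows "frechet_derivative f (at z) (c *s v) = c *s frechet_derivative f (at z) v"
  using Hol_derivative_matrix(2)[OF assms] by (auto simp: vector_scalar_commute)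

lemma Hol_continuous_on: "f \<in> Hol \<Longrightarrow> S \<subseteq> unit_ball \<Longrightarrow> continuous_on S f"
  by (meson Hol_has_derivative continuous_at_imp_continuous_on has_derivative_continuous subsetD)

text \<open>Restriction to a complex line and pairing with a fixed vector produce a scalar function
  of one variable, to which one-variable function theory applies. Complex linearity of the Jacobian
  makes the real derivative of the slice a multiplication by a complex number.\<close>

lemma Hol_slice:
  assumes f: "f \<in> Hol" and z: "z + \<zeta> *s v \<in> unit_ball"
  shows "((\<lambda>\<zeta>. cinner (f (z + \<zeta> *s v)) w) has_field_derivative
           cinner (frechet_derivative f (at (z + \<zeta> *s v)) v) w) (at \<zeta>)"
proof -
  have 1: "((\<lambda>\<zeta>. z + \<zeta> *s v) has_derivative (\<lambda>\<eta>. \<eta> *s v)) (at \<zeta>)"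
    using has_derivative_add[OF has_derivative_const
        linear_imp_has_derivative[OF linear_scaleC]] by force
  have 2: "((\<lambda>\<zeta>. f (z + \<zeta> *s v)) has_derivative
      (\<lambda>\<eta>. frechet_derivative f (at (z + \<zeta> *s v)) (\<eta> *s v))) (at \<zeta>)"
    using diff_chain_at[OF 1 Hol_has_derivative[OF f z]] by (simp add: o_def)
  have "((\<lambda>\<zeta>. cinner (f (z + \<zeta> *s v)) w) has_derivative
      (\<lambda>\<eta>. cinner (frechet_derivative f (at (z + \<zeta> *s v)) (\<eta> *s v)) w)) (at \<zeta>)"
    using diff_chain_at[OF 2 linear_imp_has_derivative[OF linear_cinner_left]] by (simp add: o_def)
  then show ?thesis
    unfolding has_field_derivative_def Hol_derivative_scaleC[OF f z] cinner_scale_left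
    by (simp add: mult.commute[of _ "cinner _ _"])
qed

section \<open>Cauchy estimates and Taylor remainders, transferred from discs to the ball\<close>

lemma Cauchy_bound_disc:
  fixes g :: "complex \<Rightarrow> complex"
  assumes g: "g holomorphic_on ball 0 R" and R: "R > 0" and B: "\<And>\<zeta>. norm \<zeta> < R \<Longrightarrow> norm (g \<zeta>) \<le> B"
  shows "norm (deriv g 0) \<le> 2 * B / R"
proof -
  \<comment> \<open>The circle of radius \<open>R/2\<close> lies inside the open disc on which
    \<open>g\<close> is known; this costs the factor 2.\<close>
  have "norm ((deriv ^^ 1) g 0) \<le> fact 1 * B / (R/2) ^ 1"
    by (rule Cauchy_inequality)
      (use R in \<open>auto intro!: holomorphic_on_subset[OF g] B holomorphic_on_imp_continuous_on\<close>)
  then show ?thesis by (simp add: mult.commute)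
qed

text \<open>Cauchy's inequality on discs of radius \<open>R/3\<close> about the points of the closed
  unit disc bounds the second derivative by 2 B / (R/3)^2, whence the constant 18. The condition R
  \<ge> 2 keeps these discs inside \<open>ball 0 R\<close>.\<close>

lemma Taylor_bound_disc:
  fixes g :: "complex \<Rightarrow> complex"
  assumes g: "g holomorphic_on ball 0 R" and R: "R \<ge> 2" and B: "\<And>\<zeta>. norm \<zeta> < R \<Longrightarrow> norm (g \<zeta>) \<le> B"
  shows "norm (g 1 - g 0 - deriv g 0) \<le> 18 * B / R\<^sup>2"
proof -
  have "norm ((deriv ^^ 0) g 1 - (\<Sum>i\<le>1. (deriv ^^ i) g 0 * (1 - 0) ^ i / fact i))
      \<le> (18 * B / R\<^sup>2) * norm (1 - 0 :: complex) ^ Suc 1 / fact 1"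
  proof (rule complex_Taylor[where S="cball 0 1"])
    fix i :: nat and x :: complex assume x: "x \<in> cball 0 1"
    then have "x \<in> ball 0 R" using R by simp
    then show "((deriv ^^ i) g has_field_derivative (deriv ^^ Suc i) g x) (at x within cball 0 1)"
      using holomorphic_derivI[OF holomorphic_higher_deriv[OF g open_ball] open_ball, of x i]
      by (simp add: has_field_derivative_at_within)
    have sub: "norm y < R" if "norm (x - y) \<le> R/3" for y
      using norm_triangle_ineq4[of x "x - y"] that x R by simp
    have "norm ((deriv ^^ 2) g x) \<le> fact 2 * B / (R/3) ^ 2"
      by (rule Cauchy_inequality)
        (use R sub in \<open>auto intro!: holomorphic_on_subset[OF g] B holomorphic_on_imp_continuous_on simp: dist_norm\<close>)
    then show "norm ((deriv ^^ Suc 1) g x) \<le> 18 * B / R\<^sup>2"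
      by (simp add: numeral_2_eq_2 power_divide)
  qed auto
  then show ?thesis by (simp add: algebra_simps)
qed

lemma Hol_slice_disc:
  assumes f: "f \<in> Hol" and sub: "ball z \<rho> \<subseteq> unit_ball" and v: "v \<noteq> 0" and \<rho>: "\<rho> > 0"
    and B: "\<And>x. x \<in> ball z \<rho> \<Longrightarrow> norm (f x) \<le> B"
  defines "g \<equiv> \<lambda>y \<zeta>. cinner (f (z + \<zeta> *s v)) y"
  shows "g y holomorphic_on ball 0 (\<rho> / norm v)"
    and "norm \<zeta> < \<rho> / norm v \<Longrightarrow> norm (g y \<zeta>) \<le> B * norm y"
    and "deriv (g y) 0 = cinner (frechet_derivative f (at z) v) y"
proof -
  have mem: "z + \<zeta> *s v \<in> ball z \<rho>" if "norm \<zeta> < \<rho> / norm v" for \<zeta>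
    using that v by (simp add: dist_norm norm_scaleC field_simps)
  show "g y holomorphic_on ball 0 (\<rho> / norm v)"
    unfolding g_def holomorphic_on_open[OF open_ball]
  proof
    fix \<zeta> :: complex assume "\<zeta> \<in> ball 0 (\<rho> / norm v)"
    then have "z + \<zeta> *s v \<in> unit_ball" using mem sub by (simp add: subset_iff)
    then show "\<exists>f'. ((\<lambda>\<zeta>. cinner (f (z + \<zeta> *s v)) y) has_field_derivative f') (at \<zeta>)"
      using Hol_slice[OF f] by blast
  qed
  show "norm (g y \<zeta>) \<le> B * norm y" if "norm \<zeta> < \<rho> / norm v"
    unfolding g_def
    by (rule order_trans[OF norm_cinner_le mult_right_mono[OF B[OF mem[OF that]] norm_ge_zero]])
  have z: "z + 0 *s v \<in> unit_ball" using subsetD[OF sub, of z] \<rho> by simp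
  show "deriv (g y) 0 = cinner (frechet_derivative f (at z) v) y"
    unfolding g_def using DERIV_imp_deriv[OF Hol_slice[OF f z]] by simp
qed

text \<open>Pairing with \<open>y\<close>, the derivative vector itself, loses nothing: the scalar
  estimate for the slice reads |y|^2 \<le> (2 B / \<rho>) |v| |y|, and one factor |y|
  cancels.\<close>

lemma Hol_derivative_bound:
  assumes f: "f \<in> Hol" and sub: "ball z \<rho> \<subseteq> unit_ball" and \<rho>: "\<rho> > 0"
    and B: "\<And>x. x \<in> ball z \<rho> \<Longrightarrow> norm (f x) \<le> B"
  shows "norm (frechet_derivative f (at z) v) \<le> 2 * B / \<rho> * norm v"
proof -
  have z: "z \<in> unit_ball" using sub \<rho> by (meson centre_in_ball subsetD)
  define y where "y = frechet_derivative f (at z) v"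
  show ?thesis
  proof (cases "v = 0 \<or> y = 0")
    case True
    have "B \<ge> 0" using B[of z] \<rho> norm_ge_zero order_trans by (metis centre_in_ball)
    then show ?thesis
      using True linear_0[OF has_derivative_linear[OF Hol_has_derivative[OF f z]]] \<rho> by (auto simp: y_def)
  next
    case False
    then have v: "v \<noteq> 0" by simp
    note s = Hol_slice_disc[OF f sub v \<rho> B, where y=y]
    have "norm (cinner y y) \<le> 2 * (B * norm y) / (\<rho> / norm v)"
      using Cauchy_bound_disc[OF s(1) _ s(2)] s(3) v \<rho> by (simp add: y_def)
    then have "norm y * norm y \<le> (2 * B / \<rho> * norm v) * norm y"
      by (simp add: cinner_self norm_mult power2_eq_square field_simps)
    from mult_right_le_imp_le[OF this] False show ?thesis by (simp add: y_def)
  qed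
qed

text \<open>The same self-pairing, now with the remainder as \<open>y\<close>. The slice at
  parameter 1 is the value at \<open>z + v\<close>, and |v| \<le> \<rho>/2 makes the radius
  \<open>\<rho> / norm v\<close> of its disc at least 2. Since \<open>f\<close> enters only through
  a bound, the estimate is uniform over locally bounded families.\<close>

lemma Hol_Taylor:
  assumes f: "f \<in> Hol" and sub: "ball z \<rho> \<subseteq> unit_ball" and \<rho>: "\<rho> > 0"
    and B: "\<And>x. x \<in> ball z \<rho> \<Longrightarrow> norm (f x) \<le> B" and v: "norm v \<le> \<rho> / 2"
  shows "norm (f (z + v) - f z - frechet_derivative f (at z) v) \<le> 18 * B / \<rho>\<^sup>2 * (norm v)\<^sup>2"
proof -
  have z: "z \<in> unit_ball" using sub \<rho> by (meson centre_in_ball subsetD)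
  define y where "y = f (z + v) - f z - frechet_derivative f (at z) v"
  show ?thesis
  proof (cases "v = 0 \<or> y = 0")
    case True
    have "B \<ge> 0" using B[of z] \<rho> norm_ge_zero order_trans by (metis centre_in_ball)
    then show ?thesis
      using True linear_0[OF has_derivative_linear[OF Hol_has_derivative[OF f z]]] \<rho> by (auto simp: y_def)
  next
    case False
    then have v0: "v \<noteq> 0" by simp
    note s = Hol_slice_disc[OF f sub v0 \<rho> B, where y=y]
    have "\<rho> / norm v \<ge> 2" using v v0 by (simp add: field_simps)
    then have "norm (cinner y y) \<le> 18 * (B * norm y) / (\<rho> / norm v)\<^sup>2"
      using Taylor_bound_disc[OF s(1) _ s(2)] s(3)
      by (simp add: y_def cinner_diff_left)
    then have "norm y * norm y \<le> (18 * B / \<rho>\<^sup>2 * (norm v)\<^sup>2) * norm y"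
      by (simp add: cinner_self norm_mult power2_eq_square field_simps)
    from mult_right_le_imp_le[OF this] False show ?thesis by (simp add: y_def)
  qed
qed

text \<open>Every point of \<open>cball 0 r\<close> is the centre of a ball of radius
  \<open>r' - r\<close> on which the bound \<open>B\<close> holds. The resulting bound on the
  derivative becomes a Lipschitz constant by the mean value inequality, the closed ball being
  convex.\<close>

lemma Hol_Lipschitz:
  fixes f :: "complex^'n \<Rightarrow> complex^'n"
  assumes f: "f \<in> Hol" and r: "r < r'" "r' \<le> 1"
    and B: "\<And>x. norm x < r' \<Longrightarrow> norm (f x) \<le> B"
    and xy: "norm x \<le> r" "norm y \<le> r"
  shows "norm (f x - f y) \<le> 2 * B / (r' - r) * norm (x - y)"
proof (rule differentiable_bound[where S="cball 0 r" and f'="\<lambda>z. frechet_derivative f (at z)"])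
  fix z :: "complex^'n" assume z: "z \<in> cball 0 r"
  then have "z \<in> unit_ball" using r by simp
  then show "(f has_derivative frechet_derivative f (at z)) (at z within cball 0 r)"
    using Hol_has_derivative[OF f] has_derivative_at_withinI by blast
  have sub: "ball z (r' - r) \<subseteq> ball 0 r'"
    using z by (simp add: ball_subset_ball_iff dist_norm)
  have s: "norm x < r'" if "x \<in> ball z (r' - r)" for x
    using subsetD[OF sub that] by simp
  show "onorm (frechet_derivative f (at z)) \<le> 2 * B / (r' - r)"
  proof (rule onorm_le)
    fix v
    show "norm (frechet_derivative f (at z) v) \<le> 2 * B / (r' - r) * norm v"
    proof (rule Hol_derivative_bound[OF f _ _ B[OF s]])
      show "ball z (r' - r) \<subseteq> unit_ball"
        using sub subset_ball[OF r(2)] by (rule subset_trans)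
    qed (use r in auto)
  qed
qed (use xy in auto)

section \<open>Pointwise limits of locally bounded holomorphic maps\<close>

lemma bounded_matrices:
  fixes A :: "nat \<Rightarrow> complex^'n^'n"
  assumes "\<And>n v. norm (A n *v v) \<le> K * norm v"
  shows "bounded (range A)"
proof -
  have "norm (A n) \<le> (\<Sum>i\<in>(UNIV::'n set). \<Sum>j\<in>(UNIV::'n set). K)" for n
  proof -
    have e: "norm (A n $ i $ j) \<le> K" for i j
    proof -
      have "norm (A n $ i $ j) = norm ((A n *v axis j 1) $ i)"
        by (simp add: matrix_vector_mul_component axis_def matrix_vector_mult_def if_distrib cong: if_cong)
      also have "\<dots> \<le> norm (A n *v axis j 1)" by (rule Finite_Cartesian_Product.norm_nth_le)
      also have "\<dots> \<le> K" using assms[of n "axis j 1"] by (simp add: norm_axis_1)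
      finally show ?thesis .
    qed
    have "norm (A n) \<le> (\<Sum>i\<in>UNIV. norm (A n $ i))"
      unfolding norm_vec_def[of "A n"] by (rule L2_set_le_sum) simp
    also have "\<dots> \<le> (\<Sum>i\<in>UNIV. \<Sum>j\<in>UNIV. norm (A n $ i $ j))"
      unfolding norm_vec_def[of "A n $ _"] by (intro sum_mono L2_set_le_sum) simp
    also have "\<dots> \<le> (\<Sum>i\<in>(UNIV::'n set). \<Sum>j\<in>(UNIV::'n set). K)"
      by (intro sum_mono e)
    finally show ?thesis .
  qed
  then show ?thesis by (auto simp: bounded_iff)
qed

text \<open>The Taylor remainders are bounded uniformly along the sequence, so any limit point of the
  Jacobians is the Jacobian of the limit.\<close>

lemma Hol_limit:
  fixes f :: "nat \<Rightarrow> complex^'n \<Rightarrow> complex^'n"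
  assumes f: "\<And>n. f n \<in> Hol" and h: "h \<in> extensional unit_ball"
    and bd: "\<And>r. r < 1 \<Longrightarrow> \<exists>B. \<forall>n x. norm x \<le> r \<longrightarrow> norm (f n x) \<le> B"
    and lim: "\<And>z. norm z < 1 \<Longrightarrow> (\<lambda>n. f n z) \<longlonglongrightarrow> h z"
  shows "h \<in> Hol"
  unfolding Hol_def
proof (intro CollectI conjI ballI h)
  fix z :: "complex^'n" assume z: "z \<in> unit_ball"
  define \<rho> where "\<rho> = (1 - norm z) / 2"
  have \<rho>: "\<rho> > 0" using z by (simp add: \<rho>_def)
  have mem: "norm x \<le> norm z + \<rho>" if "x \<in> ball z \<rho>" for x
    using that norm_triangle_ineq[of z "x - z"] by (simp add: dist_norm norm_minus_commute)
  have sub: "ball z \<rho> \<subseteq> unit_ball"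
    using mem z by (fastforce simp: \<rho>_def field_simps)
  obtain B where B: "\<And>n x. norm x \<le> norm z + \<rho> \<Longrightarrow> norm (f n x) \<le> B"
    using bd[of "norm z + \<rho>"] z by (auto simp: \<rho>_def field_simps)
  define A where "A n = matrix (frechet_derivative (f n) (at z))" for n
  have A: "frechet_derivative (f n) (at z) v = A n *v v" for n v
    using Hol_derivative_matrix(1)[OF f z] unfolding A_def by metis
  have "norm (A n *v v) \<le> 2 * B / \<rho> * norm v" for n v
    unfolding A[symmetric] by (rule Hol_derivative_bound[OF f sub \<rho> B[OF mem]])
  then have "bounded (range A)" by (rule bounded_matrices)
  \<comment> \<open>Convergence of the Jacobians along a subsequence is enough, because the values
    of the maps converge along it to the same limit \<open>h\<close>.\<close>
  then obtain D k where k: "strict_mono k" and D: "(A \<circ> k) \<longlonglongrightarrow> D"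
    using bounded_imp_convergent_subsequence by metis
  define K where "K = 18 * B / \<rho>\<^sup>2"
  have T: "norm (h (z + v) - h z - D *v v) \<le> K * (norm v)\<^sup>2" if v: "norm v < \<rho> / 2" for v
  proof (rule LIMSEQ_le_const2)
    have "z + v \<in> ball z \<rho>" using v \<rho> by (simp add: dist_norm)
    from subsetD[OF sub this] have zv: "norm (z + v) < 1" by simp
    have "(\<lambda>n. A (k n) *v v) \<longlonglongrightarrow> D *v v"
      using D unfolding matrix_vector_mult_def o_def
      by (intro vec_tendstoI) (auto intro!: tendsto_intros)
    then show "(\<lambda>n. norm (f (k n) (z + v) - f (k n) z - A (k n) *v v)) \<longlonglongrightarrow> norm (h (z + v) - h z - D *v v)"
      using LIMSEQ_subseq_LIMSEQ[OF lim[OF zv] k] LIMSEQ_subseq_LIMSEQ[OF lim[of z] k] z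
      by (intro tendsto_norm tendsto_diff) (simp_all add: o_def)
    show "\<exists>N. \<forall>n\<ge>N. norm (f (k n) (z + v) - f (k n) z - A (k n) *v v) \<le> K * (norm v)\<^sup>2"
      unfolding A[symmetric] K_def
      using Hol_Taylor[OF f sub \<rho> B[OF mem], of v] v by auto
  qed
  have "(h has_derivative (\<lambda>v. D *v v)) (at z)"
    unfolding has_derivative_at
  proof
    show "bounded_linear (\<lambda>v. D *v v)" by (simp add: matrix_vector_mul_bounded_linear)
    show "(\<lambda>v. norm (h (z + v) - h z - D *v v) / norm v) \<midarrow>0\<rightarrow> 0"
    proof (rule Lim_null_comparison)
      show "((\<lambda>v::complex^'n. K * norm v) \<longlongrightarrow> 0) (at 0)"
        by (rule tendsto_mult_right_zero[OF tendsto_norm_zero[OF tendsto_ident_at]])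
      have "\<forall>\<^sub>F v in at 0. norm v < \<rho> / 2 \<and> v \<noteq> (0::complex^'n)"
        using \<rho> by (auto simp: eventually_at dist_norm intro!: exI[of _ "\<rho>/2"])
      then show "\<forall>\<^sub>F v in at 0. norm (norm (h (z + v) - h z - D *v v) / norm v) \<le> K * norm v"
        by eventually_elim (use T in \<open>simp add: field_simps power2_eq_square\<close>)
    qed
  qed
  then show "\<exists>A::complex^'n^'n. (h has_derivative (\<lambda>v. A *v v)) (at z)" by blast
qed

section \<open>Absolutely continuous functions\<close>

lemma negligible_outer_open:
  assumes "negligible N" "\<delta> > 0"
  obtains T where "open T" "N \<subseteq> T" "T \<in> lmeasurable" "measure lebesgue T < \<delta>"
proof -
  have N: "N \<in> lmeasurable" "measure lebesgue N = 0"
    using assms(1) by (auto simp: negligible_iff_measure)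
  then obtain T where T: "open T" "N \<subseteq> T" "T - N \<in> lmeasurable" "emeasure lebesgue (T - N) < ennreal \<delta>"
    using sets_lebesgue_outer_open[of N \<delta>] assms by (metis fmeasurableD)
  have eq: "T = (T - N) \<union> N" using T by auto
  have Tm: "T \<in> lmeasurable" using T N by (subst eq) (rule fmeasurable.Un)
  have "measure lebesgue T \<le> measure lebesgue (T - N) + measure lebesgue N"
    using T N by (subst eq) (rule measure_Un_le, auto)
  also have "\<dots> < \<delta>"
    using T(4) N assms(2) emeasure_eq_measure2[OF T(3)] by (simp add: ennreal_less_iff)
  finally show ?thesis using that T Tm by blast
qed

text \<open>Absolute continuity compensates for the exceptional set. At a point outside
  \<open>N\<close> the gauge is so small that increments of \<open>u\<close> are linear up to an
  error proportional to length. At a point of \<open>N\<close> it confines the interval to an open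
  set whose measure is below the \<open>\<delta>\<close> of absolute continuity, so that the
  increments over all intervals tagged in \<open>N\<close> are small together.\<close>

lemma AC_has_integral:
  fixes u :: "real \<Rightarrow> 'a::euclidean_space"
  assumes ab: "a \<le> b" and ac: "absolutely_continuous_on {a..b} u" and N: "negligible N"
    and der: "\<And>x. x \<in> {a..b} - N \<Longrightarrow> (u has_vector_derivative g x) (at x)"
  shows "(g has_integral u b - u a) {a..b}"
proof -
  \<comment> \<open>With the value 0 on \<open>N\<close>, an interval tagged in \<open>N\<close>
    contributes to the error only its increment of \<open>u\<close>. The change on \<open>N\<close>
    does not affect the integral and is undone at the end.\<close>
  let ?g = "\<lambda>x. if x \<in> N then 0 else g x"
  have "(?g has_integral u b - u a) {a..b}"
    unfolding has_integral_real
  proof (intro allI impI)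
    fix e :: real assume e: "e > 0"
    \<comment> \<open>The summand 1 keeps the quotient meaningful and the inequality for
      \<open>\<eta>\<close> strict when \<open>a = b\<close>.\<close>
    define \<eta> where "\<eta> = e / (2 * (b - a + 1))"
    have \<eta>: "\<eta> > 0" "\<eta> * (b - a) < e / 2"
      using e ab by (simp_all add: \<eta>_def field_simps)
    from ac e obtain \<delta> where \<delta>: "\<delta> > 0" and ac':
      "\<And>D T. D division_of T \<Longrightarrow> T \<subseteq> {a..b} \<Longrightarrow> (\<Sum>k\<in>D. Sup k - Inf k) < \<delta> \<Longrightarrow>
        (\<Sum>k\<in>D. norm (u (Sup k) - u (Inf k))) < e / 2"
      unfolding absolutely_continuous_on_def by (meson half_gt_zero)
    obtain Q where Q: "open Q" "N \<subseteq> Q" "Q \<in> lmeasurable" "measure lebesgue Q < \<delta>"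
      using negligible_outer_open[OF N \<delta>] by blast
    have "\<exists>d>0. (x \<in> N \<longrightarrow> ball x d \<subseteq> Q) \<and>
        (x \<in> {a..b} - N \<longrightarrow> (\<forall>y. \<bar>y - x\<bar> < d \<longrightarrow> norm (u y - u x - (y - x) *\<^sub>R g x) \<le> \<eta> * \<bar>y - x\<bar>))" for x
    proof (cases "x \<in> N")
      case True
      then show ?thesis using Q by (meson DiffE open_contains_ball subsetD)
    next
      case False
      show ?thesis
      proof (cases "x \<in> {a..b}")
        case True
        with der[of x] False have "(u has_derivative (\<lambda>h. h *\<^sub>R g x)) (at x)"
          by (simp add: has_vector_derivative_def)
        then show ?thesis using \<eta> False unfolding has_derivative_at_alt by (metis real_norm_def)
      qed (use False zero_less_one in blast)
    qed
    then obtain d where d: "\<And>x. d x > 0" "\<And>x. x \<in> N \<Longrightarrow> ball x (d x) \<subseteq> Q"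
      "\<And>x y. x \<in> {a..b} - N \<Longrightarrow> \<bar>y - x\<bar> < d x \<Longrightarrow> norm (u y - u x - (y - x) *\<^sub>R g x) \<le> \<eta> * \<bar>y - x\<bar>"
      by metis
    let ?\<gamma> = "\<lambda>x. ball x (d x)"
    have "norm ((\<Sum>(x, k)\<in>p. measure lborel k *\<^sub>R ?g x) - (u b - u a)) < e"
      if p: "p tagged_division_of {a..b}" and fine: "?\<gamma> fine p" for p
    proof -
      let ?d = "\<lambda>k::real set. u (Sup k) - u (Inf k)"
      have K: "\<exists>c e. k = {c..e} \<and> c \<le> x \<and> x \<le> e \<and> Inf k = c \<and> Sup k = e \<and> measure lborel k = e - c \<and> a \<le> c \<and> e \<le> b
           \<and> (\<forall>y\<in>{c..e}. \<bar>y - x\<bar> < d x)"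
        if xk: "(x, k) \<in> p" for x k
      proof -
        obtain c e where k: "k = cbox c e" using tagged_division_ofD(4)[OF p xk] by blast
        have x: "x \<in> k" "k \<subseteq> {a..b}" "k \<subseteq> ball x (d x)"
          using tagged_division_ofD(2,3)[OF p xk] fine xk by (auto simp: fine_def)
        then have "c \<le> e" using k by auto
        with x k show ?thesis
          by (intro exI[of _ c] exI[of _ e]) (auto simp: subset_iff dist_real_def abs_minus_commute)
      qed
      have fin: "finite p" using p by (rule tagged_division_of_finite)
      let ?t = "\<lambda>(x, k). measure lborel k *\<^sub>R ?g x - ?d k"
      define A where "A = {(x, k) \<in> p. x \<in> N}"
      have "(\<Sum>(x, k)\<in>p. measure lborel k *\<^sub>R ?g x) - (u b - u a) = sum ?t p"
        using additive_tagged_division_1[OF ab p, of u]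
        by (simp add: sum_subtractf split_def)
      also have "norm \<dots> \<le> (\<Sum>q\<in>p. norm (?t q))" by (rule norm_sum)
      also have "\<dots> = (\<Sum>q\<in>p - A. norm (?t q)) + (\<Sum>q\<in>A. norm (?t q))"
        by (rule sum.subset_diff) (auto simp: A_def fin)
      also have "(\<Sum>q\<in>p - A. norm (?t q)) \<le> (\<Sum>(x, k)\<in>p - A. \<eta> * measure lborel k)"
      proof (rule sum_mono, clarify)
        fix x k assume xk: "(x, k) \<in> p" "(x, k) \<notin> A"
        obtain c e where k: "k = {c..e}" "c \<le> x" "x \<le> e" "Inf k = c" "Sup k = e" "measure lborel k = e - c" "a \<le> c" "e \<le> b"
          and y: "\<And>y. y \<in> {c..e} \<Longrightarrow> \<bar>y - x\<bar> < d x"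
          using K[OF xk(1)] by metis
        have x: "x \<in> {a..b} - N" using xk k by (auto simp: A_def)
        \<comment> \<open>Both end points are compared with the tag \<open>x\<close> between them,
          so the two errors add up to \<open>\<eta>\<close> times the length of the
          interval.\<close>
        have "norm ((u e - u x - (e - x) *\<^sub>R g x) - (u c - u x - (c - x) *\<^sub>R g x)) \<le> \<eta> * \<bar>e - x\<bar> + \<eta> * \<bar>c - x\<bar>"
          by (intro order_trans[OF norm_triangle_ineq4 add_mono] d(3)[OF x y]) (use k in auto)
        also have "(u e - u x - (e - x) *\<^sub>R g x) - (u c - u x - (c - x) *\<^sub>R g x) = - (measure lborel k *\<^sub>R g x - ?d k)"
          using k by (simp add: algebra_simps)
        also have "\<eta> * \<bar>e - x\<bar> + \<eta> * \<bar>c - x\<bar> = \<eta> * measure lborel k"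
          using k by (simp add: algebra_simps)
        finally show "norm (measure lborel k *\<^sub>R ?g x - ?d k) \<le> \<eta> * measure lborel k"
          using x by (simp add: norm_minus_commute)
      qed
      also have "\<dots> \<le> (\<Sum>(x, k)\<in>p. \<eta> * measure lborel k)"
        by (rule sum_mono2) (use fin \<eta> in auto)
      also have "\<dots> = \<eta> * (b - a)"
        using additive_content_tagged_division[of p a b] p ab
        by (simp add: split_def flip: sum_distrib_left)
      also have "(\<Sum>q\<in>A. norm (?t q)) < e / 2"
      proof -
        have "A \<subseteq> p" by (auto simp: A_def)
        then have "A tagged_partial_division_of {a..b}"
          using p tagged_partial_division_subset[of p "{a..b}" A] by (simp add: tagged_division_of_def)
        then have tag: "A tagged_division_of \<Union>(snd ` A)"
          by (rule tagged_partial_division_of_Union_self)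
        then have div: "snd ` A division_of \<Union>(snd ` A)" by (rule division_of_tagged_division)
        have K': "k \<noteq> {} \<and> k \<subseteq> {a..b} \<and> k \<subseteq> Q \<and> Sup k - Inf k = measure lebesgue k" if k: "k \<in> snd ` A" for k
        proof -
          obtain x where x: "(x, k) \<in> p" "x \<in> N" using k by (auto simp: A_def)
          then show ?thesis using K[OF x(1)] d(2)[OF x(2)]
            by (fastforce simp: subset_iff dist_real_def abs_minus_commute)
        qed
        have "(\<Sum>k\<in>snd ` A. Sup k - Inf k) = (\<Sum>k\<in>snd ` A. measure lebesgue k)"
          by (rule sum.cong) (use K' in auto)
        also have "\<dots> = measure lebesgue (\<Union>(snd ` A))" by (rule content_division[OF div])
        also have "\<dots> \<le> measure lebesgue Q"
          by (rule measure_mono_fmeasurable[OF _ _ Q(3)])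
            (use K' lmeasurable_division[OF div] in auto)
        finally have "(\<Sum>k\<in>snd ` A. norm (?d k)) < e / 2"
          by (intro ac'[OF div]) (use K' Q in auto)
        \<comment> \<open>Passing from tagged intervals to their set is legitimate only if the
          summand vanishes on intervals with empty interior, which several tags may share. It does
          so at single points, and the value at the empty set, where \<open>Sup\<close> and
          \<open>Inf\<close> are unspecified, is put to 0.\<close>
        moreover have "(\<Sum>q\<in>A. norm (?t q)) = (\<Sum>(x, k)\<in>A. if k = {} then 0 else norm (?d k))"
        proof (rule sum.cong)
          fix q assume q: "q \<in> A"
          then have "snd q \<noteq> {}" using K' by blast
          then show "norm (?t q) = (case q of (x, k) \<Rightarrow> if k = {} then 0 else norm (?d k))"
            using q by (cases q) (simp add: A_def norm_minus_commute)
        qed simp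
        moreover have "\<dots> = (\<Sum>k\<in>snd ` A. if k = {} then 0 else norm (?d k))"
          by (rule sum.over_tagged_division_lemma[OF tag]) (auto simp: cbox_interval box_eq_empty)
        moreover have "\<dots> = (\<Sum>k\<in>snd ` A. norm (?d k))"
          by (rule sum.cong) (use K' in auto)
        ultimately show ?thesis by simp
      qed
      finally show ?thesis using \<eta> by simp
    qed
    then show "\<exists>\<gamma>. gauge \<gamma> \<and> (\<forall>p. p tagged_division_of {a..b} \<and> \<gamma> fine p \<longrightarrow>
        norm ((\<Sum>(x, k)\<in>p. measure lborel k *\<^sub>R ?g x) - (u b - u a)) < e)"
      using d(1) by (intro exI[of _ ?\<gamma>]) (simp add: gauge_def)
  qed
  then show ?thesis
    by (rule has_integral_spike[OF N, rotated]) simp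
qed

text \<open>Vitali's theorem covers the points at which the difference quotients stay away from \<open>g\<close> by
  disjoint intervals having such a point as an end point; Henstock's lemma bounds their total length.\<close>

lemma integral_has_vector_derivative_ae:
  fixes g :: "real \<Rightarrow> 'a::euclidean_space"
  assumes g: "g integrable_on {a..b}"
  obtains N where "negligible N"
    "\<And>x. x \<in> {a<..<b} - N \<Longrightarrow> ((\<lambda>t. integral {a..t} g) has_vector_derivative g x) (at x)"
proof -
  define u where "u t = integral {a..t} g" for t
  define bad where "bad \<epsilon> x y \<longleftrightarrow> y \<in> {a<..<b} \<and> y \<noteq> x \<and> norm (u y - u x - (y - x) *\<^sub>R g x) > \<epsilon> * \<bar>y - x\<bar>"
    for \<epsilon> x y
  define E where "E \<epsilon> = {x \<in> {a<..<b}. \<forall>d>0. \<exists>y. bad \<epsilon> x y \<and> \<bar>y - x\<bar> < d}" for \<epsilon>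
  have u_diff: "u y - u x = integral {x..y} g" if "a \<le> x" "x \<le> y" "y \<le> b" for x y
  proof -
    have "g integrable_on {a..y}"
      by (rule integrable_on_subinterval[OF g]) (use that in auto)
    then have "integral {a..x} g + integral {x..y} g = integral {a..y} g"
      using that by (intro Henstock_Kurzweil_Integration.integral_combine)
    then show ?thesis unfolding u_def by (metis add_diff_cancel_left')
  qed
  have negE: "negligible (E \<epsilon>)" if \<epsilon>: "\<epsilon> > 0" for \<epsilon>
    unfolding negligible_outer_le
  proof (intro allI impI)
    fix \<eta> :: real assume \<eta>: "\<eta> > 0"
    have "g integrable_on cbox a b" "0 < \<eta> * \<epsilon>" using g \<epsilon> \<eta> by simp_all
    then obtain \<gamma> where \<gamma>: "gauge \<gamma>" and hen: "\<And>p. p tagged_partial_division_of (cbox a b) \<Longrightarrow> \<gamma> fine p \<Longrightarrow>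
       (\<Sum>(x,k)\<in>p. norm (measure lborel k *\<^sub>R g x - integral k g)) < \<eta> * \<epsilon>"
      by (rule Henstock_lemma) blast
    \<comment> \<open>An index records a bad point \<open>x\<close> and a far end \<open>y\<close>.
      Requiring the interval between them to lie in \<open>\<gamma> x\<close> makes every finite
      disjoint subfamily a fine partial division, tagged at the bad points, as Henstock's lemma
      demands.\<close>
    define K where "K = {(x, y). x \<in> E \<epsilon> \<and> bad \<epsilon> x y \<and> {min x y..max x y} \<subseteq> \<gamma> x}"
    \<comment> \<open>The covering theorem speaks of balls, so the interval is presented as the
      closed ball about its midpoint.\<close>
    let ?c = "\<lambda>(x::real, y). (x + y) / 2" and ?r = "\<lambda>(x::real, y). \<bar>x - y\<bar> / 2"
    let ?I = "\<lambda>i. cball (?c i) (?r i)"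
    have half: "(p + q) / 2 - (q - p) / 2 = p" "(p + q) / 2 + (q - p) / 2 = q" for p q :: real
      by (simp_all flip: diff_divide_distrib add_divide_distrib)
    have I: "?I (x, y) = {min x y..max x y}" for x y
    proof (cases "x \<le> y")
      case True
      then have "\<bar>x - y\<bar> = y - x" by simp
      with True half[of x y] show ?thesis by (simp only: cball_eq_atLeastAtMost prod.case min_def max_def if_True)
    next
      case False
      then have "\<bar>x - y\<bar> = x - y" by simp
      with False half[of y x] show ?thesis
        by (simp only: cball_eq_atLeastAtMost prod.case min_def max_def if_False add.commute[of x y])
    qed
    obtain C where C: "countable C" "C \<subseteq> K" "pairwise (\<lambda>i j. disjnt (?I i) (?I j)) C"
      and neg: "negligible (E \<epsilon> - (\<Union>i\<in>C. ?I i))"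
    proof (rule Vitali_covering_theorem_cballs[of K ?r "E \<epsilon>" ?c])
      show "0 < ?r i" if "i \<in> K" for i using that by (auto simp: K_def bad_def)
      fix x d :: real assume x: "x \<in> E \<epsilon>" and d: "0 < d"
      have "open (\<gamma> x)" "x \<in> \<gamma> x" using \<gamma> by (auto simp: gauge_def)
      then obtain d' where d': "d' > 0" "ball x d' \<subseteq> \<gamma> x" by (rule openE)
      have "min d d' > 0" using d d' by simp
      then obtain y where y: "bad \<epsilon> x y" "\<bar>y - x\<bar> < min d d'"
        using x unfolding E_def by blast
      have "{min x y..max x y} \<subseteq> ball x d'"
        using y by (auto simp: dist_real_def abs_if min_def max_def split: if_splits)
      then show "\<exists>i. i \<in> K \<and> x \<in> ?I i \<and> ?r i < d"
        using x y d' I[of x y] by (intro exI[of _ "(x, y)"]) (auto simp: K_def)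
    qed
    have fin: "measure lebesgue (\<Union>i\<in>F. ?I i) \<le> \<eta>" if F: "F \<subseteq> C" "finite F" for F
    proof -
      define p where "p = (\<lambda>i. (fst i, ?I i)) ` F"
      have mem: "x \<in> E \<epsilon>" "bad \<epsilon> x y" "{min x y..max x y} \<subseteq> \<gamma> x" "x \<in> {a<..<b}" "y \<in> {a<..<b}" if "(x, y) \<in> F" for x y
        using that F C by (auto simp: K_def E_def bad_def)
      have disj: "?I i \<inter> ?I j = {}" if "i \<in> F" "j \<in> F" "i \<noteq> j" for i j
        using C(3) F that unfolding pairwise_def disjnt_def by blast
      have inj: "inj_on (\<lambda>i. (fst i, ?I i)) F"
      proof (rule inj_onI, rule ccontr)
        fix i j assume ij: "i \<in> F" "j \<in> F" "(fst i, ?I i) = (fst j, ?I j)" "i \<noteq> j"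
        have "fst i \<in> ?I i" using I[of "fst i" "snd i"] by simp
        moreover have "?I i = ?I j" using ij(3) by (simp only: prod.inject)
        ultimately show False using disj[OF ij(1,2,4)] by blast
      qed
      have "p tagged_partial_division_of cbox a b"
        unfolding tagged_partial_division_of_def
      proof (intro conjI allI impI)
        show "finite p" using F by (simp add: p_def)
        fix x k assume "(x, k) \<in> p"
        then obtain y where y: "(x, y) \<in> F" "k = {min x y..max x y}"
          unfolding p_def using I by auto
        show "x \<in> k" "k \<subseteq> cbox a b" "\<exists>c e. k = cbox c e"
          using y mem(4,5)[OF y(1)] by (auto simp: cbox_interval)
      next
        fix x1 k1 x2 k2 assume "(x1, k1) \<in> p \<and> (x2, k2) \<in> p \<and> (x1, k1) \<noteq> (x2, k2)"
        then have "k1 \<inter> k2 = {}" using disj unfolding p_def by blast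
        then show "interior k1 \<inter> interior k2 = {}"
          using interior_subset by blast
      qed
      moreover have "\<gamma> fine p"
      proof -
        have "?I i \<subseteq> \<gamma> (fst i)" if "i \<in> F" for i
        proof -
          obtain x y where i: "i = (x, y)" by force
          show ?thesis using mem(3)[OF that[unfolded i]] unfolding i I by simp
        qed
        then show ?thesis unfolding fine_def p_def by blast
      qed
      ultimately have sum: "(\<Sum>(x,k)\<in>p. norm (measure lborel k *\<^sub>R g x - integral k g)) < \<eta> * \<epsilon>"
        by (rule hen)
      have each: "\<epsilon> * measure lebesgue (?I i) \<le> norm (measure lborel (?I i) *\<^sub>R g (fst i) - integral (?I i) g)"
        if "i \<in> F" for i
      proof -
        obtain x y where i: "i = (x, y)" by force
        note m = mem[OF that[unfolded i]]
        have "norm (measure lborel (?I i) *\<^sub>R g x - integral (?I i) g) = norm (u y - u x - (y - x) *\<^sub>R g x)"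
        proof (cases "x \<le> y")
          case True
          then have "integral (?I i) g = u y - u x" "measure lborel (?I i) = y - x"
            using u_diff[of x y] m unfolding i I by auto
          then show ?thesis by (simp add: norm_minus_commute)
        next
          case False
          then have e: "integral (?I i) g = u x - u y" "measure lborel (?I i) = x - y"
            using u_diff[of y x] m unfolding i I by auto
          show ?thesis unfolding e by (simp add: algebra_simps)
        qed
        moreover have "measure lebesgue (?I i) = \<bar>y - x\<bar>" unfolding i I by (cases "x \<le> y") auto
        ultimately show ?thesis using m(2) by (simp add: bad_def i)
      qed
      \<comment> \<open>Each chosen interval has a Henstock error of at least
        \<open>\<epsilon>\<close> times its length, whereas all errors together stay below
        \<open>\<eta> * \<epsilon>\<close>. Hence the total length is at most \<open>\<eta>\<close>,
        uniformly over finite subfamilies.\<close>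
      have "measure lebesgue (\<Union>i\<in>F. ?I i) * \<epsilon> \<le> (\<Sum>i\<in>F. measure lebesgue (?I i)) * \<epsilon>"
        by (intro mult_right_mono measure_UNION_le) (use F \<epsilon> in auto)
      also have "\<dots> \<le> (\<Sum>i\<in>F. norm (measure lborel (?I i) *\<^sub>R g (fst i) - integral (?I i) g))"
        unfolding sum_distrib_right by (rule sum_mono) (use each in \<open>simp add: mult.commute\<close>)
      also have "\<dots> = (\<Sum>(x,k)\<in>p. norm (measure lborel k *\<^sub>R g x - integral k g))"
        unfolding p_def by (subst sum.reindex[OF inj]) (simp add: o_def)
      also have "\<dots> < \<eta> * \<epsilon>" by (rule sum)
      finally show ?thesis using \<epsilon> by (simp add: mult_less_cancel_right_pos)
    qed
    let ?U = "\<Union>i\<in>C. ?I i"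
    have U: "?U \<in> lmeasurable" "measure lebesgue ?U \<le> \<eta>"
      by (rule fmeasurable_UN_bound[OF C(1) _ fin] measure_UN_bound[OF C(1) _ fin]; simp)+
    show "\<exists>T. E \<epsilon> \<subseteq> T \<and> T \<in> lmeasurable \<and> measure lebesgue T \<le> \<eta>"
    proof (intro exI[of _ "?U \<union> (E \<epsilon> - ?U)"] conjI)
      have n: "E \<epsilon> - ?U \<in> lmeasurable" "measure lebesgue (E \<epsilon> - ?U) = 0"
        using neg by (auto simp: negligible_iff_measure)
      show "?U \<union> (E \<epsilon> - ?U) \<in> lmeasurable" using U n by (intro fmeasurable.Un)
      show "measure lebesgue (?U \<union> (E \<epsilon> - ?U)) \<le> \<eta>"
        using measure_Un_le[of ?U lebesgue "E \<epsilon> - ?U"] U n by (simp add: fmeasurableD)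
    qed blast
  qed
  show ?thesis
  proof
    show "negligible (\<Union>n. E (inverse (real (Suc n))))"
      by (rule negligible_countable_Union) (use negE in auto)
    fix x assume x: "x \<in> {a<..<b} - (\<Union>n. E (inverse (real (Suc n))))"
    show "((\<lambda>t. integral {a..t} g) has_vector_derivative g x) (at x)"
      unfolding u_def[symmetric] has_vector_derivative_def has_derivative_at_alt
    proof (intro conjI allI impI bounded_linear_scaleR_left)
      fix e :: real assume "0 < e"
      then obtain n where n: "inverse (real (Suc n)) < e" using reals_Archimedean by blast
      have "x \<notin> E (inverse (real (Suc n)))" using x by blast
      then have "\<not> (\<forall>d>0. \<exists>y. bad (inverse (real (Suc n))) x y \<and> \<bar>y - x\<bar> < d)"
        using x by (simp add: E_def)
      then obtain d where d: "d > 0" "\<And>y. \<bar>y - x\<bar> < d \<Longrightarrow> \<not> bad (inverse (real (Suc n))) x y"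
        by meson
      have ab: "0 < min (x - a) (b - x)" using x by auto
      show "\<exists>d>0. \<forall>y. norm (y - x) < d \<longrightarrow> norm (u y - u x - (y - x) *\<^sub>R g x) \<le> e * norm (y - x)"
      proof (intro exI[of _ "min d (min (x - a) (b - x))"] conjI allI impI)
        fix y assume y: "norm (y - x) < min d (min (x - a) (b - x))"
        then have "norm (u y - u x - (y - x) *\<^sub>R g x) \<le> inverse (real (Suc n)) * \<bar>y - x\<bar>"
          using d(2)[of y] by (cases "y = x") (auto simp: bad_def abs_less_iff)
        also have "\<dots> \<le> e * norm (y - x)" using n by (simp add: mult_right_mono)
        finally show "norm (u y - u x - (y - x) *\<^sub>R g x) \<le> e * norm (y - x)" .
      qed (use d ab in auto)
    qed
  qed
qed

text \<open>Solutions of the differential equation are locally Lipschitz in time, because the fields are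
  bounded on smaller balls; unlike absolute continuity this passes easily to products and
  concatenations.\<close>

definition lip_primitive :: "(real \<Rightarrow> 'a::real_normed_vector) \<Rightarrow> (real \<Rightarrow> 'a) \<Rightarrow> bool" where
  "lip_primitive u g \<longleftrightarrow>
     (\<forall>T. \<exists>C\<ge>0. \<forall>s\<in>{0..T}. \<forall>t\<in>{0..T}. norm (u s - u t) \<le> C * \<bar>s - t\<bar>) \<and>
     negligible {t. 0 < t \<and> \<not> (u has_vector_derivative g t) (at t)}"

section \<open>Calculus of locally Lipschitz primitives\<close>

lemma lip_primitiveE:
  assumes "lip_primitive u g"
  obtains C where "C \<ge> 0" "\<And>s t. s \<in> {0..T} \<Longrightarrow> t \<in> {0..T} \<Longrightarrow> norm (u s - u t) \<le> C * \<bar>s - t\<bar>"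
  using assms unfolding lip_primitive_def by meson

lemma lip_primitive_cong:
  assumes "lip_primitive u g" "\<And>t. t > 0 \<Longrightarrow> g t = h t"
  shows "lip_primitive u h"
proof -
  have "{t. 0 < t \<and> \<not> (u has_vector_derivative h t) (at t)} = {t. 0 < t \<and> \<not> (u has_vector_derivative g t) (at t)}"
    using assms(2) by auto
  with assms(1) show ?thesis by (simp add: lip_primitive_def)
qed

lemma division_endpoints:
  fixes D :: "real set set"
  assumes "D division_of T" "T \<subseteq> {a..b}" "k \<in> D"
  shows "Inf k \<in> {a..b}" "Sup k \<in> {a..b}" "Inf k \<le> Sup k"
proof -
  obtain c d where k: "k = cbox c d" using division_ofD(4)[OF assms(1,3)] by blast
  have "k \<noteq> {}" "k \<subseteq> {a..b}" using division_ofD(2,3)[OF assms(1,3)] assms(2) by auto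
  then show "Inf k \<in> {a..b}" "Sup k \<in> {a..b}" "Inf k \<le> Sup k" using k by auto
qed

lemma Lipschitz_imp_AC:
  assumes C: "C \<ge> 0" and L: "\<And>s t. s \<in> {a..b} \<Longrightarrow> t \<in> {a..b} \<Longrightarrow> norm (u s - u t) \<le> C * \<bar>s - t\<bar>"
  shows "absolutely_continuous_on {a..b} u"
  unfolding absolutely_continuous_on_def
proof (intro allI impI)
  fix e :: real assume e: "e > 0"
  show "\<exists>\<delta>>0. \<forall>D T. D division_of T \<and> T \<subseteq> {a..b} \<and> (\<Sum>k\<in>D. Sup k - Inf k) < \<delta> \<longrightarrow>
        (\<Sum>k\<in>D. norm (u (Sup k) - u (Inf k))) < e"
  proof (intro exI[of _ "e / (C + 1)"] conjI allI impI; (elim conjE)?)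
    show "0 < e / (C + 1)" using e C by simp
    fix D T assume D: "D division_of T" "T \<subseteq> {a..b}" "(\<Sum>k\<in>D. Sup k - Inf k) < e / (C + 1)"
    have "(\<Sum>k\<in>D. norm (u (Sup k) - u (Inf k))) \<le> (\<Sum>k\<in>D. C * (Sup k - Inf k))"
    proof (rule sum_mono)
      fix k assume k: "k \<in> D"
      show "norm (u (Sup k) - u (Inf k)) \<le> C * (Sup k - Inf k)"
        using L[of "Sup k" "Inf k"] division_endpoints[OF D(1,2) k] by auto
    qed
    also have "\<dots> = C * (\<Sum>k\<in>D. Sup k - Inf k)" by (simp add: sum_distrib_left)
    also have "\<dots> \<le> C * (e / (C + 1))" using D C by (intro mult_left_mono) auto
    also have "\<dots> < e" using e C by (simp add: field_simps)
    finally show "(\<Sum>k\<in>D. norm (u (Sup k) - u (Inf k))) < e" .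
  qed
qed

lemma lip_primitive_has_integral:
  fixes u :: "real \<Rightarrow> 'a::euclidean_space"
  assumes u: "lip_primitive u g" and ab: "0 \<le> a" "a \<le> b"
  shows "(g has_integral u b - u a) {a..b}"
proof -
  obtain C where C: "C \<ge> 0" "\<And>s t. s \<in> {0..b} \<Longrightarrow> t \<in> {0..b} \<Longrightarrow> norm (u s - u t) \<le> C * \<bar>s - t\<bar>"
    using lip_primitiveE[OF u, of b] by blast
  have ac: "absolutely_continuous_on {a..b} u"
    by (rule Lipschitz_imp_AC[OF C(1)]) (use C(2) ab in auto)
  show ?thesis
  proof (rule AC_has_integral[OF ab(2) ac])
    \<comment> \<open>Differentiability is recorded for positive times only, so the time 0 joins the
      exceptional set.\<close>
    show "negligible (insert 0 {t. 0 < t \<and> \<not> (u has_vector_derivative g t) (at t)})"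
      using u by (simp add: lip_primitive_def)
  qed (use ab in auto)
qed

lemma lip_primitive_norm_le:
  fixes u :: "real \<Rightarrow> 'a::euclidean_space"
  assumes "lip_primitive u g" "0 \<le> a" "a \<le> b" "M \<ge> 0" "\<And>t. t \<in> {a..b} \<Longrightarrow> norm (g t) \<le> M"
  shows "norm (u b - u a) \<le> M * (b - a)"
  using has_integral_bound_real[of M "{}" g "u b - u a" a b] lip_primitive_has_integral[OF assms(1-3)] assms
  by simp

lemma lip_primitive_AC:
  assumes "lip_primitive u g" shows "absolutely_continuous_on {0..T} u"
  by (rule lip_primitiveE[OF assms, of T], rule Lipschitz_imp_AC) auto

lemma AC_imp_continuous_on:
  assumes ac: "absolutely_continuous_on {a..b} u"
  shows "continuous_on {a..b} u"
  unfolding continuous_on_iff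
proof (intro ballI allI impI)
  fix x e :: real assume x: "x \<in> {a..b}" and e: "e > 0"
  from ac e obtain \<delta> where \<delta>: "\<delta> > 0" and ac':
      "\<And>D T. D division_of T \<Longrightarrow> T \<subseteq> {a..b} \<Longrightarrow> (\<Sum>k\<in>D. Sup k - Inf k) < \<delta> \<Longrightarrow>
        (\<Sum>k\<in>D. norm (u (Sup k) - u (Inf k))) < e"
    unfolding absolutely_continuous_on_def by meson
  show "\<exists>d>0. \<forall>x'\<in>{a..b}. dist x' x < d \<longrightarrow> dist (u x') (u x) < e"
  proof (intro exI[of _ \<delta>] conjI ballI impI \<delta>)
    fix y assume y: "y \<in> {a..b}" "dist y x < \<delta>"
    let ?k = "{min x y..max x y}"
    have "{?k} division_of ?k"
      using division_of_self[of "min x y" "max x y"] by (simp add: cbox_interval)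
    then have "norm (u (max x y) - u (min x y)) < e"
      using ac'[of "{?k}" ?k] x y by (auto simp: dist_real_def abs_if split: if_splits)
    then show "dist (u y) (u x) < e"
      by (auto simp: dist_norm min_def max_def norm_minus_commute split: if_splits)
  qed
qed

lemma lip_primitive_continuous_on: "lip_primitive u g \<Longrightarrow> continuous_on {0..T} u"
  by (rule AC_imp_continuous_on[OF lip_primitive_AC])

lemma lip_primitive_nonincreasing:
  fixes u :: "real \<Rightarrow> real"
  assumes "lip_primitive u g" "0 \<le> a" "a \<le> b" "\<And>t. t \<in> {a..b} \<Longrightarrow> g t \<le> 0"
  shows "u b \<le> u a"
  using has_integral_le[OF lip_primitive_has_integral[OF assms(1-3)] has_integral_0] assms(4) by simp

text \<open>Both factors are bounded on compact intervals, which makes the product Lipschitz there.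
  The bilinear map is left general because products of reals, scaled vectors and inner products all
  occur below.\<close>

lemma lip_primitive_bilinear:
  assumes bb: "bounded_bilinear bil" and u: "lip_primitive u g" and v: "lip_primitive v h"
  shows "lip_primitive (\<lambda>t. bil (u t) (v t)) (\<lambda>t. bil (u t) (h t) + bil (g t) (v t))"
  unfolding lip_primitive_def
proof (intro conjI allI)
  interpret bounded_bilinear bil by (rule bb)
  fix T :: real
  obtain K where K: "K > 0" "\<And>x y. norm (bil x y) \<le> norm x * norm y * K"
    using pos_bounded by blast
  obtain C where C: "C \<ge> 0" "\<And>s t. s \<in> {0..T} \<Longrightarrow> t \<in> {0..T} \<Longrightarrow> norm (u s - u t) \<le> C * \<bar>s - t\<bar>"
    using lip_primitiveE[OF u, of T] by blast
  obtain C' where C': "C' \<ge> 0" "\<And>s t. s \<in> {0..T} \<Longrightarrow> t \<in> {0..T} \<Longrightarrow> norm (v s - v t) \<le> C' * \<bar>s - t\<bar>"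
    using lip_primitiveE[OF v, of T] by blast
  obtain M where M: "M > 0" "\<And>t. t \<in> {0..T} \<Longrightarrow> norm (u t) \<le> M"
    using compact_imp_bounded[OF compact_continuous_image[OF lip_primitive_continuous_on[OF u] compact_Icc]]
    unfolding bounded_pos by blast
  obtain M' where M': "M' > 0" "\<And>t. t \<in> {0..T} \<Longrightarrow> norm (v t) \<le> M'"
    using compact_imp_bounded[OF compact_continuous_image[OF lip_primitive_continuous_on[OF v] compact_Icc]]
    unfolding bounded_pos by blast
  show "\<exists>C\<ge>0. \<forall>s\<in>{0..T}. \<forall>t\<in>{0..T}. norm (bil (u s) (v s) - bil (u t) (v t)) \<le> C * \<bar>s - t\<bar>"
  proof (intro exI[of _ "(M * C' + C * M') * K"] conjI ballI)
    show "0 \<le> (M * C' + C * M') * K" using M M' C C' K by simp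
    fix s t assume st: "s \<in> {0..T}" "t \<in> {0..T}"
    have "norm (bil (u s) (v s) - bil (u t) (v t)) = norm (bil (u s) (v s - v t) + bil (u s - u t) (v t))"
      by (simp add: diff_left diff_right)
    also have "\<dots> \<le> norm (u s) * norm (v s - v t) * K + norm (u s - u t) * norm (v t) * K"
      by (rule order_trans[OF norm_triangle_ineq add_mono[OF K(2) K(2)]])
    also have "\<dots> \<le> M * (C' * \<bar>s - t\<bar>) * K + (C * \<bar>s - t\<bar>) * M' * K"
      using st C C' M M' K by (intro add_mono mult_right_mono mult_mono) auto
    finally show "norm (bil (u s) (v s) - bil (u t) (v t)) \<le> (M * C' + C * M') * K * \<bar>s - t\<bar>"
      by (simp add: algebra_simps)
  qed
next
  interpret bounded_bilinear bil by (rule bb)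
  let ?P = "\<lambda>u g. {t. 0 < t \<and> \<not> (u has_vector_derivative g t) (at t)}"
  have "negligible (?P u g \<union> ?P v h)" using u v by (intro negligible_Un) (simp_all add: lip_primitive_def)
  then show "negligible (?P (\<lambda>t. bil (u t) (v t)) (\<lambda>t. bil (u t) (h t) + bil (g t) (v t)))"
  proof (rule negligible_subset, safe)
    fix t assume "(u has_vector_derivative g t) (at t)" "(v has_vector_derivative h t) (at t)"
      and neg: "\<not> ((\<lambda>t. bil (u t) (v t)) has_vector_derivative bil (u t) (h t) + bil (g t) (v t)) (at t)"
    then show "False"
      unfolding has_vector_derivative_def
      using FDERIV[of u "\<lambda>x. x *\<^sub>R g t" t UNIV v "\<lambda>x. x *\<^sub>R h t"]
      by (simp add: scaleR_left scaleR_right scaleR_add_right)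
  qed
qed

lemma lip_primitive_exp: "lip_primitive (\<lambda>t. exp (c * t)) (\<lambda>t. c * exp (c * t))"
  unfolding lip_primitive_def
proof (intro conjI allI)
  fix T :: real
  show "\<exists>C\<ge>0. \<forall>s\<in>{0..T}. \<forall>t\<in>{0..T}. norm (exp (c * s) - exp (c * t)) \<le> C * \<bar>s - t\<bar>"
  proof (intro exI[of _ "\<bar>c\<bar> * exp (\<bar>c\<bar> * T)"] conjI ballI)
    fix s t assume st: "s \<in> {0..T}" "t \<in> {0..T}"
    have "norm (exp (c * s) - exp (c * t)) \<le> \<bar>c\<bar> * exp (\<bar>c\<bar> * T) * norm (s - t)"
    proof (rule field_differentiable_bound[where S="{0..T}" and f'="\<lambda>t. c * exp (c * t)"])
      fix z assume z: "z \<in> {0..T}"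
      show "((\<lambda>t. exp (c * t)) has_field_derivative c * exp (c * z)) (at z within {0..T})"
        by (auto intro!: derivative_eq_intros)
      have "c * z \<le> \<bar>c\<bar> * T" using z by (intro mult_mono) auto
      then show "norm (c * exp (c * z)) \<le> \<bar>c\<bar> * exp (\<bar>c\<bar> * T)"
        by (simp add: abs_mult mult_left_mono)
    qed (use st in auto)
    then show "norm (exp (c * s) - exp (c * t)) \<le> \<bar>c\<bar> * exp (\<bar>c\<bar> * T) * \<bar>s - t\<bar>" by simp
  qed simp
next
  have "((\<lambda>t. exp (c * t)) has_vector_derivative c * exp (c * t)) (at t)" for t
    unfolding has_real_derivative_iff_has_vector_derivative[symmetric]
    by (auto intro!: derivative_eq_intros)
  then show "negligible {t. 0 < t \<and> \<not> ((\<lambda>t. exp (c * t)) has_vector_derivative c * exp (c * t)) (at t)}"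
    by simp
qed

text \<open>The integrating factor \<open>exp (- c * t)\<close> turns the differential inequality
  into monotonicity. The sign of \<open>c\<close> is free: negative values give decay of solutions,
  positive ones give uniqueness.\<close>

lemma lip_primitive_Gronwall:
  fixes u :: "real \<Rightarrow> real"
  assumes u: "lip_primitive u g" and ab: "0 \<le> a" "a \<le> b" and le: "\<And>t. t \<in> {a..b} \<Longrightarrow> g t \<le> c * u t"
  shows "u b \<le> exp (c * (b - a)) * u a"
proof -
  have "exp (- c * b) * u b \<le> exp (- c * a) * u a"
  proof (rule lip_primitive_nonincreasing[OF lip_primitive_bilinear[OF bounded_bilinear_mult lip_primitive_exp u] ab])
    fix t assume "t \<in> {a..b}"
    then have "exp (- c * t) * (g t - c * u t) \<le> 0"
      using le by (simp add: mult_le_0_iff)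
    then show "exp (- c * t) * g t + - c * exp (- c * t) * u t \<le> 0"
      by (simp add: algebra_simps)
  qed
  then have "exp (c * b) * (exp (- c * b) * u b) \<le> exp (c * b) * (exp (- c * a) * u a)"
    by (intro mult_left_mono) auto
  then show ?thesis
    by (simp add: algebra_simps flip: exp_add mult.assoc)
qed

lemma lip_primitive_diff:
  assumes u: "lip_primitive u g" and v: "lip_primitive v h"
  shows "lip_primitive (\<lambda>t. u t - v t) (\<lambda>t. g t - h t)"
  unfolding lip_primitive_def
proof (intro conjI allI)
  fix T :: real
  obtain C where C: "C \<ge> 0" "\<And>s t. s \<in> {0..T} \<Longrightarrow> t \<in> {0..T} \<Longrightarrow> norm (u s - u t) \<le> C * \<bar>s - t\<bar>"
    using lip_primitiveE[OF u, of T] by blast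
  obtain C' where C': "C' \<ge> 0" "\<And>s t. s \<in> {0..T} \<Longrightarrow> t \<in> {0..T} \<Longrightarrow> norm (v s - v t) \<le> C' * \<bar>s - t\<bar>"
    using lip_primitiveE[OF v, of T] by blast
  show "\<exists>C\<ge>0. \<forall>s\<in>{0..T}. \<forall>t\<in>{0..T}. norm (u s - v s - (u t - v t)) \<le> C * \<bar>s - t\<bar>"
  proof (intro exI[of _ "C + C'"] conjI ballI)
    fix s t assume st: "s \<in> {0..T}" "t \<in> {0..T}"
    have "norm (u s - v s - (u t - v t)) \<le> norm (u s - u t) + norm (v s - v t)"
      using norm_triangle_ineq4[of "u s - u t" "v s - v t"] by (simp add: algebra_simps)
    then show "norm (u s - v s - (u t - v t)) \<le> (C + C') * \<bar>s - t\<bar>"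
      using C(2)[OF st] C'(2)[OF st] by (simp add: algebra_simps)
  qed (use C C' in simp)
next
  let ?P = "\<lambda>u g. {t. 0 < t \<and> \<not> (u has_vector_derivative g t) (at t)}"
  have "negligible (?P u g \<union> ?P v h)" using u v by (intro negligible_Un) (simp_all add: lip_primitive_def)
  then show "negligible (?P (\<lambda>t. u t - v t) (\<lambda>t. g t - h t))"
    by (rule negligible_subset) (auto intro: has_vector_derivative_diff)
qed

lemma lip_primitive_shift:
  assumes u: "lip_primitive u g" and s: "s \<ge> 0"
  shows "lip_primitive (\<lambda>t. u (t + s)) (\<lambda>t. g (t + s))"
  unfolding lip_primitive_def
proof (intro conjI allI)
  fix T :: real
  obtain C where C: "C \<ge> 0" "\<And>a t. a \<in> {0..T + s} \<Longrightarrow> t \<in> {0..T + s} \<Longrightarrow> norm (u a - u t) \<le> C * \<bar>a - t\<bar>"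
    using lip_primitiveE[OF u, of "T + s"] by blast
  show "\<exists>C\<ge>0. \<forall>a\<in>{0..T}. \<forall>t\<in>{0..T}. norm (u (a + s) - u (t + s)) \<le> C * \<bar>a - t\<bar>"
  proof (intro exI[of _ C] conjI ballI)
    fix a t assume "a \<in> {0..T}" "t \<in> {0..T}"
    then show "norm (u (a + s) - u (t + s)) \<le> C * \<bar>a - t\<bar>"
      using C(2)[of "a + s" "t + s"] s by simp
  qed (use C in simp)
next
  have "negligible ((+) (- s) ` {t. 0 < t \<and> \<not> (u has_vector_derivative g t) (at t)})"
    using u by (intro negligible_translation) (simp add: lip_primitive_def)
  then show "negligible {t. 0 < t \<and> \<not> ((\<lambda>t. u (t + s)) has_vector_derivative g (t + s)) (at t)}"
  proof (rule negligible_subset, safe)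
    fix t assume t: "0 < t" "\<not> ((\<lambda>t. u (t + s)) has_vector_derivative g (t + s)) (at t)"
    have "\<not> (u has_vector_derivative g (t + s)) (at (t + s))"
    proof
      assume "(u has_vector_derivative g (t + s)) (at (t + s))"
      then have "((u \<circ> (\<lambda>t. t + s)) has_vector_derivative 1 *\<^sub>R g (t + s)) (at t)"
        by (intro vector_diff_chain_at) (auto intro!: derivative_eq_intros)
      with t show False by (simp add: o_def)
    qed
    then show "t \<in> (+) (- s) ` {t. 0 < t \<and> \<not> (u has_vector_derivative g t) (at t)}"
      using t s by (intro image_eqI[of _ _ "t + s"]) auto
  qed
qed

text \<open>The junction \<open>s\<close> joins the exceptional set, since the one-sided derivatives
  may differ there. The Lipschitz bound across it follows by inserting the common value
  \<open>u s = v 0\<close>.\<close>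

lemma lip_primitive_concat:
  assumes u: "lip_primitive u g" and v: "lip_primitive v h" and s: "s \<ge> 0" and eq: "u s = v 0"
  shows "lip_primitive (\<lambda>t. if t \<le> s then u t else v (t - s)) (\<lambda>t. if t \<le> s then g t else h (t - s))"
    (is "lip_primitive ?w ?k")
  unfolding lip_primitive_def
proof (intro conjI allI)
  fix T :: real
  obtain C where C: "C \<ge> 0" "\<And>a t. a \<in> {0..max s T} \<Longrightarrow> t \<in> {0..max s T} \<Longrightarrow> norm (u a - u t) \<le> C * \<bar>a - t\<bar>"
    using lip_primitiveE[OF u, of "max s T"] by blast
  obtain C' where C': "C' \<ge> 0" "\<And>a t. a \<in> {0..T} \<Longrightarrow> t \<in> {0..T} \<Longrightarrow> norm (v a - v t) \<le> C' * \<bar>a - t\<bar>"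
    using lip_primitiveE[OF v, of T] by blast
  have le: "norm (?w a - ?w t) \<le> (C + C') * \<bar>a - t\<bar>" if at: "a \<in> {0..T}" "t \<in> {0..T}" "a \<le> t" for a t
  proof -
    consider "t \<le> s" | "a > s" | "a \<le> s" "s < t" by linarith
    then show ?thesis
    proof cases
      case 1
      then have "norm (?w a - ?w t) \<le> C * \<bar>a - t\<bar>" using C(2)[of a t] at by simp
      then show ?thesis using C' by (simp add: distrib_right add_increasing2)
    next
      case 2
      then have "norm (?w a - ?w t) \<le> C' * \<bar>a - t\<bar>" using C'(2)[of "a - s" "t - s"] at s by simp
      then show ?thesis using C by (simp add: distrib_right add_increasing)
    next
      case 3
      have "norm (u a - v (t - s)) \<le> norm (u a - u s) + norm (v 0 - v (t - s))"
        using norm_triangle_ineq[of "u a - u s" "v 0 - v (t - s)"] eq by simp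
      also have "\<dots> \<le> C * \<bar>a - s\<bar> + C' * \<bar>0 - (t - s)\<bar>"
        by (intro add_mono C C') (use at 3 s in auto)
      also have "\<dots> \<le> C * \<bar>a - t\<bar> + C' * \<bar>a - t\<bar>"
        using 3 C C' by (intro add_mono mult_left_mono) auto
      finally show ?thesis using 3 by (simp add: distrib_right)
    qed
  qed
  show "\<exists>C\<ge>0. \<forall>a\<in>{0..T}. \<forall>t\<in>{0..T}. norm (?w a - ?w t) \<le> C * \<bar>a - t\<bar>"
  proof (intro exI[of _ "C + C'"] conjI ballI)
    fix a t assume "a \<in> {0..T}" "t \<in> {0..T}"
    then show "norm (?w a - ?w t) \<le> (C + C') * \<bar>a - t\<bar>"
      using le[of a t] le[of t a] by (cases "a \<le> t") (simp_all only: norm_minus_commute abs_minus_commute linear not_le)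
  qed (use C C' in simp)
next
  let ?P = "\<lambda>u g. {t. 0 < t \<and> \<not> (u has_vector_derivative g t) (at t)}"
  have "negligible ({s} \<union> (?P u g \<union> (+) s ` ?P v h))"
    using u v by (intro negligible_Un negligible_translation) (simp_all add: lip_primitive_def)
  then show "negligible (?P ?w ?k)"
  proof (rule negligible_subset, intro subsetI)
    fix t assume t: "t \<in> ?P ?w ?k"
    consider "t = s" | "t < s" | "t > s" by linarith
    then show "t \<in> {s} \<union> (?P u g \<union> (+) s ` ?P v h)"
    proof cases
      case 2
      have "\<not> (u has_vector_derivative g t) (at t)"
      proof
        assume "(u has_vector_derivative g t) (at t)"
        then have "(?w has_vector_derivative g t) (at t)"
          by (rule has_vector_derivative_transform_within_open[where S="{..<s}"]) (use 2 in auto)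
        with t 2 show False by simp
      qed
      with t show ?thesis by simp
    next
      case 3
      have "\<not> (v has_vector_derivative h (t - s)) (at (t - s))"
      proof
        assume "(v has_vector_derivative h (t - s)) (at (t - s))"
        then have "((v \<circ> (\<lambda>t. t - s)) has_vector_derivative 1 *\<^sub>R h (t - s)) (at t)"
          by (intro vector_diff_chain_at) (auto intro!: derivative_eq_intros)
        then have "(?w has_vector_derivative 1 *\<^sub>R h (t - s)) (at t)"
          by (rule has_vector_derivative_transform_within_open[where S="{s<..}"]) (use 3 in auto)
        with t 3 show False by simp
      qed
      then have "t - s \<in> ?P v h" using 3 by simp
      then have "s + (t - s) \<in> (+) s ` ?P v h" by (rule imageI)
      then show ?thesis by simp
    qed simp
  qed
qed

section \<open>Bounds for the class \<open>M\<^sub>n\<close>\<close>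

text \<open>The Cayley transform \<open>w = (p - 1) / (p + 1)\<close> maps the right half plane into
  the unit disc and vanishes at 0, so the Schwarz lemma gives |w(z)| \<le> |z|. Both inequalities
  are this bound solved for |p(z)| and for \<open>Re (p z)\<close>.\<close>

lemma Caratheodory_bounds:
  fixes p :: "complex \<Rightarrow> complex"
  assumes p: "p holomorphic_on ball 0 1" "p 0 = 1" and Re: "\<And>\<zeta>. norm \<zeta> < 1 \<Longrightarrow> Re (p \<zeta>) \<ge> 0"
    and z: "norm z < 1"
  shows "norm (p z) \<le> (1 + norm z) / (1 - norm z)" and "Re (p z) \<ge> (1 - norm z) / (1 + norm z)"
proof -
  define w where "w \<zeta> = (p \<zeta> - 1) / (p \<zeta> + 1)" for \<zeta>
  have nz: "p \<zeta> + 1 \<noteq> 0" if "norm \<zeta> < 1" for \<zeta>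
    using Re[OF that] by (auto simp: complex_eq_iff)
  have w1: "norm (w \<zeta>) \<le> 1" if "norm \<zeta> < 1" for \<zeta>
  proof -
    have "norm (p \<zeta> - 1) \<le> norm (p \<zeta> + 1)"
      unfolding cmod_def using Re[OF that] by (simp add: power2_eq_square algebra_simps)
    then show ?thesis using nz[OF that] by (simp add: w_def norm_divide)
  qed
  have wz: "norm (w z) \<le> norm z"
  \<comment> \<open>The Schwarz lemma asks for values in the open disc, while \<open>w\<close> is
    only known to map into the closed one. It is applied to \<open>c * w\<close> with
    \<open>c < 1\<close>, and \<open>c\<close> tends to 1.\<close>
  proof (rule field_le_mult_one_interval)
    fix c :: real assume c: "0 < c" "c < 1"
    have "norm (of_real c * w z) \<le> norm z"
    proof (rule Schwarz_Lemma(1)[where f="\<lambda>\<zeta>. of_real c * w \<zeta>"])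
      show "(\<lambda>\<zeta>. complex_of_real c * w \<zeta>) holomorphic_on ball 0 1"
        unfolding w_def using nz by (intro holomorphic_intros p) auto
      show "complex_of_real c * w 0 = 0" by (simp add: w_def p)
      show "norm (complex_of_real c * w \<zeta>) < 1" if "norm \<zeta> < 1" for \<zeta>
      proof -
        have "c * norm (w \<zeta>) \<le> c * 1" using w1[OF that] c by (intro mult_left_mono) auto
        then have "c * norm (w \<zeta>) < 1" using c by linarith
        then show ?thesis using c by (simp add: norm_mult)
      qed
    qed (use z in auto)
    then show "c * norm (w z) \<le> norm z" using c by (simp add: norm_mult)
  qed
  have key: "norm (p z - 1) \<le> norm z * norm (p z + 1)"
    using wz nz[OF z] by (simp add: w_def norm_divide field_simps)
  have "norm (p z) \<le> norm (p z - 1) + 1" using norm_triangle_ineq[of "p z - 1" 1] by simp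
  moreover have "norm z * norm (p z + 1) \<le> norm z * (norm (p z) + 1)"
    using norm_triangle_ineq[of "p z" 1] by (intro mult_left_mono) auto
  ultimately have "norm (p z) * (1 - norm z) \<le> 1 + norm z" using key by (simp add: algebra_simps)
  then show "norm (p z) \<le> (1 + norm z) / (1 - norm z)" using z by (simp add: field_simps)
  have "(norm (p z - 1))\<^sup>2 \<le> (norm z)\<^sup>2 * (norm (p z + 1))\<^sup>2"
    using power_mono[OF key, of 2] by (simp add: power_mult_distrib)
  then have "(Re (p z) - 1)\<^sup>2 + (Im (p z))\<^sup>2 \<le> (norm z)\<^sup>2 * ((Re (p z) + 1)\<^sup>2 + (Im (p z))\<^sup>2)"
    by (simp add: cmod_power2)
  \<comment> \<open>As |z| < 1, the imaginary part can be cancelled from the squared inequality,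
    which leaves one between real parts.\<close>
  moreover have "(norm z)\<^sup>2 * (Im (p z))\<^sup>2 \<le> (Im (p z))\<^sup>2"
    using z by (intro mult_left_le_one_le) (auto simp: power_le_one)
  ultimately have "(Re (p z) - 1)\<^sup>2 \<le> (norm z)\<^sup>2 * (Re (p z) + 1)\<^sup>2"
    by (simp add: distrib_left)
  then have "(Re (p z) - 1)\<^sup>2 \<le> (norm z * (Re (p z) + 1))\<^sup>2"
    by (simp only: power_mult_distrib)
  then have "\<bar>Re (p z) - 1\<bar> \<le> \<bar>norm z * (Re (p z) + 1)\<bar>" by (simp only: abs_le_square_iff)
  then have "1 - norm z \<le> Re (p z) * (1 + norm z)"
    using Re[OF z] by (simp add: algebra_simps)
  then show "Re (p z) \<ge> (1 - norm z) / (1 + norm z)" by (simp add: field_simps add_pos_nonneg)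
qed

lemma class_M_Hol: "h \<in> class_M \<Longrightarrow> h \<in> Hol"
  and class_M_zero: "h \<in> class_M \<Longrightarrow> h 0 = 0"
  and class_M_dissipative: "h \<in> class_M \<Longrightarrow> norm z < 1 \<Longrightarrow> Re (cinner (h z) z) \<le> 0"
  by (auto simp: class_M_def)

lemma class_M_derivative: "h \<in> class_M \<Longrightarrow> frechet_derivative h (at 0) = (\<lambda>v. - v)"
  using frechet_derivative_at by (force simp: class_M_def)

text \<open>With \<open>u\<close> the unit vector along \<open>z\<close>, the function -<h(\<zeta>
  u), u> / \<zeta> on the disc has nonnegative real part. The normalised derivative of
  \<open>h\<close> at 0 gives it the value 1 at 0, so the bounds for functions of positive real part
  apply at \<zeta> = |z|.\<close>

lemma class_M_radial:
  assumes h: "h \<in> class_M" and z: "norm z < 1"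
  shows "norm (cinner (h z) z) \<le> (norm z)\<^sup>2 * ((1 + norm z) / (1 - norm z))"
    and "Re (cinner (h z) z) \<le> - ((norm z)\<^sup>2 * ((1 - norm z) / (1 + norm z)))"
proof -
  have "norm (cinner (h z) z) \<le> (norm z)\<^sup>2 * ((1 + norm z) / (1 - norm z)) \<and>
     Re (cinner (h z) z) \<le> - ((norm z)\<^sup>2 * ((1 - norm z) / (1 + norm z)))"
  proof (cases "z = 0")
    case True
    then show ?thesis by (simp add: class_M_zero[OF h] cinner_def)
  next
    case False
    define u where "u = inverse (norm z) *\<^sub>R z"
    have u: "norm u = 1" using False by (simp add: u_def)
    have zu: "complex_of_real (norm z) *s u = z"
      using False by (simp add: scaleC_of_real u_def)
    define g where "g \<zeta> = cinner (h (0 + \<zeta> *s u)) u" for \<zeta>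
    have mem: "0 + \<zeta> *s u \<in> unit_ball" if "norm \<zeta> < 1" for \<zeta>
      using that u by (simp add: norm_scaleC)
    have dg: "(g has_field_derivative cinner (frechet_derivative h (at (0 + \<zeta> *s u)) u) u) (at \<zeta>)"
      if "norm \<zeta> < 1" for \<zeta>
      unfolding g_def by (rule Hol_slice[OF class_M_Hol[OF h] mem[OF that]])
    have g: "g holomorphic_on ball 0 1"
      unfolding holomorphic_on_open[OF open_ball] by (intro ballI exI, rule dg) simp
    have g0: "g 0 = 0" by (simp add: g_def class_M_zero[OF h] cinner_def)
    have "deriv g 0 = cinner (- u) u"
      using DERIV_imp_deriv[OF dg[of 0]] by (simp add: class_M_derivative[OF h])
    also have "\<dots> = - 1"
      using cinner_diff_left[of 0 u u] by (simp add: cinner_self u) (simp add: cinner_def)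
    finally have g'0: "deriv g 0 = - 1" .
    \<comment> \<open>The value \<open>deriv g 0\<close> at 0 removes the singularity. Elsewhere the
      function is -<h(\<zeta> u), \<zeta> u> / |\<zeta>|^2, whose real part is controlled by the
      definition of the class.\<close>
    define p where "p \<zeta> = - (if \<zeta> = 0 then deriv g 0 else (g \<zeta> - g 0) / (\<zeta> - 0))" for \<zeta>
    have p: "p \<zeta> = - cinner (h (\<zeta> *s u)) (\<zeta> *s u) / of_real ((norm \<zeta>)\<^sup>2)" if "\<zeta> \<noteq> 0" for \<zeta>
      using that unfolding p_def g0
      by (simp add: g_def cinner_scale_right field_simps del: of_real_power flip: complex_norm_square)
    have hol: "p holomorphic_on ball 0 1"
      unfolding p_def by (intro holomorphic_on_minus pole_lemma_open g) simp
    have p0: "p 0 = 1" by (simp add: p_def g'0)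
    have Rep: "Re (p \<zeta>) \<ge> 0" if \<zeta>: "norm \<zeta> < 1" for \<zeta>
    proof (cases "\<zeta> = 0")
      case False
      then show ?thesis
        using class_M_dissipative[OF h, of "\<zeta> *s u"] \<zeta> u p[OF False]
        by (simp add: norm_scaleC divide_nonpos_nonneg del: of_real_power)
    qed (simp add: p0)
    have pz: "p (of_real (norm z)) = - cinner (h z) z / of_real ((norm z)\<^sup>2)"
      using p[of "of_real (norm z)"] False by (simp add: zu)
    have n: "norm (complex_of_real (norm z)) = norm z" by simp
    note C = Caratheodory_bounds[OF hol p0 Rep, of "of_real (norm z)", unfolded n, OF _ z]
    have "norm (p (of_real (norm z))) = norm (cinner (h z) z) / (norm z)\<^sup>2"
      unfolding pz by (simp add: norm_divide norm_power)
    moreover have "Re (p (of_real (norm z))) = - Re (cinner (h z) z) / (norm z)\<^sup>2"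
      unfolding pz by (simp del: of_real_power)
    moreover have "(norm z)\<^sup>2 > 0" using False by simp
    ultimately show ?thesis
      using C z by (simp add: field_simps)
  qed
  then show "norm (cinner (h z) z) \<le> (norm z)\<^sup>2 * ((1 + norm z) / (1 - norm z))"
    and "Re (cinner (h z) z) \<le> - ((norm z)\<^sup>2 * ((1 - norm z) / (1 + norm z)))" by auto
qed

text \<open>On the circle \<open>|\<zeta>| = 1\<close> the function \<open>\<zeta> \<langle>h(z + \<zeta>w), z\<rangle> + \<langle>h(z + \<zeta>w), w\<rangle>\<close> equals
  \<open>\<zeta> \<langle>h(y), y\<rangle>\<close> with \<open>y = z + \<zeta>w\<close>, so the maximum principle turns the bound on \<open>\<langle>h(y), y\<rangle>\<close> into
  one on \<open>\<langle>h(z), w\<rangle>\<close>.\<close>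

lemma class_M_norm_le:
  assumes h: "h \<in> class_M" and z: "norm z \<le> r" "r < 1"
  shows "norm (h z) \<le> 8 / (1 - r)\<^sup>2"
proof (cases "h z = 0")
  case False
  define s where "s = (1 - r) / 2"
  have s: "s > 0" using z by (simp add: s_def)
  \<comment> \<open>In the direction of \<open>h z\<close> the pairing recovers the norm of
    \<open>h z\<close>; the length (1 - r)/2 keeps \<open>z + \<zeta> *s w\<close> in the ball of
    radius (1 + r)/2.\<close>
  define w where "w = (s / norm (h z)) *\<^sub>R h z"
  have w: "norm w = s" using False s by (simp add: w_def)
  have y: "norm (z + \<zeta> *s w) \<le> (1 + r) / 2" if "norm \<zeta> \<le> 1" for \<zeta>
  proof -
    have "norm (z + \<zeta> *s w) \<le> norm z + norm \<zeta> * s"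
      using norm_triangle_ineq[of z "\<zeta> *s w"] by (simp add: norm_scaleC w)
    also have "\<dots> \<le> r + 1 * s" using that z s by (intro add_mono mult_right_mono) auto
    finally show ?thesis by (simp add: s_def field_simps)
  qed
  define Q where "Q \<zeta> = \<zeta> * cinner (h (z + \<zeta> *s w)) z + cinner (h (z + \<zeta> *s w)) w" for \<zeta>
  have Q: "Q field_differentiable (at \<zeta>)" if "norm \<zeta> \<le> 1" for \<zeta>
  proof -
    have "z + \<zeta> *s w \<in> unit_ball" using y[OF that] z by simp
    note d = Hol_slice[OF class_M_Hol[OF h] this]
    show ?thesis unfolding Q_def
      by (intro derivative_intros) (use d field_differentiable_def in blast)+
  qed
  have "norm (Q 0) \<le> 4 / (1 - r)"
  proof (rule maximum_modulus_frontier[where f=Q and \<xi>=0 and S="cball 0 1"])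
    show "Q holomorphic_on interior (cball 0 1)"
      unfolding holomorphic_on_def using Q by (auto intro: field_differentiable_at_within)
    show "continuous_on (closure (cball 0 1)) Q"
      using Q by (intro continuous_at_imp_continuous_on) (auto intro: field_differentiable_imp_continuous_at)
    fix \<zeta> :: complex assume "\<zeta> \<in> frontier (cball 0 1)"
    then have \<zeta>: "norm \<zeta> = 1" by simp
    define Y where "Y = z + \<zeta> *s w"
    have Y: "norm Y \<le> (1 + r) / 2" using y \<zeta> by (simp add: Y_def)
    then have Y1: "norm Y < 1" using z by simp
    have "\<zeta> * cnj \<zeta> = 1" using \<zeta> by (simp flip: complex_norm_square)
    then have "Q \<zeta> = \<zeta> * cinner (h Y) Y"
      unfolding Q_def Y_def by (simp add: cinner_add_right cinner_scale_right distrib_left flip: mult.assoc)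
    then have "norm (Q \<zeta>) \<le> (norm Y)\<^sup>2 * ((1 + norm Y) / (1 - norm Y))"
      using class_M_radial(1)[OF h Y1] by (simp add: norm_mult \<zeta>)
    also have "\<dots> \<le> 1 * (2 / (1 - (1 + r) / 2))"
      using Y Y1 z by (intro mult_mono frac_le) (auto simp: power_le_one)
    also have "\<dots> = 4 / (1 - r)" using z by (simp add: field_simps)
    finally show "norm (Q \<zeta>) \<le> 4 / (1 - r)" .
  qed auto
  moreover have "Q 0 = of_real (s * norm (h z))"
  proof -
    have "Q 0 = cinner (h z) (complex_of_real (s / norm (h z)) *s h z)"
      unfolding scaleC_of_real by (simp add: Q_def w_def)
    also have "\<dots> = of_real (s / norm (h z) * (norm (h z))\<^sup>2)"
      unfolding cinner_scale_right cinner_self by simp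
    finally show ?thesis by (simp add: power2_eq_square)
  qed
  ultimately have "s * norm (h z) \<le> 4 / (1 - r)" using s by (simp add: norm_mult)
  then have "norm (h z) * (1 - r)\<^sup>2 \<le> 8"
    using z by (simp add: s_def field_simps power2_eq_square)
  then show ?thesis using z by (subst pos_le_divide_eq) auto
qed simp

text \<open>One constant serves all members of the class on a given ball, which later makes the
  estimates uniform in time and in the field. The quadratic bound is the Taylor remainder at 0,
  where \<open>h\<close> vanishes with derivative -id.\<close>

lemma class_M_bounds:
  assumes r: "r < 1"
  obtains C where "C \<ge> 0"
    "\<And>h x. h \<in> class_M \<Longrightarrow> norm (x :: complex^'n) \<le> r \<Longrightarrow> norm (h x) \<le> C"
    "\<And>h x. h \<in> class_M \<Longrightarrow> norm (x :: complex^'n) \<le> r \<Longrightarrow> norm (h x + x) \<le> C * (norm x)\<^sup>2"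
    "\<And>h x y. h \<in> class_M \<Longrightarrow> norm (x :: complex^'n) \<le> r \<Longrightarrow> norm y \<le> r \<Longrightarrow> norm (h x - h y) \<le> C * norm (x - y)"
proof -
  define r' where "r' = (1 + r) / 2"
  have r': "r < r'" "r' < 1" using r by (auto simp: r'_def field_simps)
  define B where "B = 8 / (1 - r)\<^sup>2"
  define B' where "B' = 8 / (1 - r')\<^sup>2"
  have B: "B \<ge> 0" "B' \<ge> 0" by (simp_all add: B_def B'_def)
  \<comment> \<open>The summands: \<open>B\<close> bounds \<open>h\<close> itself; 2304 = 18 * 32 /
    (1/2)^2 is the Taylor constant on the ball of radius 1/2, where \<open>h\<close> is at most 32;
    for |x| > 1/4 the number 16 |x|^2 exceeds 1, which turns the bound \<open>B + 1\<close> into a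
    quadratic one; the last is the Lipschitz constant obtained from the bound on the larger radius
    \<open>r'\<close>.\<close>
  define C where "C = B + 16 * (B + 1) + 2304 + 2 * B' / (r' - r)"
  have q: "2 * B' / (r' - r) \<ge> 0" using r' B by simp
  show ?thesis
  proof
    show "C \<ge> 0" using B q by (simp add: C_def)
    fix h :: "complex^'n \<Rightarrow> complex^'n" and x :: "complex^'n" assume h: "h \<in> class_M" and x: "norm x \<le> r"
    show h1: "norm (h x) \<le> C"
      using class_M_norm_le[OF h x r] B q by (simp add: C_def flip: B_def)
    show "norm (h x + x) \<le> C * (norm x)\<^sup>2"
    proof (cases "norm x \<le> 1 / 4")
      case True
      have "norm (h (0 + x) - h 0 - frechet_derivative h (at 0) x) \<le> 18 * 32 / (1/2)\<^sup>2 * (norm x)\<^sup>2"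
      proof (rule Hol_Taylor[OF class_M_Hol[OF h]])
        fix y :: "complex^'n" assume "y \<in> ball 0 (1/2)"
        then show "norm (h y) \<le> 32" using class_M_norm_le[OF h, of y "1/2"] by (simp add: power2_eq_square)
      qed (use True in auto)
      then have "norm (h x + x) \<le> 2304 * (norm x)\<^sup>2"
        by (simp add: class_M_zero[OF h] class_M_derivative[OF h] power2_eq_square)
      also have "\<dots> \<le> C * (norm x)\<^sup>2" using B q by (intro mult_right_mono) (auto simp: C_def)
      finally show ?thesis .
    next
      case False
      then have n: "1 \<le> 16 * (norm x)\<^sup>2"
        using power_mono[of "1/4" "norm x" 2] by (simp add: power2_eq_square)
      have "norm (h x + x) \<le> B + 1"
        using norm_triangle_ineq[of "h x" x] class_M_norm_le[OF h x r] x r by (simp add: B_def)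
      also have "\<dots> \<le> (B + 1) * (16 * (norm x)\<^sup>2)"
        using n B mult_left_mono[OF n, of "B + 1"] by simp
      also have "\<dots> = 16 * (B + 1) * (norm x)\<^sup>2" by simp
      also have "\<dots> \<le> C * (norm x)\<^sup>2" using B q by (intro mult_right_mono) (auto simp: C_def)
      finally show ?thesis .
    qed
    fix y :: "complex^'n" assume y: "norm y \<le> r"
    have "norm (h x - h y) \<le> 2 * B' / (r' - r) * norm (x - y)"
    proof (rule Hol_Lipschitz[OF class_M_Hol[OF h] r'(1) _ _ x y])
      show "norm (h x) \<le> B'" if "norm x < r'" for x :: "complex^'n"
        using class_M_norm_le[OF h, of x r'] that r' by (simp add: B'_def)
    qed (use r' in simp)
    also have "\<dots> \<le> C * norm (x - y)"
      using B q by (intro mult_right_mono) (auto simp: C_def)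
    finally show "norm (h x - h y) \<le> C * norm (x - y)" .
  qed
qed

section \<open>Solutions for Herglotz vector fields\<close>

text \<open>A Herglotz vector field becomes regular after a change at a null set of times.\<close>

definition regular_field :: "(complex^'n \<Rightarrow> real \<Rightarrow> complex^'n) \<Rightarrow> bool" where
  "regular_field G \<longleftrightarrow>
     (\<forall>t. (\<lambda>z\<in>unit_ball. G z t) \<in> class_M) \<and>
     (\<forall>z\<in>unit_ball. (\<lambda>t. G z t) \<in> borel_measurable lebesgue)"

lemma regular_field_dissipative:
  assumes G: "regular_field G" and z: "norm z < 1"
  shows "inner (G z t) z \<le> 0"
    and "inner (G z t) z \<le> - ((norm z)\<^sup>2 * ((1 - norm z) / (1 + norm z)))"
proof -
  let ?h = "\<lambda>z\<in>unit_ball. G z t"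
  have h: "?h \<in> class_M" using G by (simp add: regular_field_def)
  have e: "?h z = G z t" using z by simp
  show "inner (G z t) z \<le> 0"
    using class_M_dissipative[OF h z] unfolding e Re_cinner .
  show "inner (G z t) z \<le> - ((norm z)\<^sup>2 * ((1 - norm z) / (1 + norm z)))"
    using class_M_radial(2)[OF h z] unfolding e Re_cinner .
qed

lemma regular_field_zero: "regular_field G \<Longrightarrow> G 0 t = 0"
  using class_M_zero[of "\<lambda>z\<in>unit_ball. G z t"] by (simp add: regular_field_def)

lemma regular_field_bounds:
  assumes r: "r < 1"
  obtains C where "C \<ge> 0"
    "\<And>G x t. regular_field G \<Longrightarrow> norm (x :: complex^'n) \<le> r \<Longrightarrow> norm (G x t) \<le> C"
    "\<And>G x t. regular_field G \<Longrightarrow> norm (x :: complex^'n) \<le> r \<Longrightarrow> norm (G x t + x) \<le> C * (norm x)\<^sup>2"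
    "\<And>G x y t. regular_field G \<Longrightarrow> norm (x :: complex^'n) \<le> r \<Longrightarrow> norm y \<le> r \<Longrightarrow> norm (G x t - G y t) \<le> C * norm (x - y)"
proof -
  obtain C where C: "C \<ge> 0"
    "\<And>h x. h \<in> class_M \<Longrightarrow> norm (x :: complex^'n) \<le> r \<Longrightarrow> norm (h x) \<le> C"
    "\<And>h x. h \<in> class_M \<Longrightarrow> norm (x :: complex^'n) \<le> r \<Longrightarrow> norm (h x + x) \<le> C * (norm x)\<^sup>2"
    "\<And>h x y. h \<in> class_M \<Longrightarrow> norm (x :: complex^'n) \<le> r \<Longrightarrow> norm y \<le> r \<Longrightarrow> norm (h x - h y) \<le> C * norm (x - y)"
    using class_M_bounds[OF r] by blast
  show ?thesis
  proof (rule that[OF C(1)])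
    fix G :: "complex^'n \<Rightarrow> real \<Rightarrow> complex^'n" and x y :: "complex^'n" and t
    assume G: "regular_field G" and x: "norm x \<le> r"
    let ?h = "\<lambda>z\<in>unit_ball. G z t"
    have h: "?h \<in> class_M" using G by (simp add: regular_field_def)
    have e: "?h x = G x t" if "norm x \<le> r" for x using that r by simp
    show "norm (G x t) \<le> C" using C(2)[OF h x] e[OF x] by simp
    show "norm (G x t + x) \<le> C * (norm x)\<^sup>2" using C(3)[OF h x] e[OF x] by simp
    show "norm (G x t - G y t) \<le> C * norm (x - y)" if y: "norm y \<le> r"
      using C(4)[OF h x y] e[OF x] e[OF y] by simp
  qed
qed

definition solution :: "(complex^'n \<Rightarrow> real \<Rightarrow> complex^'n) \<Rightarrow> (real \<Rightarrow> complex^'n) \<Rightarrow> bool" where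
  "solution G x \<longleftrightarrow> (\<forall>t\<ge>0. norm (x t) < 1) \<and> lip_primitive x (\<lambda>t. G (x t) t)"

section \<open>Decay of trajectories and convergence of the rescaled flow\<close>

lemma lip_primitive_inner_self:
  assumes "lip_primitive x g"
  shows "lip_primitive (\<lambda>t. (norm (x t))\<^sup>2) (\<lambda>t. 2 * inner (g t) (x t))"
proof -
  have "inner (x t) (g t) + inner (g t) (x t) = 2 * inner (g t) (x t)" for t
    by (metis inner_commute mult_2)
  then show ?thesis
    using lip_primitive_bilinear[OF bounded_bilinear_inner assms assms]
    by (simp only: power2_norm_eq_inner)
qed

text \<open>The squared norm has the derivative 2 <G, x>, which dissipativity makes nonpositive; the
  square avoids the point where the norm is not differentiable.\<close>

lemma solution_norm_antimono:
  assumes G: "regular_field G" and x: "solution G x" and st: "0 \<le> s" "s \<le> t"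
  shows "norm (x t) \<le> norm (x s)"
proof -
  have "(norm (x t))\<^sup>2 \<le> (norm (x s))\<^sup>2"
  proof (rule lip_primitive_nonincreasing[OF lip_primitive_inner_self st])
    show "lip_primitive x (\<lambda>t. G (x t) t)" using x by (simp add: solution_def)
    show "2 * inner (G (x \<tau>) \<tau>) (x \<tau>) \<le> 0" if "\<tau> \<in> {s..t}" for \<tau>
      using regular_field_dissipative(1)[OF G, of "x \<tau>" \<tau>] x that st by (simp add: solution_def)
  qed
  then show ?thesis by simp
qed

text \<open>The trajectory stays in \<open>cball 0 r\<close>, where the radial bound gives <G, x>
  \<le> -q |x|^2 with q = (1 - r)/(1 + r). Gronwall's inequality for the squared norm and a square
  root yield the decay.\<close>

lemma solution_decay:
  assumes G: "regular_field G" and x: "solution G x" and st: "0 \<le> s" "s \<le> t" and r: "norm (x s) \<le> r" "r < 1"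
  shows "norm (x t) \<le> exp (- ((1 - r) / (1 + r)) * (t - s)) * norm (x s)"
proof -
  define q where "q = (1 - r) / (1 + r)"
  have "(norm (x t))\<^sup>2 \<le> exp (- 2 * q * (t - s)) * (norm (x s))\<^sup>2"
  proof (rule lip_primitive_Gronwall[OF lip_primitive_inner_self st])
    show "lip_primitive x (\<lambda>t. G (x t) t)" using x by (simp add: solution_def)
    fix \<tau> assume \<tau>: "\<tau> \<in> {s..t}"
    have n: "norm (x \<tau>) \<le> r" "norm (x \<tau>) < 1"
      using solution_norm_antimono[OF G x st(1), of \<tau>] \<tau> r by auto
    have "q \<le> (1 - norm (x \<tau>)) / (1 + norm (x \<tau>))"
      unfolding q_def by (rule frac_le) (use n r in \<open>auto intro: add_pos_nonneg\<close>)
    then have "(norm (x \<tau>))\<^sup>2 * q \<le> (norm (x \<tau>))\<^sup>2 * ((1 - norm (x \<tau>)) / (1 + norm (x \<tau>)))"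
      by (intro mult_left_mono) auto
    then have "inner (G (x \<tau>) \<tau>) (x \<tau>) \<le> - ((norm (x \<tau>))\<^sup>2 * q)"
      using regular_field_dissipative(2)[OF G n(2), of \<tau>] by linarith
    moreover have "- 2 * q * m = - 2 * (m * q)" for m :: real by simp
    ultimately show "2 * inner (G (x \<tau>) \<tau>) (x \<tau>) \<le> - 2 * q * (norm (x \<tau>))\<^sup>2"
      by (metis (no_types, lifting) add.inverse_inverse mult_left_mono mult_minus_left mult_minus_right zero_le_numeral)
  qed
  also have "\<dots> = (exp (- q * (t - s)) * norm (x s))\<^sup>2"
    unfolding power_mult_distrib exp_double[symmetric] by (simp add: algebra_simps)
  finally have "norm (x t) \<le> \<bar>exp (- q * (t - s)) * norm (x s)\<bar>"
    using abs_le_square_iff by force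
  then show ?thesis by (simp add: q_def)
qed

text \<open>The rate (1 - r)/(1 + r) degenerates as \<open>r\<close> approaches 1, but by the time
  ln 7 / q every trajectory has norm at most 1/7, and (1 - 1/7)/(1 + 1/7) = 3/4. Convergence of e^t
  x requires that twice the rate exceed 1.\<close>

lemma solution_decay_34:
  assumes r: "0 \<le> r" "r < 1"
  obtains K where "K \<ge> 0"
    "\<And>G x t. regular_field G \<Longrightarrow> solution G x \<Longrightarrow> norm (x 0 :: complex^'n) \<le> r \<Longrightarrow> t \<ge> 0 \<Longrightarrow>
       norm (x t) \<le> K * exp (- (3/4) * t)"
proof -
  define q where "q = (1 - r) / (1 + r)"
  have q: "q > 0" using r by (simp add: q_def)
  define T where "T = ln 7 / q"
  have T: "T \<ge> 0" "exp (- q * T) = 1 / 7" using q by (simp_all add: T_def exp_minus field_simps)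
  show ?thesis
  proof
    show "exp (3/4 * T) \<ge> 0" by simp
    fix G :: "complex^'n \<Rightarrow> real \<Rightarrow> complex^'n" and x and t :: real
    assume G: "regular_field G" and x: "solution G x" and x0: "norm (x 0) \<le> r" and t: "t \<ge> 0"
    have x1: "norm (x s) \<le> 1" if "s \<ge> 0" for s
      using x that by (auto simp: solution_def less_imp_le)
    have "norm (x t) \<le> exp (- (3/4) * (t - T))"
    proof (cases "t \<le> T")
      case True
      have "norm (x t) \<le> 1" using x1 t by blast
      also have "1 \<le> exp (- (3/4) * (t - T))" using True by simp
      finally show ?thesis .
    next
      case False
      have "norm (x T) \<le> exp (- q * (T - 0)) * norm (x 0)"
        unfolding q_def by (rule solution_decay[OF G x _ _ x0]) (use T r in auto)
      also have "\<dots> \<le> 1 / 7" unfolding diff_0_right T(2) using x1[of 0] by simp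
      finally have xT: "norm (x T) \<le> 1 / 7" .
      have "norm (x t) \<le> exp (- ((1 - 1/7) / (1 + 1/7)) * (t - T)) * norm (x T)"
        by (rule solution_decay[OF G x _ _ xT]) (use T False in auto)
      also have "\<dots> \<le> exp (- ((1 - 1/7) / (1 + 1/7)) * (t - T)) * 1"
        using xT by (intro mult_left_mono) auto
      finally show ?thesis by simp
    qed
    also have "- (3/4) * (t - T) = 3/4 * T + - (3/4) * t"
      unfolding right_diff_distrib by simp
    also have "exp \<dots> = exp (3/4 * T) * exp (- (3/4) * t)" by (rule exp_add)
    finally show "norm (x t) \<le> exp (3/4 * T) * exp (- (3/4) * t)" .
  qed
qed

lemma lip_primitive_norm_le_integral:
  fixes u :: "real \<Rightarrow> 'a::euclidean_space"
  assumes u: "lip_primitive u g" and ab: "0 \<le> a" "a \<le> b"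
    and le: "\<And>t. t \<in> {a..b} \<Longrightarrow> norm (g t) \<le> k t"
    and v: "\<And>t. (v has_real_derivative k t) (at t)"
  shows "norm (u b - u a) \<le> v b - v a"
proof -
  have g: "(g has_integral u b - u a) {a..b}" by (rule lip_primitive_has_integral[OF u ab])
  have k: "(k has_integral v b - v a) {a..b}"
    using v by (intro fundamental_theorem_of_calculus[OF ab(2)])
      (auto simp: has_real_derivative_iff_has_vector_derivative intro: has_vector_derivative_at_within)
  show ?thesis
    using integral_norm_bound_integral[of g "{a..b}" k] g k le integral_unique[OF g] integral_unique[OF k]
    by (auto simp: has_integral_integrable)
qed

lemma solution_exp_lip_primitive:
  assumes "solution G x"
  shows "lip_primitive (\<lambda>t. exp t *\<^sub>R x t) (\<lambda>t. exp t *\<^sub>R (G (x t) t + x t))"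
  using lip_primitive_bilinear[OF bounded_bilinear_scaleR lip_primitive_exp[of 1], of x "\<lambda>t. G (x t) t"] assms
  by (simp add: solution_def scaleR_add_right)

text \<open>The derivative of e^t x is e^t (G + x), of order e^t |x|^2 by the quadratic bound. The
  decay rate 3/4 makes this of order e^(-t/2), which is integrable up to infinity; its primitive
  brings in the factor 2.\<close>

lemma solution_exp_increment:
  assumes r: "0 \<le> r" "r < 1"
  obtains K where "K \<ge> 0"
    "\<And>G x s t. regular_field G \<Longrightarrow> solution G x \<Longrightarrow> norm (x 0 :: complex^'n) \<le> r \<Longrightarrow> 0 \<le> s \<Longrightarrow> s \<le> t \<Longrightarrow>
       norm (exp t *\<^sub>R x t - exp s *\<^sub>R x s) \<le> K * exp (- s / 2)"
proof -
  obtain K where K: "K \<ge> 0"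
    "\<And>G x t. regular_field G \<Longrightarrow> solution G x \<Longrightarrow> norm (x 0 :: complex^'n) \<le> r \<Longrightarrow> t \<ge> 0 \<Longrightarrow>
       norm (x t) \<le> K * exp (- (3/4) * t)"
    using solution_decay_34[OF r] by blast
  obtain C where C: "C \<ge> 0"
    "\<And>G x t. regular_field G \<Longrightarrow> norm (x :: complex^'n) \<le> r \<Longrightarrow> norm (G x t + x) \<le> C * (norm x)\<^sup>2"
    using regular_field_bounds[OF r(2)] by metis
  show ?thesis
  proof
    show "2 * (C * K\<^sup>2) \<ge> 0" using C by simp
    fix G :: "complex^'n \<Rightarrow> real \<Rightarrow> complex^'n" and x and s t :: real
    assume G: "regular_field G" and x: "solution G x" and x0: "norm (x 0) \<le> r" and st: "0 \<le> s" "s \<le> t"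
    let ?v = "\<lambda>\<tau>::real. - 2 * (C * K\<^sup>2) * exp (- \<tau> / 2)"
    have "norm (exp t *\<^sub>R x t - exp s *\<^sub>R x s) \<le> ?v t - ?v s"
    proof (rule lip_primitive_norm_le_integral[OF solution_exp_lip_primitive[OF x] st])
      fix \<tau> assume \<tau>: "\<tau> \<in> {s..t}"
      have n: "norm (x \<tau>) \<le> r" using solution_norm_antimono[OF G x, of 0 \<tau>] x0 \<tau> st by simp
      have "norm (G (x \<tau>) \<tau> + x \<tau>) \<le> C * (norm (x \<tau>))\<^sup>2" by (rule C(2)[OF G n])
      also have "\<dots> \<le> C * (K * exp (- (3/4) * \<tau>))\<^sup>2"
        by (intro mult_left_mono power_mono K(2)[OF G x x0]) (use C \<tau> st in auto)
      also have "\<dots> = C * K\<^sup>2 * exp (- (3/2) * \<tau>)"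
        unfolding power_mult_distrib exp_double[symmetric] by simp
      finally have "exp \<tau> * norm (G (x \<tau>) \<tau> + x \<tau>) \<le> exp \<tau> * (C * K\<^sup>2 * exp (- (3/2) * \<tau>))"
        by (intro mult_left_mono) auto
      also have "\<dots> = C * K\<^sup>2 * exp (- \<tau> / 2)"
        by (simp add: algebra_simps flip: exp_add)
      finally show "norm (exp \<tau> *\<^sub>R (G (x \<tau>) \<tau> + x \<tau>)) \<le> C * K\<^sup>2 * exp (- \<tau> / 2)" by simp
    next
      show "(?v has_real_derivative C * K\<^sup>2 * exp (- \<tau> / 2)) (at \<tau>)" for \<tau>
        by (auto intro!: derivative_eq_intros)
    qed
    also have "\<dots> \<le> 2 * (C * K\<^sup>2) * exp (- s / 2)" using C by simp
    finally show "norm (exp t *\<^sub>R x t - exp s *\<^sub>R x s) \<le> 2 * (C * K\<^sup>2) * exp (- s / 2)" .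
  qed
qed

lemma solution_unique:
  assumes G: "regular_field G" and x: "solution G x" and y: "solution G y" and eq: "x 0 = y 0" and t: "t \<ge> 0"
  shows "x t = y t"
proof -
  define r where "r = norm (x 0)"
  have r: "r < 1" using x by (simp add: r_def solution_def)
  have n: "norm (x s) \<le> r" "norm (y s) \<le> r" if "s \<ge> 0" for s
    using solution_norm_antimono[OF G x, of 0 s] solution_norm_antimono[OF G y, of 0 s] that eq by (auto simp: r_def)
  obtain C where C: "C \<ge> 0"
    "\<And>x y t. norm x \<le> r \<Longrightarrow> norm y \<le> r \<Longrightarrow> norm (G x t - G y t) \<le> C * norm (x - y)"
    using regular_field_bounds[OF r] G by metis
  have "(norm (x t - y t))\<^sup>2 \<le> exp (2 * C * (t - 0)) * (norm (x 0 - y 0))\<^sup>2"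
  proof (rule lip_primitive_Gronwall[OF lip_primitive_inner_self order_refl t])
    show "lip_primitive (\<lambda>t. x t - y t) (\<lambda>t. G (x t) t - G (y t) t)"
      using x y by (intro lip_primitive_diff) (simp_all add: solution_def)
    fix s assume s: "s \<in> {0..t}"
    have "inner (G (x s) s - G (y s) s) (x s - y s) \<le> norm (G (x s) s - G (y s) s) * norm (x s - y s)"
      by (rule norm_cauchy_schwarz)
    also have "\<dots> \<le> C * norm (x s - y s) * norm (x s - y s)"
      by (intro mult_right_mono C n) (use s in auto)
    finally show "2 * inner (G (x s) s - G (y s) s) (x s - y s) \<le> 2 * C * (norm (x s - y s))\<^sup>2"
      by (simp add: power2_eq_square)
  qed
  then show ?thesis by (simp add: eq)
qed

section \<open>Existence of solutions by Picard iteration\<close>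

lemma regular_field_measurable_along:
  assumes G: "regular_field G" and y: "continuous_on UNIV y" and ball: "\<And>t. norm (y t) < 1"
  shows "(\<lambda>t. G (y t) t) \<in> borel_measurable lebesgue"
proof (rule borel_measurable_LIMSEQ_metric)
  \<comment> \<open>Measurability is known for each fixed point of the ball only. The curve is
    therefore sampled on the grid of mesh 1/(n+1), where countably many points occur, and continuity
    of the field in \<open>z\<close> gives the limit.\<close>
  define a :: "nat \<Rightarrow> real \<Rightarrow> int" where "a n t = \<lfloor>real (Suc n) * t\<rfloor>" for n t
  define f where "f n t = G (y (of_int (a n t) / real (Suc n))) t" for n t
  show "f n \<in> borel_measurable lebesgue" for n
    unfolding f_def
  proof (rule measurable_compose_countable[where f="\<lambda>i t. G (y (of_int i / real (Suc n))) t" and g="a n"])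
    show "(\<lambda>t. G (y (of_int i / real (Suc n))) t) \<in> borel_measurable lebesgue" for i :: int
      using G ball by (simp add: regular_field_def)
    have "(\<lambda>t. \<lfloor>real (Suc n) * t\<rfloor>) \<in> measurable borel (count_space UNIV)"
      by measurable
    then show "a n \<in> measurable lebesgue (count_space UNIV)"
      unfolding a_def by (intro measurable_completion) (simp add: measurable_lborel1)
  qed
  fix t :: real
  have "(\<lambda>n. of_int (a n t) / real (Suc n) - t) \<longlonglongrightarrow> 0"
  proof (rule Lim_null_comparison[OF _ LIMSEQ_inverse_real_of_nat])
    show "\<forall>\<^sub>F n in sequentially. norm (of_int (a n t) / real (Suc n) - t) \<le> inverse (real (Suc n))"
    proof (rule always_eventually, rule allI)
      fix n
      have "\<bar>of_int (a n t) - real (Suc n) * t\<bar> \<le> 1" unfolding a_def by linarith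
      then have "\<bar>of_int (a n t) - real (Suc n) * t\<bar> / real (Suc n) \<le> 1 / real (Suc n)"
        by (rule divide_right_mono) simp
      moreover have "of_int (a n t) / real (Suc n) - t = (of_int (a n t) - real (Suc n) * t) / real (Suc n)"
        by (simp add: diff_divide_distrib)
      ultimately show "norm (of_int (a n t) / real (Suc n) - t) \<le> inverse (real (Suc n))"
        by (simp add: inverse_eq_divide)
    qed
  qed
  then have "(\<lambda>n. of_int (a n t) / real (Suc n)) \<longlonglongrightarrow> t" by (simp only: LIM_zero_iff)
  moreover have "isCont y t" using y by (simp add: continuous_on_eq_continuous_at)
  ultimately have lim: "(\<lambda>n. y (of_int (a n t) / real (Suc n))) \<longlonglongrightarrow> y t"
    using isCont_tendsto_compose by blast
  let ?h = "\<lambda>z\<in>unit_ball. G z t"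
  have "?h \<in> Hol" using G by (simp add: regular_field_def class_M_Hol)
  then have "isCont ?h (y t)"
    using Hol_has_derivative has_derivative_continuous ball by (metis mem_ball_0)
  from isCont_tendsto_compose[OF this lim] show "(\<lambda>n. f n t) \<longlonglongrightarrow> G (y t) t"
    using ball by (simp add: f_def)
qed

text \<open>This is the nearest-point map onto the closed ball, hence 1-Lipschitz. The explicit
  formula shows that \<open>a\<close> and its image lie on one ray, which decides the sign of inner
  products.\<close>

definition radial_proj :: "real \<Rightarrow> 'a::euclidean_space \<Rightarrow> 'a" where
  "radial_proj r a = (if norm a \<le> r then a else (r / norm a) *\<^sub>R a)"

lemma norm_radial_proj: "r \<ge> 0 \<Longrightarrow> norm (radial_proj r a) \<le> r"
  by (auto simp: radial_proj_def)

lemma radial_proj_closest_point: "r \<ge> 0 \<Longrightarrow> closest_point (cball 0 r) a = radial_proj r a"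
proof (rule closest_point_unique[symmetric])
  assume r: "r \<ge> 0"
  show "radial_proj r a \<in> cball 0 r" using norm_radial_proj[OF r] by simp
  show "\<forall>z\<in>cball 0 r. dist a (radial_proj r a) \<le> dist a z"
  proof (cases "norm a \<le> r")
    case False
    have "a - radial_proj r a = (1 - r / norm a) *\<^sub>R a" using False by (simp add: radial_proj_def algebra_simps)
    then have "dist a (radial_proj r a) = \<bar>1 - r / norm a\<bar> * norm a" by (simp add: dist_norm)
    also have "\<bar>1 - r / norm a\<bar> = 1 - r / norm a" using False r by (simp add: divide_le_eq)
    also have "(1 - r / norm a) * norm a = norm a - r" using False r by (auto simp: left_diff_distrib)
    finally have d: "dist a (radial_proj r a) = norm a - r" .
    show ?thesis
    proof
      fix z :: 'a assume "z \<in> cball 0 r"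
      then show "dist a (radial_proj r a) \<le> dist a z"
        unfolding d using norm_triangle_ineq2[of a z] by (simp add: dist_norm)
    qed
  qed (simp add: radial_proj_def)
qed auto

lemma radial_proj_Lipschitz:
  assumes "r \<ge> 0" shows "norm (radial_proj r a - radial_proj r b) \<le> norm (a - b)"
  using closest_point_lipschitz[of "cball 0 r" a b] assms
  by (simp add: radial_proj_closest_point dist_norm)

text \<open>As \<open>a\<close> is a positive multiple of its projection, an inner product with
  \<open>a\<close> has the sign of the one with the projection. This carries dissipativity over to
  the projected field.\<close>

lemma radial_proj_scale:
  assumes "r > 0" obtains c where "c \<ge> 1" "a = c *\<^sub>R radial_proj r a"
proof (cases "norm a \<le> r")
  case True
  then show ?thesis using that[of 1] by (simp add: radial_proj_def)
next
  case False
  then show ?thesis using that[of "norm a / r"] assms by (auto simp: radial_proj_def)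
qed

text \<open>Caratheodory's conditions with global constants. Measurability is demanded along
  continuous curves, the form in which the field enters the integral equation.\<close>

locale Caratheodory_field =
  fixes X :: "'a::euclidean_space \<Rightarrow> real \<Rightarrow> 'a" and C :: real
  assumes meas: "\<And>y. continuous_on UNIV y \<Longrightarrow> (\<lambda>t. X (y t) t) \<in> borel_measurable lebesgue"
    and bound: "\<And>a t. norm (X a t) \<le> C"
    and Lip: "\<And>a b t. norm (X a t - X b t) \<le> C * norm (a - b)"
begin

lemma C_nonneg: "C \<ge> 0"
  using bound norm_ge_zero order_trans by blast

lemma integrable:
  assumes "continuous_on UNIV y" shows "(\<lambda>s. X (y s) s) integrable_on {a..b}"
proof (rule measurable_bounded_by_integrable_imp_integrable)
  show "(\<lambda>s. X (y s) s) \<in> borel_measurable (lebesgue_on {a..b})"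
    using meas[OF assms] by (rule measurable_restrict_space1)
  show "(\<lambda>s. C) integrable_on {a..b}" by (rule integrable_const_ivl)
qed (use bound in auto)

lemma integral_diff_le:
  assumes y: "continuous_on UNIV y" and st: "s \<le> t"
  shows "norm (integral {0..t} (\<lambda>s. X (y s) s) - integral {0..s} (\<lambda>s. X (y s) s)) \<le> C * (t - s)"
proof -
  let ?f = "\<lambda>s. X (y s) s"
  have b: "norm (integral {a..b} ?f) \<le> C * (b - a)" if "a \<le> b" for a b
    using has_integral_bound_real[OF C_nonneg finite.emptyI integrable_integral[OF integrable[OF y, of a b]]]
      that bound by simp
  \<comment> \<open>For a negative upper end the interval is empty and the integral is 0, so the
    integral is Lipschitz in its upper end on the whole line, and the iterates are continuous
    there.\<close>
  consider "t < 0" | "s < 0" "0 \<le> t" | "0 \<le> s" by linarith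
  then show ?thesis
  proof cases
    case 1
    then show ?thesis using st C_nonneg by simp
  next
    case 2
    have "norm (integral {0..t} ?f) \<le> C * (t - 0)" using b 2 by blast
    also have "\<dots> \<le> C * (t - s)" using 2 C_nonneg by (intro mult_left_mono) auto
    finally show ?thesis using 2 by simp
  next
    case 3
    have "integral {0..s} ?f + integral {s..t} ?f = integral {0..t} ?f"
      by (intro Henstock_Kurzweil_Integration.integral_combine integrable[OF y]) (use 3 st in auto)
    then have "integral {0..t} ?f - integral {0..s} ?f = integral {s..t} ?f" by (metis add_diff_cancel_left')
    then show ?thesis using b[OF st] by simp
  qed
qed

lemma integral_Lipschitz:
  assumes y: "continuous_on UNIV y"
  shows "norm (integral {0..s} (\<lambda>s. X (y s) s) - integral {0..t} (\<lambda>s. X (y s) s)) \<le> C * \<bar>s - t\<bar>"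
proof (cases "s \<le> t")
  case True
  then show ?thesis using integral_diff_le[OF y True] by (simp add: norm_minus_commute)
next
  case False
  then show ?thesis using integral_diff_le[OF y, of t s] by simp
qed

primrec picard :: "'a \<Rightarrow> nat \<Rightarrow> real \<Rightarrow> 'a" where
  "picard z 0 = (\<lambda>t. z)"
| "picard z (Suc k) = (\<lambda>t. z + integral {0..t} (\<lambda>s. X (picard z k s) s))"

lemma Lipschitz_continuous:
  assumes "\<And>s t. norm (f s - f t) \<le> C * \<bar>s - t\<bar>" shows "continuous_on UNIV (f :: real \<Rightarrow> 'a)"
  using assms C_nonneg
  by (intro lipschitz_on_continuous_on[of C] lipschitz_onI) (auto simp: dist_norm)

lemma picard_Lipschitz: "norm (picard z k s - picard z k t) \<le> C * \<bar>s - t\<bar>"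
proof (induction k arbitrary: s t)
  case 0
  then show ?case using C_nonneg by simp
next
  case (Suc k)
  show ?case using integral_Lipschitz[OF Lipschitz_continuous[OF Suc]] by simp
qed

lemma picard_continuous: "continuous_on UNIV (picard z k)"
  by (rule Lipschitz_continuous[OF picard_Lipschitz])

text \<open>Relative to the weight exp(L t) with L = 2 (C + 1), each iteration gains a factor 1/2,
  because the integral of C exp(L s) is at most exp(L t) / 2. Thus the iterates converge for all
  times at once; \<open>C + 1\<close> keeps L positive.\<close>

lemma picard_step:
  assumes "t \<ge> 0"
  shows "norm (picard z (Suc k) t - picard z k t) \<le> exp (2 * (C + 1) * t) / 2 ^ k"
  using assms
proof (induction k arbitrary: t)
  case 0
  have "norm (picard z (Suc 0) t - picard z 0 t) \<le> C * t"
    using integral_Lipschitz[OF picard_continuous[of z 0], of t 0] 0 by simp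
  also have "\<dots> \<le> 1 + 2 * (C + 1) * t" using 0 C_nonneg by (simp add: algebra_simps)
  also have "\<dots> \<le> exp (2 * (C + 1) * t)" by (rule exp_ge_add_one_self)
  finally show ?case by simp
next
  case (Suc k)
  let ?f = "\<lambda>k s. X (picard z k s) s"
  let ?L = "2 * (C + 1)"
  have e1: "picard z (Suc (Suc k)) t - picard z (Suc k) t = integral {0..t} (\<lambda>s. ?f (Suc k) s - ?f k s)"
    by (simp add: integral_diff integrable[OF picard_continuous] del: picard.simps(2))
      (simp add: integral_diff integrable[OF picard_continuous, simplified])
  have e2: "norm (integral {0..t} (\<lambda>s. ?f (Suc k) s - ?f k s)) \<le> integral {0..t} (\<lambda>s. C * (exp (?L * s) / 2 ^ k))"
  proof (rule integral_norm_bound_integral)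
    show "(\<lambda>s. ?f (Suc k) s - ?f k s) integrable_on {0..t}"
      by (intro integrable_diff integrable picard_continuous)
    show "(\<lambda>s. C * (exp (?L * s) / 2 ^ k)) integrable_on {0..t}"
      by (intro integrable_continuous_real continuous_intros) auto
    fix s assume s: "s \<in> {0..t}"
    have "norm (?f (Suc k) s - ?f k s) \<le> C * norm (picard z (Suc k) s - picard z k s)" by (rule Lip)
    also have "\<dots> \<le> C * (exp (?L * s) / 2 ^ k)"
      using Suc.IH[of s] s C_nonneg by (intro mult_left_mono) auto
    finally show "norm (?f (Suc k) s - ?f k s) \<le> C * (exp (?L * s) / 2 ^ k)" .
  qed
  have e3: "integral {0..t} (\<lambda>s. C * (exp (?L * s) / 2 ^ k)) \<le> exp (?L * t) / 2 ^ Suc k"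
  proof -
    let ?v = "\<lambda>s. C / ?L * (exp (?L * s) / 2 ^ k)"
    have L: "?L > 0" using C_nonneg by simp
    have "((\<lambda>s. C * (exp (?L * s) / 2 ^ k)) has_integral ?v t - ?v 0) {0..t}"
    proof (rule fundamental_theorem_of_calculus[OF \<open>t \<ge> 0\<close>])
      fix s
      have "(?v has_real_derivative C / ?L * ((exp (?L * s) * ?L) / 2 ^ k)) (at s within {0..t})"
        by (auto intro!: derivative_eq_intros)
      also have "C / ?L * ((exp (?L * s) * ?L) / 2 ^ k) = C * (exp (?L * s) / 2 ^ k)" using L by simp
      finally show "(?v has_vector_derivative C * (exp (?L * s) / 2 ^ k)) (at s within {0..t})"
        by (simp add: has_real_derivative_iff_has_vector_derivative)
    qed
    then have "integral {0..t} (\<lambda>s. C * (exp (?L * s) / 2 ^ k)) = ?v t - ?v 0" by (rule integral_unique)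
    also have "\<dots> \<le> ?v t" using C_nonneg L by simp
    also have "\<dots> \<le> (1 / 2) * (exp (?L * t) / 2 ^ k)"
      using C_nonneg by (intro mult_right_mono) (auto simp: field_simps)
    finally show ?thesis by simp
  qed
  show ?case unfolding e1 by (rule order_trans[OF e2 e3])
qed

lemma picard_limit:
  obtains y where "\<And>t. (\<lambda>k. picard z k t) \<longlonglongrightarrow> y t"
proof -
  have "\<exists>l. (\<lambda>k. picard z k t) \<longlonglongrightarrow> l" for t
  proof (cases "t \<ge> 0")
    case True
    have "summable (\<lambda>k. exp (2 * (C + 1) * t) * (1 / 2) ^ k)"
      by (intro summable_mult summable_geometric) simp
    then have "summable (\<lambda>k. picard z (Suc k) t - picard z k t)"
      by (rule summable_comparison_test'[where N=0])
        (use picard_step[OF True] in \<open>simp add: power_divide del: picard.simps\<close>)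
    then have "(\<lambda>n. \<Sum>k<n. picard z (Suc k) t - picard z k t) \<longlonglongrightarrow> (\<Sum>k. picard z (Suc k) t - picard z k t)"
      by (rule summable_LIMSEQ)
    moreover have "(\<Sum>k<n. picard z (Suc k) t - picard z k t) = picard z n t - z" for n
      using sum_lessThan_telescope[of "\<lambda>k. picard z k t" n] by (simp del: picard.simps(2))
    ultimately have "(\<lambda>n. picard z n t - z) \<longlonglongrightarrow> (\<Sum>k. picard z (Suc k) t - picard z k t)"
      by (simp del: picard.simps(2))
    then have "(\<lambda>n. picard z n t - z + z) \<longlonglongrightarrow> (\<Sum>k. picard z (Suc k) t - picard z k t) + z"
      by (intro tendsto_intros)
    then show ?thesis by auto
  next
    case False
    have "picard z k t = z" for k using False by (cases k) auto
    then show ?thesis by auto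
  qed
  then show ?thesis using that by metis
qed

lemma integral_equation_solvable:
  "\<exists>y. (\<forall>s t. norm (y s - y t) \<le> C * \<bar>s - t\<bar>) \<and> continuous_on UNIV y \<and>
     (\<forall>t. y t = z + integral {0..t} (\<lambda>s. X (y s) s))"
proof -
  obtain y where y: "\<And>t. (\<lambda>k. picard z k t) \<longlonglongrightarrow> y t" by (rule picard_limit) blast
  have Lip_y: "norm (y s - y t) \<le> C * \<bar>s - t\<bar>" for s t
    by (rule LIMSEQ_le_const2[OF tendsto_norm[OF tendsto_diff[OF y y]]]) (use picard_Lipschitz in auto)
  then have cont: "continuous_on UNIV y" by (rule Lipschitz_continuous)
  have "y t = z + integral {0..t} (\<lambda>s. X (y s) s)" for t
  proof (rule LIMSEQ_unique)
    show "(\<lambda>k. picard z (Suc k) t) \<longlonglongrightarrow> y t" using y by (rule LIMSEQ_Suc)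
    have "(\<lambda>k. integral {0..t} (\<lambda>s. X (picard z k s) s)) \<longlonglongrightarrow> integral {0..t} (\<lambda>s. X (y s) s)"
    proof (rule dominated_convergence(2)[where h="\<lambda>_. C"])
      fix s
      show "(\<lambda>k. X (picard z k s) s) \<longlonglongrightarrow> X (y s) s"
      proof (rule LIM_zero_cancel, rule Lim_null_comparison)
        show "\<forall>\<^sub>F k in sequentially. norm (X (picard z k s) s - X (y s) s) \<le> C * norm (picard z k s - y s)"
          using Lip by simp
        show "(\<lambda>k. C * norm (picard z k s - y s)) \<longlonglongrightarrow> 0"
          by (intro tendsto_mult_right_zero tendsto_norm_zero LIM_zero y)
      qed
    qed (use bound integrable[OF picard_continuous] in auto)
    then show "(\<lambda>k. picard z (Suc k) t) \<longlonglongrightarrow> z + integral {0..t} (\<lambda>s. X (y s) s)"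
      by (simp add: tendsto_add)
  qed
  then show ?thesis using Lip_y cont by blast
qed

lemma initial_value_problem:
  obtains y where "y 0 = z" "lip_primitive y (\<lambda>t. X (y t) t)"
proof -
  obtain y where y: "\<forall>s t. norm (y s - y t) \<le> C * \<bar>s - t\<bar>" "continuous_on UNIV y"
    and eq: "\<forall>t. y t = z + integral {0..t} (\<lambda>s. X (y s) s)"
    using integral_equation_solvable[of z] by (elim exE conjE) (rule that)
  let ?g = "\<lambda>s. X (y s) s"
  have "\<exists>N. negligible N \<and> (\<forall>x. x \<in> {0<..<real n} - N \<longrightarrow>
      ((\<lambda>t. integral {0..t} ?g) has_vector_derivative ?g x) (at x))" for n
    using integral_has_vector_derivative_ae[OF integrable[OF y(2), of 0 "real n"]] by metis
  then obtain N where N: "\<And>n. negligible (N n)" "\<And>n x. x \<in> {0<..<real n} - N n \<Longrightarrow>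
      ((\<lambda>t. integral {0..t} ?g) has_vector_derivative ?g x) (at x)" by metis
  have "negligible (\<Union>n. N n)" by (rule negligible_countable_Union) (use N in auto)
  moreover have "{t. 0 < t \<and> \<not> (y has_vector_derivative ?g t) (at t)} \<subseteq> (\<Union>n. N n)"
  proof (rule subsetI, rule ccontr)
    fix t assume t: "t \<in> {t. 0 < t \<and> \<not> (y has_vector_derivative ?g t) (at t)}" "t \<notin> (\<Union>n. N n)"
    obtain n where "t < real n" using reals_Archimedean2 by blast
    with t have "((\<lambda>t. integral {0..t} ?g) has_vector_derivative ?g t) (at t)"
      by (intro N(2)[of t n]) auto
    then have "((\<lambda>t. z + integral {0..t} ?g) has_vector_derivative ?g t) (at t)"
      by (auto intro!: derivative_eq_intros)
    moreover have "(\<lambda>t. z + integral {0..t} ?g) = y" by (rule ext) (rule eq[rule_format, symmetric])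
    ultimately show False using t by simp
  qed
  ultimately have "negligible {t. 0 < t \<and> \<not> (y has_vector_derivative ?g t) (at t)}"
    by (rule negligible_subset)
  then have "lip_primitive y ?g"
    unfolding lip_primitive_def using y(1) C_nonneg by blast
  moreover have "y 0 = z" using eq[rule_format, of 0] by simp
  ultimately show ?thesis using that by blast
qed

end

text \<open>Composing the field with the radial projection onto a smaller closed ball makes it globally
  Lipschitz; as the norm decreases along solutions, they stay where the projection is the identity.\<close>

lemma solution_exists:
  fixes G :: "complex^'n \<Rightarrow> real \<Rightarrow> complex^'n"
  assumes G: "regular_field G" and z: "norm z < 1"
  obtains x where "solution G x" "x 0 = z"
proof (cases "z = 0")
  \<comment> \<open>The starting point 0 is treated apart, since the projection radius
    \<open>norm z\<close> has to be positive for points to be multiples of their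
    projections.\<close>
  case True
  have "solution G (\<lambda>t. 0)"
    by (simp add: solution_def lip_primitive_def regular_field_zero[OF G] exI[of _ "0::real"])
  then show ?thesis using that True by blast
next
  case False
  define r where "r = norm z"
  have r: "0 < r" "r < 1" using False z by (auto simp: r_def)
  obtain C where C: "C \<ge> 0"
    "\<And>x t. norm x \<le> r \<Longrightarrow> norm (G x t) \<le> C"
    "\<And>x y t. norm x \<le> r \<Longrightarrow> norm y \<le> r \<Longrightarrow> norm (G x t - G y t) \<le> C * norm (x - y)"
    using regular_field_bounds[OF r(2)] G by metis
  define X where "X a = G (radial_proj r a)" for a
  have p: "norm (radial_proj r a) \<le> r" for a :: "complex^'n" using norm_radial_proj r by (metis less_imp_le)
  interpret Caratheodory_field X C
  proof
    fix y :: "real \<Rightarrow> complex^'n" assume y: "continuous_on UNIV y"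
    have "continuous_on UNIV (radial_proj r :: complex^'n \<Rightarrow> _)"
      using radial_proj_Lipschitz[of r] r
      by (intro lipschitz_on_continuous_on[of 1] lipschitz_onI) (auto simp: dist_norm)
    then have "continuous_on UNIV (\<lambda>t. radial_proj r (y t))"
      using y by (rule continuous_on_compose2) simp
    then show "(\<lambda>t. X (y t) t) \<in> borel_measurable lebesgue"
      unfolding X_def using p r by (intro regular_field_measurable_along[OF G]) (metis order_le_less_trans)+
  next
    fix a b :: "complex^'n" and t
    show "norm (X a t) \<le> C" unfolding X_def by (rule C(2)[OF p])
    have "norm (X a t - X b t) \<le> C * norm (radial_proj r a - radial_proj r b)"
      unfolding X_def by (rule C(3)[OF p p])
    also have "\<dots> \<le> C * norm (a - b)"
      using radial_proj_Lipschitz[of r a b] r C by (intro mult_left_mono) auto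
    finally show "norm (X a t - X b t) \<le> C * norm (a - b)" .
  qed
  obtain y where y: "y 0 = z" "lip_primitive y (\<lambda>t. X (y t) t)" by (rule initial_value_problem)
  have ny: "norm (y t) \<le> r" if t: "t \<ge> 0" for t
  proof -
    have "(norm (y t))\<^sup>2 \<le> (norm (y 0))\<^sup>2"
    proof (rule lip_primitive_nonincreasing[OF lip_primitive_inner_self[OF y(2)] order_refl t])
      fix s
      obtain c where c: "c \<ge> 1" "y s = c *\<^sub>R radial_proj r (y s)" using radial_proj_scale[OF r(1)] .
      have "norm (radial_proj r (y s)) < 1" using p r by (metis order_le_less_trans)
      then have "inner (X (y s) s) (radial_proj r (y s)) \<le> 0"
        unfolding X_def by (rule regular_field_dissipative(1)[OF G])
      then have "c * inner (X (y s) s) (radial_proj r (y s)) \<le> 0" using c by (simp add: mult_le_0_iff)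
      moreover have "inner (X (y s) s) (y s) = c * inner (X (y s) s) (radial_proj r (y s))"
        by (metis c(2) inner_scaleR_right)
      ultimately show "2 * inner (X (y s) s) (y s) \<le> 0" by simp
    qed
    then show ?thesis by (simp add: y r_def)
  qed
  have "lip_primitive y (\<lambda>t. G (y t) t)"
    by (rule lip_primitive_cong[OF y(2)]) (use ny in \<open>simp add: X_def radial_proj_def\<close>)
  then have "solution G y"
    using ny r by (auto simp: solution_def intro: order_le_less_trans)
  then show ?thesis using that y by blast
qed

section \<open>Evolutions and the class \<open>S\<^sub>n\<^sup>0\<close>\<close>

lemma AE_lebesgue_on_pos_iff:
  "(AE t in lebesgue_on {0<..}. P t) \<longleftrightarrow> negligible {t::real. 0 < t \<and> \<not> P t}"
proof -
  have "(AE t in lebesgue_on {0<..}. P t) \<longleftrightarrow> (AE t::real in lebesgue. 0 < t \<longrightarrow> P t)"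
    by (subst AE_restrict_space_iff) auto
  also have "\<dots> \<longleftrightarrow> (\<exists>N. negligible N \<and> {t::real. \<not> (0 < t \<longrightarrow> P t)} \<subseteq> N)"
    by (rule eventually_ae_filter_negligible)
  also have "\<dots> \<longleftrightarrow> negligible {t::real. 0 < t \<and> \<not> P t}"
    by (auto intro: negligible_subset)
  finally show ?thesis .
qed

lemma minus_in_class_M: "(\<lambda>z\<in>unit_ball. - z) \<in> (class_M :: (complex^'n \<Rightarrow> complex^'n) set)"
proof -
  let ?h = "\<lambda>z\<in>unit_ball. - z :: complex^'n"
  have d: "(?h has_derivative (\<lambda>v. - v)) (at z)" if "z \<in> unit_ball" for z
  proof (rule has_derivative_transform_within_open[OF _ open_ball that])
    show "(uminus has_derivative (\<lambda>v::complex^'n. - v)) (at z)"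
      by (auto intro!: derivative_eq_intros)
  qed auto
  have m: "(\<lambda>v::complex^'n. - v) = (\<lambda>v. (- mat 1) *v v)"
  proof
    show "- v = (- mat 1) *v v" for v :: "complex^'n"
      using matrix_vector_mult_diff_rdistrib[of 0 "mat 1" v] by simp
  qed
  have "?h \<in> Hol"
    unfolding Hol_def using d m by auto metis
  moreover have "Re (cinner (?h z) z) \<le> 0" if "z \<in> unit_ball" for z
    using that by (simp add: Re_cinner)
  ultimately show ?thesis using d[of 0] by (auto simp: class_M_def)
qed

lemma regular_field_autonomous: "h \<in> class_M \<Longrightarrow> regular_field (\<lambda>z t. h z)"
proof -
  assume h: "h \<in> class_M"
  have "(\<lambda>z\<in>unit_ball. h z) = h"
    using Hol_extensional[OF class_M_Hol[OF h]] by (rule extensional_restrict)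
  with h show ?thesis by (simp add: regular_field_def)
qed

text \<open>At exceptional times the field is replaced by -z, a member of the class. The exceptional
  positive times form a null set, which is measurable, so measurability in time survives.\<close>

lemma herglotz_imp_regular_field:
  fixes G :: "complex^'n \<Rightarrow> real \<Rightarrow> complex^'n"
  assumes G: "herglotz_vector_field G"
  obtains G' where "regular_field G'" "negligible {t. 0 < t \<and> (\<exists>z\<in>unit_ball. G' z t \<noteq> G z t)}"
proof -
  define E where "E = {t. 0 < t \<and> (\<lambda>z\<in>unit_ball. G z t) \<in> class_M}"
  \<comment> \<open>The inner conditional extends a function that is measurable on the positive half
    line to all times; the outer one substitutes -z off \<open>E\<close>.\<close>
  define G' where "G' z t = (if t \<in> E then (if t \<in> {0<..} then G z t else 0) else - z)" for z t
  have neg: "negligible {t. 0 < t \<and> \<not> (\<lambda>z\<in>unit_ball. G z t) \<in> class_M}"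
    using G unfolding herglotz_vector_field_def AE_lebesgue_on_pos_iff by blast
  have "E = {0<..} - {t. 0 < t \<and> \<not> (\<lambda>z\<in>unit_ball. G z t) \<in> class_M}" by (auto simp: E_def)
  also have "\<dots> \<in> sets lebesgue" by (intro sets.Diff negligible_imp_sets[OF neg]) simp
  finally have E: "E \<in> sets lebesgue" .
  show ?thesis
  proof
    show "regular_field G'"
      unfolding regular_field_def
    proof (intro conjI allI ballI)
      fix t show "(\<lambda>z\<in>unit_ball. G' z t) \<in> class_M"
      proof (cases "t \<in> E")
        case True
        then have "t \<in> {0<..}" "(\<lambda>z\<in>unit_ball. G z t) \<in> class_M" by (simp_all add: E_def)
        then show ?thesis using True by (simp add: G'_def)
      next
        case False
        then show ?thesis using minus_in_class_M by (simp add: G'_def)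
      qed
    next
      fix z :: "complex^'n" assume z: "z \<in> unit_ball"
      have "(\<lambda>t. if t \<in> {0<..} then G z t else 0) \<in> borel_measurable lebesgue"
        using G z unfolding herglotz_vector_field_def by (intro borel_measurable_if_I) auto
      then have "(\<lambda>t. if t \<in> E then if t \<in> {0<..} then G z t else 0 else - z) \<in> borel_measurable lebesgue"
        by (rule measurable_If_set) (use E in auto)
      then show "G' z \<in> borel_measurable lebesgue" by (simp only: G'_def[abs_def])
    qed
    have "{t. 0 < t \<and> (\<exists>z\<in>unit_ball. G' z t \<noteq> G z t)} \<subseteq> {t. 0 < t \<and> \<not> (\<lambda>z\<in>unit_ball. G z t) \<in> class_M}"
      by (auto simp: G'_def E_def)
    then show "negligible {t. 0 < t \<and> (\<exists>z\<in>unit_ball. G' z t \<noteq> G z t)}" by (rule negligible_subset[OF neg])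
  qed
qed

lemma regular_imp_herglotz:
  assumes "regular_field G" shows "herglotz_vector_field G"
  using assms unfolding regular_field_def herglotz_vector_field_def by (auto intro: measurable_restrict_space1)

definition evolution :: "(complex^'n \<Rightarrow> real \<Rightarrow> complex^'n) \<Rightarrow> (real \<Rightarrow> complex^'n \<Rightarrow> complex^'n) \<Rightarrow> bool" where
  "evolution G \<phi> \<longleftrightarrow> (\<forall>z\<in>unit_ball. \<phi> 0 z = z \<and> solution G (\<lambda>t. \<phi> t z))"

lemma evolution_imp_is_evolution:
  assumes "evolution G \<phi>" shows "is_evolution G \<phi>"
  unfolding is_evolution_def AE_lebesgue_on_pos_iff
proof (intro ballI conjI allI impI)
  fix z :: "complex^'a" assume "z \<in> unit_ball"
  then have z: "\<phi> 0 z = z" "\<And>t. t \<ge> 0 \<Longrightarrow> norm (\<phi> t z) < 1"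
    and lp: "lip_primitive (\<lambda>t. \<phi> t z) (\<lambda>t. G (\<phi> t z) t)"
    using assms by (simp_all add: evolution_def solution_def)
  show "\<phi> 0 z = z" by (rule z)
  show "\<phi> t z \<in> unit_ball" if "t \<ge> 0" for t using z(2)[OF that] by simp
  show "absolutely_continuous_on {0..T} (\<lambda>t. \<phi> t z)" for T by (rule lip_primitive_AC[OF lp])
  show "negligible {t. 0 < t \<and> \<not> ((\<lambda>s. \<phi> s z) has_vector_derivative G (\<phi> t z) t) (at t)}"
    using lp by (simp add: lip_primitive_def)
qed

text \<open>On [0, T] a trajectory is continuous and hence stays in a ball of radius less than 1,
  where the modified field is bounded. Integrating the derivative then sharpens absolute continuity
  to a Lipschitz bound.\<close>

lemma is_evolution_imp_evolution:
  assumes \<phi>: "is_evolution G \<phi>" and G': "regular_field G'"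
    and neg: "negligible {t. 0 < t \<and> (\<exists>z\<in>unit_ball. G' z t \<noteq> G z t)}"
  shows "evolution G' \<phi>"
  unfolding evolution_def solution_def lip_primitive_def
proof (intro ballI conjI allI impI)
  fix z :: "complex^'a" assume z: "z \<in> unit_ball"
  let ?x = "\<lambda>t. \<phi> t z"
  have x: "\<phi> 0 z = z" "\<And>t. t \<ge> 0 \<Longrightarrow> ?x t \<in> unit_ball" "\<And>T. T > 0 \<Longrightarrow> absolutely_continuous_on {0..T} ?x"
    "negligible {t. 0 < t \<and> \<not> (?x has_vector_derivative G (?x t) t) (at t)}"
    using \<phi> z unfolding is_evolution_def AE_lebesgue_on_pos_iff by auto
  show "\<phi> 0 z = z" by (rule x)
  show "norm (\<phi> t z) < 1" if "t \<ge> 0" for t using x(2)[OF that] by simp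
  show neg': "negligible {t. 0 < t \<and> \<not> (?x has_vector_derivative G' (?x t) t) (at t)}"
  proof (rule negligible_subset[OF negligible_Un[OF x(4) neg]], safe)
    fix t :: real assume t: "0 < t" "\<not> (?x has_vector_derivative G' (?x t) t) (at t)"
      "\<not> (\<exists>z\<in>unit_ball. G' z t \<noteq> G z t)" "(?x has_vector_derivative G (?x t) t) (at t)"
    then have "G' (?x t) t = G (?x t) t" using x(2)[of t] by (meson less_imp_le)
    with t show False by simp
  qed
  show "\<exists>C\<ge>0. \<forall>s\<in>{0..T}. \<forall>t\<in>{0..T}. norm (?x s - ?x t) \<le> C * \<bar>s - t\<bar>" for T
  proof (cases "T > 0")
    case True
    have "continuous_on {0..T} (\<lambda>t. norm (?x t))"
      by (intro continuous_on_norm AC_imp_continuous_on x True)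
    then obtain t0 where t0: "t0 \<in> {0..T}" "\<And>t. t \<in> {0..T} \<Longrightarrow> norm (?x t) \<le> norm (?x t0)"
      using continuous_attains_sup[of "{0..T}" "\<lambda>t. norm (?x t)"] True by auto
    have r: "norm (?x t0) < 1" using x(2)[of t0] t0 by simp
    obtain C where C: "C \<ge> 0" "\<And>y t. norm y \<le> norm (?x t0) \<Longrightarrow> norm (G' y t) \<le> C"
      using regular_field_bounds[OF r] G' by metis
    have le: "norm (?x t - ?x s) \<le> C * \<bar>t - s\<bar>" if st: "s \<in> {0..T}" "t \<in> {0..T}" "s \<le> t" for s t
    proof -
      have ac: "absolutely_continuous_on {s..t} ?x"
        using x(3)[OF True] st unfolding absolutely_continuous_on_def
        by (meson atLeastatMost_subset_iff atLeastAtMost_iff order_trans)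
      have "((\<lambda>t. G' (?x t) t) has_integral ?x t - ?x s) {s..t}"
        by (rule AC_has_integral[OF st(3) ac, of "insert 0 {t. 0 < t \<and> \<not> (?x has_vector_derivative G' (?x t) t) (at t)}"])
          (use neg' st in auto)
      from has_integral_bound_real[OF C(1) finite.emptyI this] have "norm (?x t - ?x s) \<le> C * measure lborel {s..t}"
        using C(2)[OF t0(2)] st by simp
      then show ?thesis using st by simp
    qed
    show ?thesis
    proof (intro exI[of _ C] conjI ballI C(1))
      fix s t assume "s \<in> {0..T}" "t \<in> {0..T}"
      then show "norm (?x s - ?x t) \<le> C * \<bar>s - t\<bar>"
        using le[of s t] le[of t s] by (cases "s \<le> t") (simp_all add: norm_minus_commute abs_minus_commute)
    qed
  next
    case False
    then have eq: "s = t" if "s \<in> {0..T}" "t \<in> {0..T}" for s t using that by auto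
    show ?thesis
    proof (intro exI[of _ 0] conjI ballI)
      fix s t assume "s \<in> {0..T}" "t \<in> {0..T}"
      from eq[OF this] show "norm (?x s - ?x t) \<le> 0 * \<bar>s - t\<bar>" by simp
    qed simp
  qed
qed

lemma evolution_exists:
  assumes G: "regular_field G" obtains \<phi> where "evolution G \<phi>"
proof -
  have "\<exists>x. z \<in> unit_ball \<longrightarrow> solution G x \<and> x 0 = z" for z
    using solution_exists[OF G, of z] by (metis mem_ball_0)
  then obtain x where "\<And>z. z \<in> unit_ball \<Longrightarrow> solution G (x z) \<and> x z 0 = z" by metis
  then have "evolution G (\<lambda>t z. x z t)" by (simp add: evolution_def)
  then show ?thesis by (rule that)
qed

text \<open>Pointwise convergence is enough here, because the rate established below makes it
  locally uniform.\<close>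

definition evolution_limit ::
    "(complex^'n \<Rightarrow> real \<Rightarrow> complex^'n) \<Rightarrow> (real \<Rightarrow> complex^'n \<Rightarrow> complex^'n) \<Rightarrow> (complex^'n \<Rightarrow> complex^'n) \<Rightarrow> bool" where
  "evolution_limit G \<phi> f \<longleftrightarrow> regular_field G \<and> evolution G \<phi> \<and> f \<in> extensional unit_ball \<and>
     (\<forall>z\<in>unit_ball. ((\<lambda>t. exp t *\<^sub>R \<phi> t z) \<longlongrightarrow> f z) at_top)"

lemma evolution_limit_exists:
  assumes G: "regular_field G" and \<phi>: "evolution G \<phi>"
  obtains f where "evolution_limit G \<phi> f"
proof -
  have "\<exists>l. ((\<lambda>t. exp t *\<^sub>R \<phi> t z) \<longlongrightarrow> l) at_top" if z: "z \<in> unit_ball" for z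
  proof -
    have sol: "solution G (\<lambda>t. \<phi> t z)" "\<phi> 0 z = z" using \<phi> z by (auto simp: evolution_def)
    obtain K where K: "K \<ge> 0" "\<And>G x s t. regular_field G \<Longrightarrow> solution G x \<Longrightarrow> norm (x 0 :: complex^'a) \<le> norm z \<Longrightarrow> 0 \<le> s \<Longrightarrow> s \<le> t \<Longrightarrow>
       norm (exp t *\<^sub>R x t - exp s *\<^sub>R x s) \<le> K * exp (- s / 2)"
      using solution_exp_increment[OF norm_ge_zero, of z] z by (auto simp: mem_ball_0)
    have inc: "norm (exp t *\<^sub>R \<phi> t z - exp s *\<^sub>R \<phi> s z) \<le> K * exp (- s / 2)" if "0 \<le> s" "s \<le> t" for s t
      using K(2)[OF G sol(1)] sol(2) that by simp
    have small: "((\<lambda>s::real. K * exp (- s / 2)) \<longlongrightarrow> 0) at_top" by real_asymp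
    let ?w = "\<lambda>t. exp t *\<^sub>R \<phi> t z"
    \<comment> \<open>The limit is found along integer times; the increment estimate then carries it
      over to continuous time.\<close>
    have "Cauchy (\<lambda>n. ?w (real n))"
    proof (rule CauchyI')
      fix e :: real assume "e > 0"
      then have "\<forall>\<^sub>F s in at_top. K * exp (- s / 2) < e" using small order_tendstoD(2) by blast
      then obtain s0 where s0: "\<And>s. s \<ge> s0 \<Longrightarrow> K * exp (- s / 2) < e" by (auto simp: eventually_at_top_linorder)
      show "\<exists>M. \<forall>m\<ge>M. \<forall>n>m. dist (?w (real m)) (?w (real n)) < e"
      proof (intro exI allI impI)
        fix m n :: nat assume mn: "m \<ge> nat \<lceil>s0\<rceil>" "n > m"
        have "norm (?w (real n) - ?w (real m)) \<le> K * exp (- real m / 2)"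
          by (rule inc) (use mn in auto)
        also have "\<dots> < e" by (rule s0) (use mn in linarith)
        finally show "dist (?w (real m)) (?w (real n)) < e" unfolding dist_norm by (subst norm_minus_commute)
      qed
    qed
    then obtain l where l: "(\<lambda>n. ?w (real n)) \<longlonglongrightarrow> l" using Cauchy_convergent_iff convergent_def by blast
    have le: "norm (?w s - l) \<le> K * exp (- s / 2)" if "s \<ge> 0" for s
    proof (rule LIMSEQ_le_const2)
      show "(\<lambda>n. norm (?w s - ?w (real n))) \<longlonglongrightarrow> norm (?w s - l)" by (intro tendsto_intros l)
      show "\<exists>N. \<forall>n\<ge>N. norm (?w s - ?w (real n)) \<le> K * exp (- s / 2)"
      proof (intro exI[of _ "nat \<lceil>s\<rceil>"] allI impI)
        fix n assume "n \<ge> nat \<lceil>s\<rceil>"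
        then have "s \<le> real n" by linarith
        then show "norm (?w s - ?w (real n)) \<le> K * exp (- s / 2)"
          using inc[OF that] by (subst norm_minus_commute) blast
      qed
    qed
    have "(?w \<longlongrightarrow> l) at_top"
    proof (rule LIM_zero_cancel, rule Lim_null_comparison[OF _ small])
      show "\<forall>\<^sub>F s in at_top. norm (?w s - l) \<le> K * exp (- s / 2)"
        using eventually_ge_at_top[of 0] by eventually_elim (rule le)
    qed
    then show ?thesis by blast
  qed
  then obtain f where f: "\<And>z. z \<in> unit_ball \<Longrightarrow> ((\<lambda>t. exp t *\<^sub>R \<phi> t z) \<longlongrightarrow> f z) at_top" by metis
  have "evolution_limit G \<phi> (restrict f unit_ball)"
    unfolding evolution_limit_def using G \<phi> f by simp
  then show ?thesis by (rule that)
qed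

text \<open>The later time in the increment estimate tends to infinity. That \<open>K\<close> is
  independent of the field gives, besides locally uniform convergence, a bound common to the whole
  class of limits.\<close>

lemma evolution_limit_rate:
  assumes r: "0 \<le> r" "r < 1"
  obtains K where "K \<ge> 0"
    "\<And>G \<phi> f z t. evolution_limit G \<phi> f \<Longrightarrow> norm (z :: complex^'n) \<le> r \<Longrightarrow> 0 \<le> t \<Longrightarrow>
       norm (exp t *\<^sub>R \<phi> t z - f z) \<le> K * exp (- t / 2)"
proof -
  obtain K where K: "K \<ge> 0" "\<And>G x s t. regular_field G \<Longrightarrow> solution G x \<Longrightarrow> norm (x 0 :: complex^'n) \<le> r \<Longrightarrow> 0 \<le> s \<Longrightarrow> s \<le> t \<Longrightarrow>
       norm (exp t *\<^sub>R x t - exp s *\<^sub>R x s) \<le> K * exp (- s / 2)"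
    using solution_exp_increment[OF r] by blast
  show ?thesis
  proof (rule that[OF K(1)])
    fix G :: "complex^'n \<Rightarrow> real \<Rightarrow> complex^'n" and \<phi> f and z :: "complex^'n" and t :: real
    assume f: "evolution_limit G \<phi> f" and z: "norm z \<le> r" and t: "0 \<le> t"
    have zb: "z \<in> unit_ball" using z r by simp
    have sol: "regular_field G" "solution G (\<lambda>t. \<phi> t z)" "\<phi> 0 z = z" "((\<lambda>t. exp t *\<^sub>R \<phi> t z) \<longlongrightarrow> f z) at_top"
      using f zb by (auto simp: evolution_limit_def evolution_def)
    show "norm (exp t *\<^sub>R \<phi> t z - f z) \<le> K * exp (- t / 2)"
    proof (rule tendsto_upperbound)
      show "((\<lambda>s. norm (exp t *\<^sub>R \<phi> t z - exp s *\<^sub>R \<phi> s z)) \<longlongrightarrow> norm (exp t *\<^sub>R \<phi> t z - f z)) at_top"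
        by (intro tendsto_intros sol)
      show "\<forall>\<^sub>F s in at_top. norm (exp t *\<^sub>R \<phi> t z - exp s *\<^sub>R \<phi> s z) \<le> K * exp (- t / 2)"
        using eventually_ge_at_top[of t]
      proof eventually_elim
        case (elim s)
        then show ?case
          using K(2)[OF sol(1,2), of t s] sol(3) z t by (subst norm_minus_commute) simp
      qed
    qed simp
  qed
qed

lemma compact_subset_unit_ball:
  fixes K :: "(complex^'n) set"
  assumes "compact K" "K \<subseteq> unit_ball"
  obtains r where "0 \<le> r" "r < 1" "\<And>z. z \<in> K \<Longrightarrow> norm z \<le> r"
proof (cases "K = {}")
  case True
  then show ?thesis using that[of 0] by auto
next
  case False
  obtain x where "x \<in> K" "\<forall>y\<in>K. norm y \<le> norm x"
    using continuous_attains_sup[OF assms(1) False continuous_on_norm[OF continuous_on_id]] by auto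
  then show ?thesis using that[of "norm x"] assms(2) by auto
qed

lemma class_S0_iff: "f \<in> class_S0 \<longleftrightarrow> (\<exists>G \<phi>. evolution_limit G \<phi> f)"
proof
  assume "f \<in> class_S0"
  then obtain G \<phi> where G: "herglotz_vector_field G" and f: "f \<in> extensional unit_ball" and \<phi>: "is_evolution G \<phi>"
    and lim: "\<And>K. compact K \<Longrightarrow> K \<subseteq> unit_ball \<Longrightarrow> uniform_limit K (\<lambda>t z. exp t *\<^sub>R \<phi> t z) f at_top"
    unfolding class_S0_def is_herglotz_limit_def by auto
  obtain G' where G': "regular_field G'" "negligible {t. 0 < t \<and> (\<exists>z\<in>unit_ball. G' z t \<noteq> G z t)}"
    using herglotz_imp_regular_field[OF G] .
  have "((\<lambda>t. exp t *\<^sub>R \<phi> t z) \<longlongrightarrow> f z) at_top" if "z \<in> unit_ball" for z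
    by (rule tendsto_uniform_limitI[OF lim[of "{z}"]]) (use that in auto)
  then have "evolution_limit G' \<phi> f"
    unfolding evolution_limit_def using f G' is_evolution_imp_evolution[OF \<phi> G'] by blast
  then show "\<exists>G \<phi>. evolution_limit G \<phi> f" by blast
next
  assume "\<exists>G \<phi>. evolution_limit G \<phi> f"
  then obtain G \<phi> where f: "evolution_limit G \<phi> f" by blast
  have unif: "uniform_limit K (\<lambda>t z. exp t *\<^sub>R \<phi> t z) f at_top" if K: "compact K" "K \<subseteq> unit_ball" for K
  proof -
    obtain r where r: "0 \<le> r" "r < 1" "\<And>z. z \<in> K \<Longrightarrow> norm z \<le> r" using compact_subset_unit_ball[OF K] by blast
    obtain C where C: "C \<ge> 0" "\<And>z t. norm z \<le> r \<Longrightarrow> 0 \<le> t \<Longrightarrow> norm (exp t *\<^sub>R \<phi> t z - f z) \<le> C * exp (- t / 2)"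
      using evolution_limit_rate[OF r(1,2)] f by metis
    show ?thesis
    proof (rule uniform_limitI)
      fix e :: real assume "e > 0"
      moreover have "((\<lambda>s::real. C * exp (- s / 2)) \<longlongrightarrow> 0) at_top" by real_asymp
      ultimately have "\<forall>\<^sub>F s in at_top. C * exp (- s / 2) < e" using order_tendstoD(2) by blast
      then show "\<forall>\<^sub>F t in at_top. \<forall>z\<in>K. dist (exp t *\<^sub>R \<phi> t z) (f z) < e"
        using eventually_ge_at_top[of 0]
      proof eventually_elim
        case (elim t)
        then show ?case using C(2)[OF r(3), of _ t] by (fastforce simp: dist_norm intro: le_less_trans)
      qed
    qed
  qed
  have "herglotz_vector_field G" "is_evolution G \<phi>" "f \<in> extensional unit_ball"
    using f regular_imp_herglotz evolution_imp_is_evolution unfolding evolution_limit_def by blast+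
  moreover from this unif have "is_herglotz_limit G f"
    unfolding is_herglotz_limit_def by blast
  ultimately show "f \<in> class_S0" unfolding class_S0_def by blast
qed

section \<open>Shifting and concatenating fields\<close>

lemma lebesgue_measurable_shift:
  fixes f :: "real \<Rightarrow> 'a::topological_space"
  assumes "f \<in> borel_measurable lebesgue"
  shows "(\<lambda>t. f (t + s)) \<in> borel_measurable lebesgue"
proof (rule measurableI)
  fix A :: "'a set" assume A: "A \<in> sets borel"
  \<comment> \<open>Composition of Lebesgue measurable functions may fail to be measurable; here the
    preimage is a translate of a Lebesgue set, and translates of Lebesgue sets are again such
    sets.\<close>
  have "(\<lambda>t. f (t + s)) -` A = (\<lambda>x. - s + x) ` (f -` A)"
    by (auto simp: image_iff intro!: bexI[of _ "_ + s"])
  moreover have "f -` A \<in> sets lebesgue" using measurable_sets[OF assms A] by simp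
  ultimately show "(\<lambda>t. f (t + s)) -` A \<inter> space lebesgue \<in> sets lebesgue"
    using lebesgue_sets_translation[of "f -` A" "- s"] by simp
qed simp

lemma regular_field_shift: "regular_field G \<Longrightarrow> regular_field (\<lambda>z t. G z (t + s))"
  unfolding regular_field_def by (auto intro: lebesgue_measurable_shift)

lemma regular_field_concat:
  assumes H: "regular_field H" and G: "regular_field G"
  shows "regular_field (\<lambda>z t. if t \<le> s then H z t else G z (t - s))"
  unfolding regular_field_def
proof (intro conjI allI ballI)
  fix t show "(\<lambda>z\<in>unit_ball. if t \<le> s then H z t else G z (t - s)) \<in> class_M"
    using H G by (cases "t \<le> s") (simp_all add: regular_field_def)
next
  fix z :: "complex^'a" assume z: "z \<in> unit_ball"
  have "(\<lambda>t. G z (t + - s)) \<in> borel_measurable lebesgue"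
    using G z by (intro lebesgue_measurable_shift) (simp add: regular_field_def)
  then have "(\<lambda>t. if t \<in> {..s} then H z t else G z (t + - s)) \<in> borel_measurable lebesgue"
    using H z by (intro measurable_If_set) (auto simp: regular_field_def)
  then show "(\<lambda>t. if t \<le> s then H z t else G z (t - s)) \<in> borel_measurable lebesgue"
    by (simp only: atMost_iff diff_conv_add_uminus)
qed

text \<open>After time \<open>s\<close> the rescaled composite flow at \<open>t\<close> is e^s
  (e^(t-s) \<phi>_(t-s)) \<circ> \<xi>_s, and the inner factor tends to \<open>f\<close>.\<close>

lemma evolution_limit_concat:
  assumes H: "regular_field H" and \<xi>: "evolution H \<xi>" and f: "evolution_limit G \<phi> f" and s: "s \<ge> 0"
  shows "evolution_limit (\<lambda>z t. if t \<le> s then H z t else G z (t - s))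
           (\<lambda>t z. if t \<le> s then \<xi> t z else \<phi> (t - s) (\<xi> s z))
           (\<lambda>z\<in>unit_ball. exp s *\<^sub>R f (\<xi> s z))"
    (is "evolution_limit ?K ?\<psi> ?f")
  unfolding evolution_limit_def
proof (intro conjI ballI)
  have G: "regular_field G" "evolution G \<phi>" using f by (auto simp: evolution_limit_def)
  show "regular_field ?K" by (rule regular_field_concat[OF H G(1)])
  have sol: "solution H (\<lambda>t. \<xi> t z)" "\<xi> 0 z = z" "norm (\<xi> s z) < 1"
    "solution G (\<lambda>t. \<phi> t (\<xi> s z))" "\<phi> 0 (\<xi> s z) = \<xi> s z" if "z \<in> unit_ball" for z
  proof -
    show *: "solution H (\<lambda>t. \<xi> t z)" "\<xi> 0 z = z" using \<xi> that by (auto simp: evolution_def)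
    then show "norm (\<xi> s z) < 1" using s by (simp add: solution_def)
    then show "solution G (\<lambda>t. \<phi> t (\<xi> s z))" "\<phi> 0 (\<xi> s z) = \<xi> s z" using G(2) by (auto simp: evolution_def)
  qed
  show "evolution ?K ?\<psi>"
    unfolding evolution_def
  proof (intro ballI conjI)
    fix z :: "complex^'a" assume z: "z \<in> unit_ball"
    show "(if 0 \<le> s then \<xi> 0 z else \<phi> (0 - s) (\<xi> s z)) = z" using s sol(2)[OF z] by simp
    have "lip_primitive (\<lambda>t. if t \<le> s then \<xi> t z else \<phi> (t - s) (\<xi> s z))
       (\<lambda>t. if t \<le> s then H (\<xi> t z) t else G (\<phi> (t - s) (\<xi> s z)) (t - s))"
      using sol[OF z] s
      by (intro lip_primitive_concat[where v="\<lambda>t. \<phi> t (\<xi> s z)" and h="\<lambda>t. G (\<phi> t (\<xi> s z)) t"])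
        (simp_all add: solution_def)
    then have "lip_primitive (\<lambda>t. ?\<psi> t z) (\<lambda>t. ?K (?\<psi> t z) t)"
      by (rule lip_primitive_cong) simp
    moreover have "norm (?\<psi> t z) < 1" if "t \<ge> 0" for t
      using sol(1,4)[OF z] that by (simp add: solution_def)
    ultimately show "solution ?K (\<lambda>t. ?\<psi> t z)" by (simp add: solution_def)
  qed
  show "?f \<in> extensional unit_ball" by simp
  fix z :: "complex^'a" assume z: "z \<in> unit_ball"
  have "((\<lambda>t. exp t *\<^sub>R \<phi> t (\<xi> s z)) \<longlongrightarrow> f (\<xi> s z)) at_top"
    using f sol(3)[OF z] by (simp add: evolution_limit_def)
  then have "((\<lambda>t. exp (t + - s) *\<^sub>R \<phi> (t + - s) (\<xi> s z)) \<longlongrightarrow> f (\<xi> s z)) at_top"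
    by (rule filterlim_compose) real_asymp
  then have "((\<lambda>t. exp s *\<^sub>R (exp (t + - s) *\<^sub>R \<phi> (t + - s) (\<xi> s z))) \<longlongrightarrow> exp s *\<^sub>R f (\<xi> s z)) at_top"
    by (intro tendsto_intros)
  moreover have "\<forall>\<^sub>F t in at_top. exp s *\<^sub>R (exp (t + - s) *\<^sub>R \<phi> (t + - s) (\<xi> s z)) = exp t *\<^sub>R ?\<psi> t z"
    using eventually_gt_at_top[of s] by eventually_elim (simp flip: exp_add)
  ultimately have "((\<lambda>t. exp t *\<^sub>R ?\<psi> t z) \<longlongrightarrow> exp s *\<^sub>R f (\<xi> s z)) at_top"
    by (rule Lim_transform_eventually)
  then show "((\<lambda>t. exp t *\<^sub>R ?\<psi> t z) \<longlongrightarrow> ?f z) at_top" using z by simp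
qed

lemma class_S0_concat:
  assumes "regular_field H" "evolution H \<xi>" "f \<in> class_S0" "s \<ge> 0"
  shows "(\<lambda>z\<in>unit_ball. exp s *\<^sub>R f (\<xi> s z)) \<in> class_S0"
  using assms evolution_limit_concat unfolding class_S0_iff by blast

lemma id_in_class_S0: "(\<lambda>z\<in>unit_ball. z) \<in> (class_S0 :: (complex^'n \<Rightarrow> complex^'n) set)"
proof -
  let ?G = "\<lambda>(z :: complex^'n) (t :: real). (\<lambda>z\<in>unit_ball. - z) z"
  let ?\<phi> = "\<lambda>(t :: real) (z :: complex^'n). exp (- t) *\<^sub>R z"
  have lt: "norm (exp (- t) *\<^sub>R z) < 1" if "norm z < 1" "t \<ge> 0" for t and z :: "complex^'n"
  proof -
    have "exp (- t) * norm z \<le> 1 * norm z" by (rule mult_right_mono) (use that in auto)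
    then show ?thesis using that by simp
  qed
  have "evolution ?G ?\<phi>"
    unfolding evolution_def
  proof (intro ballI conjI)
    fix z :: "complex^'n" assume z: "z \<in> unit_ball"
    have c: "lip_primitive (\<lambda>t. z) (\<lambda>t. 0)"
      by (auto simp: lip_primitive_def intro!: exI[of _ "0::real"])
    have "lip_primitive (\<lambda>t. exp (- 1 * t) *\<^sub>R z) (\<lambda>t. exp (- 1 * t) *\<^sub>R 0 + (- 1 * exp (- 1 * t)) *\<^sub>R z)"
      by (rule lip_primitive_bilinear[OF bounded_bilinear_scaleR lip_primitive_exp c])
    then have "lip_primitive (\<lambda>t. exp (- t) *\<^sub>R z) (\<lambda>t. - (exp (- t) *\<^sub>R z))" by simp
    then have "lip_primitive (\<lambda>t. exp (- t) *\<^sub>R z) (\<lambda>t. ?G (?\<phi> t z) t)"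
      by (rule lip_primitive_cong) (use lt[of z] z in simp)
    then show "solution ?G (\<lambda>t. ?\<phi> t z)" using lt z by (simp add: solution_def)
  qed simp
  moreover have "((\<lambda>t. exp t *\<^sub>R ?\<phi> t z) \<longlongrightarrow> z) at_top" for z by (simp flip: exp_add)
  ultimately have "evolution_limit ?G ?\<phi> (\<lambda>z\<in>unit_ball. z)"
    unfolding evolution_limit_def using regular_field_autonomous[OF minus_in_class_M] by simp
  then show ?thesis unfolding class_S0_iff by blast
qed

text \<open>Continue the evolution after time \<open>s\<close> with the field \<open>-z\<close>, whose flow is \<open>e\<^sup>-\<^sup>t z\<close>.  This is how
  \<open>\<phi>\<^sub>s\<close> is seen to be holomorphic.\<close>

lemma evolution_in_class_S0:
  assumes G: "regular_field G" and \<phi>: "evolution G \<phi>" and s: "s \<ge> 0"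
  shows "(\<lambda>z\<in>unit_ball. exp s *\<^sub>R \<phi> s z) \<in> class_S0"
proof -
  have "norm (\<phi> s z) < 1" if "z \<in> unit_ball" for z
    using \<phi> that s by (simp add: evolution_def solution_def)
  then have "(\<lambda>z\<in>unit_ball. exp s *\<^sub>R (\<lambda>z\<in>unit_ball. z) (\<phi> s z)) = (\<lambda>z\<in>unit_ball. exp s *\<^sub>R \<phi> s z)"
    by (intro restrict_ext) simp
  then show ?thesis using class_S0_concat[OF G \<phi> id_in_class_S0 s] by simp
qed

text \<open>By uniqueness the evolution of the shifted field carries \<open>\<phi> s z\<close> to
  \<open>\<phi> (t + s) z\<close>; multiplication by e^(t+s) and t \<rightarrow> \<infinity> factor
  \<open>F\<close> through \<open>\<phi> s\<close>.\<close>

lemma class_S0_factor: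
  assumes F: "evolution_limit G \<phi> F" and s: "s \<ge> 0"
  obtains Fs where "Fs \<in> class_S0" "\<And>z. z \<in> unit_ball \<Longrightarrow> F z = exp s *\<^sub>R Fs (\<phi> s z)"
proof -
  have G: "regular_field G" and \<phi>: "evolution G \<phi>" using F by (auto simp: evolution_limit_def)
  let ?G = "\<lambda>z t. G z (t + s)"
  have Gs: "regular_field ?G" by (rule regular_field_shift[OF G])
  obtain \<psi> where \<psi>: "evolution ?G \<psi>" using evolution_exists[OF Gs] .
  obtain Fs where Fs: "evolution_limit ?G \<psi> Fs" using evolution_limit_exists[OF Gs \<psi>] .
  have "F z = exp s *\<^sub>R Fs (\<phi> s z)" if z: "z \<in> unit_ball" for z
  proof (rule tendsto_unique)
    have sol: "solution G (\<lambda>t. \<phi> t z)" using \<phi> z by (simp add: evolution_def)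
    then have b: "\<phi> s z \<in> unit_ball" using s by (simp add: solution_def)
    have "solution ?G (\<lambda>t. \<phi> (t + s) z)"
      using sol lip_primitive_shift[of "\<lambda>t. \<phi> t z" "\<lambda>t. G (\<phi> t z) t" s] s by (simp add: solution_def)
    moreover have "solution ?G (\<lambda>t. \<psi> t (\<phi> s z))" "\<psi> 0 (\<phi> s z) = \<phi> s z" using \<psi> b by (auto simp: evolution_def)
    ultimately have eq: "\<psi> t (\<phi> s z) = \<phi> (t + s) z" if "t \<ge> 0" for t
      using solution_unique[OF Gs, of "\<lambda>t. \<psi> t (\<phi> s z)" "\<lambda>t. \<phi> (t + s) z" t] that by simp
    have "((\<lambda>t. exp t *\<^sub>R \<psi> t (\<phi> s z)) \<longlongrightarrow> Fs (\<phi> s z)) at_top"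
      using Fs b by (simp add: evolution_limit_def)
    then have "((\<lambda>t. exp s *\<^sub>R (exp t *\<^sub>R \<psi> t (\<phi> s z))) \<longlongrightarrow> exp s *\<^sub>R Fs (\<phi> s z)) at_top"
      by (intro tendsto_intros)
    moreover have "\<forall>\<^sub>F t in at_top. exp s *\<^sub>R (exp t *\<^sub>R \<psi> t (\<phi> s z)) = exp (t + s) *\<^sub>R \<phi> (t + s) z"
      using eventually_ge_at_top[of 0] by eventually_elim (simp add: eq exp_add mult.commute)
    ultimately show "((\<lambda>t. exp (t + s) *\<^sub>R \<phi> (t + s) z) \<longlongrightarrow> exp s *\<^sub>R Fs (\<phi> s z)) at_top"
      by (rule Lim_transform_eventually)
    have "((\<lambda>t. exp t *\<^sub>R \<phi> t z) \<longlongrightarrow> F z) at_top" using F z by (simp add: evolution_limit_def)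
    then show "((\<lambda>t. exp (t + s) *\<^sub>R \<phi> (t + s) z) \<longlongrightarrow> F z) at_top"
      by (rule filterlim_compose) real_asymp
  qed simp
  moreover have "Fs \<in> class_S0" unfolding class_S0_iff using Fs by blast
  ultimately show ?thesis using that by blast
qed

text \<open>At time 0 the rescaled flow is the identity, so the rate estimate bounds the distance of
  every member of the class from \<open>z\<close>.\<close>

lemma class_S0_bound:
  assumes "r < 1"
  obtains K where "\<And>f z. f \<in> class_S0 \<Longrightarrow> norm (z :: complex^'n) \<le> r \<Longrightarrow> norm (f z) \<le> K"
proof (cases "0 \<le> r")
  case True
  then obtain K where K: "K \<ge> 0" "\<And>G \<phi> f z t. evolution_limit G \<phi> f \<Longrightarrow> norm (z :: complex^'n) \<le> r \<Longrightarrow> 0 \<le> t \<Longrightarrow>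
       norm (exp t *\<^sub>R \<phi> t z - f z) \<le> K * exp (- t / 2)"
    using evolution_limit_rate[OF True assms] by blast
  show ?thesis
  proof (rule that[of "1 + K"])
    fix f :: "complex^'n \<Rightarrow> complex^'n" and z :: "complex^'n" assume f: "f \<in> class_S0" and z: "norm z \<le> r"
    obtain G \<phi> where e: "evolution_limit G \<phi> f" using f unfolding class_S0_iff by blast
    then have "\<phi> 0 z = z" using z assms by (simp add: evolution_limit_def evolution_def)
    then have "norm (z - f z) \<le> K" using K(2)[OF e z order_refl] by simp
    then show "norm (f z) \<le> 1 + K"
      using norm_triangle_ineq2[of "f z" z] z assms by (simp add: norm_minus_commute)
  qed
next
  case False
  then show ?thesis using that[of 0] by (meson norm_ge_zero order_trans)
qed

text \<open>The first-order bound keeps the quotients (\<phi>_t - id)/t bounded. The last bound,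
  quadratic in |z|, later forces their limits to have derivative -id at 0.\<close>

lemma evolution_small_time:
  assumes r: "r < 1"
  obtains C where "C \<ge> 0"
    "\<And>G \<phi> z t. regular_field G \<Longrightarrow> evolution G \<phi> \<Longrightarrow> norm (z :: complex^'n) \<le> r \<Longrightarrow> 0 \<le> t \<Longrightarrow>
       norm (\<phi> t z) \<le> norm z \<and> norm (\<phi> t z - z) \<le> C * t \<and>
       norm (exp t *\<^sub>R \<phi> t z - z) \<le> C * exp t * (norm z)\<^sup>2 * t"
proof -
  obtain C where C: "C \<ge> 0"
    "\<And>G x t. regular_field G \<Longrightarrow> norm (x :: complex^'n) \<le> r \<Longrightarrow> norm (G x t) \<le> C"
    "\<And>G x t. regular_field G \<Longrightarrow> norm (x :: complex^'n) \<le> r \<Longrightarrow> norm (G x t + x) \<le> C * (norm x)\<^sup>2"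
    using regular_field_bounds[OF r] by metis
  show ?thesis
  proof (rule that[OF C(1)])
    fix G :: "complex^'n \<Rightarrow> real \<Rightarrow> complex^'n" and \<phi> and z :: "complex^'n" and t :: real
    assume G: "regular_field G" and \<phi>: "evolution G \<phi>" and z: "norm z \<le> r" and t: "0 \<le> t"
    have sol: "solution G (\<lambda>t. \<phi> t z)" "\<phi> 0 z = z" using \<phi> z r by (auto simp: evolution_def)
    have dec: "norm (\<phi> s z) \<le> norm z" if "s \<ge> 0" for s
      using solution_norm_antimono[OF G sol(1) order_refl that] sol(2) by simp
    have "norm (\<phi> t z - \<phi> 0 z) \<le> C * (t - 0)"
    proof (rule lip_primitive_norm_le[OF _ order_refl t C(1)])
      show "lip_primitive (\<lambda>t. \<phi> t z) (\<lambda>t. G (\<phi> t z) t)" using sol by (simp add: solution_def)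
      show "norm (G (\<phi> s z) s) \<le> C" if "s \<in> {0..t}" for s
        using C(2)[OF G] dec[of s] z that by force
    qed
    moreover have "norm (exp t *\<^sub>R \<phi> t z - exp 0 *\<^sub>R \<phi> 0 z) \<le> C * exp t * (norm z)\<^sup>2 * (t - 0)"
    proof (rule lip_primitive_norm_le[OF solution_exp_lip_primitive[OF sol(1)] order_refl t])
      show "0 \<le> C * exp t * (norm z)\<^sup>2" using C by simp
      fix s assume s: "s \<in> {0..t}"
      have n: "norm (\<phi> s z) \<le> r" using dec[of s] s z by simp
      have "norm (G (\<phi> s z) s + \<phi> s z) \<le> C * (norm (\<phi> s z))\<^sup>2" by (rule C(3)[OF G n])
      also have "\<dots> \<le> C * (norm z)\<^sup>2" using dec[of s] s C by (intro mult_left_mono power_mono) auto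
      finally have "exp s * norm (G (\<phi> s z) s + \<phi> s z) \<le> exp t * (C * (norm z)\<^sup>2)"
        using s by (intro mult_mono) auto
      then show "norm (exp s *\<^sub>R (G (\<phi> s z) s + \<phi> s z)) \<le> C * exp t * (norm z)\<^sup>2"
        by (simp only: norm_scaleR abs_exp_cancel mult.assoc mult.left_commute[of C])
    qed
    ultimately show "norm (\<phi> t z) \<le> norm z \<and> norm (\<phi> t z - z) \<le> C * t \<and>
       norm (exp t *\<^sub>R \<phi> t z - z) \<le> C * exp t * (norm z)\<^sup>2 * t"
      using dec[OF t] sol(2) by simp
  qed
qed

section \<open>Complex derivatives of functionals\<close>

lemma Hol_affine:
  fixes f k :: "complex^'n \<Rightarrow> complex^'n"
  assumes f: "f \<in> Hol" and k: "k \<in> Hol"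
  shows "(\<lambda>z\<in>unit_ball. f z + c *\<^sub>R k z) \<in> Hol"
  unfolding Hol_def
proof (intro CollectI conjI ballI)
  fix z :: "complex^'n" assume z: "z \<in> unit_ball"
  obtain A B :: "complex^'n^'n" where A: "(f has_derivative (\<lambda>v. A *v v)) (at z)"
    and B: "(k has_derivative (\<lambda>v. B *v v)) (at z)"
    using f k z unfolding Hol_def by blast
  have m: "(\<lambda>v. A *v v + c *\<^sub>R (B *v v)) = (\<lambda>v. (A + c *\<^sub>R B) *v v)"
    by (simp add: fun_eq_iff vec_eq_iff matrix_vector_mult_def scaleR_sum_right sum.distrib distrib_right)
  have "((\<lambda>z. f z + c *\<^sub>R k z) has_derivative (\<lambda>v. A *v v + c *\<^sub>R (B *v v))) (at z)"
    by (intro has_derivative_add has_derivative_scaleR_right A B)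
  then have "((\<lambda>z\<in>unit_ball. f z + c *\<^sub>R k z) has_derivative (\<lambda>v. (A + c *\<^sub>R B) *v v)) (at z)"
    unfolding m by (rule has_derivative_transform_within_open[OF _ open_ball z]) simp
  then show "\<exists>A::complex^'n^'n. ((\<lambda>z\<in>unit_ball. f z + c *\<^sub>R k z) has_derivative (\<lambda>v. A *v v)) (at z)" by blast
qed simp

lemma Hol_scale_diff:
  fixes f k :: "complex^'n \<Rightarrow> complex^'n"
  assumes f: "f \<in> Hol" and k: "k \<in> Hol"
  shows "(\<lambda>z\<in>unit_ball. c *\<^sub>R (f z - k z)) \<in> Hol"
proof -
  have d: "(\<lambda>z\<in>unit_ball. f z + (- 1) *\<^sub>R k z) \<in> Hol" by (rule Hol_affine[OF f k])
  \<comment> \<open>With d = f - k, the map c d is written as d + (c - 1) d, a combination to which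
    the affine case applies again.\<close>
  have "(\<lambda>z\<in>unit_ball. (\<lambda>z\<in>unit_ball. f z + (- 1) *\<^sub>R k z) z + (c - 1) *\<^sub>R (\<lambda>z\<in>unit_ball. f z + (- 1) *\<^sub>R k z) z) \<in> Hol"
    by (rule Hol_affine[OF d d])
  also have "(\<lambda>z\<in>unit_ball. (\<lambda>z\<in>unit_ball. f z + (- 1) *\<^sub>R k z) z + (c - 1) *\<^sub>R (\<lambda>z\<in>unit_ball. f z + (- 1) *\<^sub>R k z) z)
     = (\<lambda>z\<in>unit_ball. c *\<^sub>R (f z - k z))"
    by (intro restrict_ext) (simp add: scaleR_diff_left)
  finally show ?thesis .
qed

definition loc_unif_limit :: "(nat \<Rightarrow> complex^'n \<Rightarrow> complex^'n) \<Rightarrow> (complex^'n \<Rightarrow> complex^'n) \<Rightarrow> bool" where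
  "loc_unif_limit f g \<longleftrightarrow> (\<forall>r<1. uniform_limit (cball 0 r) f g sequentially)"

lemma uniform_limit_by_bound:
  fixes f :: "nat \<Rightarrow> 'a \<Rightarrow> 'b::real_normed_vector"
  assumes "\<forall>\<^sub>F n in sequentially. \<forall>z\<in>S. norm (f n z - g z) \<le> b n z"
    and "uniform_limit S b (\<lambda>_. 0 :: real) sequentially"
  shows "uniform_limit S f g sequentially"
proof (rule uniform_limitI)
  fix e :: real assume "e > 0"
  from uniform_limitD[OF assms(2) this] assms(1)
  show "\<forall>\<^sub>F n in sequentially. \<forall>z\<in>S. dist (f n z) (g z) < e"
    by eventually_elim (fastforce simp: dist_norm)
qed

lemma uniform_limit_of_tendsto:
  assumes "(b \<longlongrightarrow> l) F" shows "uniform_limit S (\<lambda>n z. b n) (\<lambda>_. l) F"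
  using assms by (auto simp: uniform_limit_iff tendsto_iff)

lemma uniform_limit_norm_diff:
  assumes "uniform_limit S f g F"
  shows "uniform_limit S (\<lambda>n z. norm (f n z - g z)) (\<lambda>_. 0) F"
  using assms by (simp add: uniform_limit_iff dist_norm)

lemma loc_unif_limit_pointwise:
  assumes "loc_unif_limit f g" "norm z < 1" shows "(\<lambda>n. f n z) \<longlonglongrightarrow> g z"
proof -
  have "uniform_limit (cball 0 (norm z)) f g sequentially"
    using assms by (simp add: loc_unif_limit_def)
  from tendsto_uniform_limitI[OF this, of z] show ?thesis by simp
qed

lemma Hol_bounded_on:
  fixes f :: "complex^'n \<Rightarrow> complex^'n"
  assumes "f \<in> Hol" "r < 1"
  obtains M where "M \<ge> 0" "\<And>z. norm z \<le> r \<Longrightarrow> norm (f z) \<le> M"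
proof -
  have "continuous_on (cball 0 r) f"
    by (rule Hol_continuous_on[OF assms(1)]) (use assms(2) in auto)
  then have "bounded (f ` cball 0 r)"
    using compact_continuous_image compact_imp_bounded compact_cball by blast
  then obtain M where "M > 0" "\<And>x. x \<in> f ` cball 0 r \<Longrightarrow> norm x \<le> M"
    unfolding bounded_pos by blast
  then show ?thesis using that[of M] by simp
qed

text \<open>Uniform convergence supplies the common bound on \<open>cball 0 r\<close>: the limit is
  continuous and so bounded there, all but finitely many maps are within 1 of it, and the others are
  bounded one by one.\<close>

lemma Hol_loc_unif_limit:
  fixes f :: "nat \<Rightarrow> complex^'n \<Rightarrow> complex^'n"
  assumes f: "\<And>n. f n \<in> Hol" and g: "g \<in> extensional unit_ball" and lim: "loc_unif_limit f g"
  shows "g \<in> Hol"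
proof (rule Hol_limit[OF f g _ loc_unif_limit_pointwise[OF lim]])
  fix r :: real assume r: "r < 1"
  have u: "uniform_limit (cball 0 r) f g sequentially" using lim r by (simp add: loc_unif_limit_def)
  have "continuous_on (cball 0 r) (f n)" for n
    by (rule Hol_continuous_on[OF f]) (use r in auto)
  then have "continuous_on (cball 0 r) g"
    by (intro uniform_limit_theorem[OF _ u]) auto
  then have "bounded (g ` cball 0 r)"
    using compact_continuous_image compact_imp_bounded compact_cball by blast
  then obtain M where "\<forall>x\<in>g ` cball 0 r. norm x \<le> M"
    unfolding bounded_iff by blast
  then have M: "norm (g x) \<le> M" if "norm x \<le> r" for x using that by simp
  have "\<forall>\<^sub>F n in sequentially. \<forall>x\<in>cball 0 r. dist (f n x) (g x) < 1"
    using uniform_limitD[OF u, of 1] by simp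
  then obtain N where "\<forall>n\<ge>N. \<forall>x\<in>cball 0 r. dist (f n x) (g x) < 1"
    unfolding eventually_sequentially by blast
  then have N: "dist (f n x) (g x) < 1" if "n \<ge> N" "norm x \<le> r" for n x using that by simp
  have "\<exists>B\<ge>0. \<forall>x. norm x \<le> r \<longrightarrow> norm (f n x) \<le> B" for n
    using Hol_bounded_on[OF f r] by blast
  then obtain B where B: "\<And>n. B n \<ge> 0" "\<And>n x. norm x \<le> r \<Longrightarrow> norm (f n x) \<le> B n" by metis
  show "\<exists>B. \<forall>n x. norm x \<le> r \<longrightarrow> norm (f n x) \<le> B"
  proof (intro exI[of _ "(\<Sum>n<N. B n) + \<bar>M\<bar> + 1"] allI impI)
    fix n x assume x: "norm (x :: complex^'n) \<le> r"
    have S: "(\<Sum>n<N. B n) \<ge> 0" by (intro sum_nonneg B)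
    show "norm (f n x) \<le> (\<Sum>n<N. B n) + \<bar>M\<bar> + 1"
    proof (cases "n < N")
      case True
      have "norm (f n x) \<le> B n" by (rule B(2)[OF x])
      also have "\<dots> \<le> (\<Sum>n<N. B n)" by (rule member_le_sum) (use True B in auto)
      finally show ?thesis by simp
    next
      case False
      then have "norm (f n x - g x) < 1" using N[of n x] x by (simp add: dist_norm)
      moreover have "norm (f n x) \<le> norm (f n x - g x) + norm (g x)"
        using norm_triangle_ineq[of "f n x - g x" "g x"] by simp
      ultimately show ?thesis using M[OF x] S by linarith
    qed
  qed
qed

text \<open>Eventual membership passes through finite intersections and unions, so the generating
  sets suffice. For these, the compact image of \<open>K\<close> under \<open>g\<close> keeps a
  positive distance \<open>e\<close> from the complement of \<open>W\<close>, and \<open>K\<close>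
  lies in a closed ball of radius less than 1.\<close>

lemma loc_unif_limit_imp_limitin:
  fixes f :: "nat \<Rightarrow> complex^'n \<Rightarrow> complex^'n"
  assumes f: "\<And>n. f n \<in> Hol" and g: "g \<in> Hol" and lim: "loc_unif_limit f g"
  shows "limitin compact_open_topology f g sequentially"
  unfolding limitin_def
proof (intro conjI allI impI)
  show "g \<in> topspace compact_open_topology" using g by simp
  fix U assume U: "openin compact_open_topology U \<and> g \<in> U"
  let ?B = "{{f \<in> Hol. f ` K \<subseteq> W} |K W. compact K \<and> K \<subseteq> (unit_ball :: (complex^'n) set) \<and> open W}"
  have "generate_topology_on ?B U"
    using U unfolding compact_open_topology_def openin_topology_generated_by_iff by blast
  then have "g \<in> U \<longrightarrow> (\<forall>\<^sub>F n in sequentially. f n \<in> U)"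
  proof (induction rule: generate_topology_on.induct)
    case (Int a b)
    then show ?case by (auto intro: eventually_conj)
  next
    case (UN K)
    show ?case
    proof
      assume "g \<in> \<Union>K"
      then obtain k where k: "k \<in> K" "g \<in> k" by blast
      with UN have "\<forall>\<^sub>F n in sequentially. f n \<in> k" by blast
      then show "\<forall>\<^sub>F n in sequentially. f n \<in> \<Union>K"
        by eventually_elim (use k in blast)
    qed
  next
    case (Basis s)
    then obtain K W where s: "s = {f \<in> Hol. f ` K \<subseteq> W}" "compact K" "K \<subseteq> unit_ball" "open W" by blast
    show ?case
    proof
      assume "g \<in> s"
      then have gK: "g ` K \<subseteq> W" using s by blast
      have "continuous_on K g" by (rule Hol_continuous_on[OF g s(3)])
      then have "compact (g ` K)" using s(2) by (rule compact_continuous_image)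
      then obtain e where e: "e > 0" "(\<Union>x\<in>g ` K. ball x e) \<subseteq> W"
        using compact_subset_open_imp_ball_epsilon_subset[OF _ s(4) gK] by metis
      obtain r where r: "r < 1" "\<And>z. z \<in> K \<Longrightarrow> norm z \<le> r"
        using compact_subset_unit_ball[OF s(2,3)] by metis
      have "uniform_limit (cball 0 r) f g sequentially" using lim r by (simp add: loc_unif_limit_def)
      from uniform_limitD[OF this e(1)]
      show "\<forall>\<^sub>F n in sequentially. f n \<in> s"
      proof eventually_elim
        case (elim n)
        have "f n ` K \<subseteq> W"
        proof
          fix y assume "y \<in> f n ` K"
          then obtain x where x: "x \<in> K" "y = f n x" by blast
          then have "dist (g x) y < e" using elim r(2)[of x] by (simp add: dist_commute)
          then have "y \<in> (\<Union>x\<in>g ` K. ball x e)" using x by auto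
          then show "y \<in> W" using e(2) by blast
        qed
        then show ?case using s f by simp
      qed
    qed
  qed simp
  then show "\<forall>\<^sub>F n in sequentially. f n \<in> U" using U by blast
qed

section \<open>Derivatives along moving base points and directions\<close>

lemma derivative_along_segment:
  fixes f k :: "complex^'n \<Rightarrow> complex^'n"
  defines "seg \<equiv> \<lambda>\<tau>. \<lambda>z\<in>unit_ball. f z + \<tau> *\<^sub>R k z"
  assumes "differentiable_along \<Phi> (seg \<tau>) k"
  shows "((\<lambda>\<tau>. \<Phi> (seg \<tau>)) has_vector_derivative directional_derivative \<Phi> (seg \<tau>) k) (at \<tau>)"
proof -
  obtain l where l: "(diff_quotient \<Phi> (seg \<tau>) k \<longlongrightarrow> l) (at 0)"
    using assms by (auto simp: differentiable_along_def)
  then have eq: "directional_derivative \<Phi> (seg \<tau>) k = l"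
    unfolding directional_derivative_def by (intro tendsto_Lim) simp_all
  \<comment> \<open>Restricting the complex increment to real values yields an ordinary derivative
    in the segment parameter, since a step \<open>h\<close> along \<open>k\<close> from
    \<open>seg \<tau>\<close> leads to \<open>seg (\<tau> + h)\<close>.\<close>
  have "filterlim (\<lambda>h::real. complex_of_real h) (at 0) (at 0)"
    unfolding filterlim_at by (auto intro!: tendsto_eq_intros simp: eventually_at_filter)
  with l have "((\<lambda>h. diff_quotient \<Phi> (seg \<tau>) k (of_real h)) \<longlongrightarrow> l) (at (0::real))"
    by (rule filterlim_compose)
  then have "((\<lambda>h. norm (diff_quotient \<Phi> (seg \<tau>) k (of_real h) - l)) \<longlongrightarrow> 0) (at (0::real))"
    by (intro tendsto_norm_zero LIM_zero)
  then have "((\<lambda>h. norm (\<Phi> (seg (\<tau> + h)) - \<Phi> (seg \<tau>) - h *\<^sub>R l) / norm h) \<longlongrightarrow> 0) (at (0::real))"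
  proof (rule Lim_transform_eventually)
    have "\<forall>\<^sub>F h in at (0::real). h \<noteq> 0" by (simp add: eventually_at_filter)
    then show "\<forall>\<^sub>F h in at (0::real). norm (diff_quotient \<Phi> (seg \<tau>) k (of_real h) - l) =
        norm (\<Phi> (seg (\<tau> + h)) - \<Phi> (seg \<tau>) - h *\<^sub>R l) / norm h"
    proof eventually_elim
      case (elim h)
      have "(\<lambda>z\<in>unit_ball. seg \<tau> z + complex_of_real h *s k z) = seg (\<tau> + h)"
        unfolding seg_def scaleC_of_real by (intro restrict_ext) (simp add: scaleR_add_left)
      then have "diff_quotient \<Phi> (seg \<tau>) k (of_real h) - l = (\<Phi> (seg (\<tau> + h)) - \<Phi> (seg \<tau>) - h *\<^sub>R l) / of_real h"
        using elim by (simp add: diff_quotient_def diff_divide_distrib scaleR_conv_of_real)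
      then show ?case by (simp add: norm_divide)
    qed
  qed
  then show ?thesis
    unfolding eq has_vector_derivative_def has_derivative_at by (simp add: bounded_linear_scaleR_left)
qed

text \<open>By the mean value inequality on the segment from \<open>f n\<close> to \<open>f n + s n k n\<close>, joint continuity of
  the directional derivative upgrades it to a derivative along moving base points and directions.\<close>

lemma derivative_along_sequence:
  fixes f k :: "nat \<Rightarrow> complex^'n \<Rightarrow> complex^'n"
  assumes D: "has_complex_derivative U \<Phi> F L"
    and f: "\<And>n. f n \<in> Hol" "F \<in> Hol" "loc_unif_limit f F"
    and k: "\<And>n. k n \<in> Hol" "h \<in> Hol" "loc_unif_limit k h"
    and s: "\<And>n. s n > 0" "s \<longlonglongrightarrow> 0"
  shows "(\<lambda>n. (\<Phi> (\<lambda>z\<in>unit_ball. f n z + s n *\<^sub>R k n z) - \<Phi> (f n)) / of_real (s n)) \<longlonglongrightarrow> L h"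
proof -
  obtain V where V: "openin compact_open_topology V" "F \<in> V"
    "\<And>f h. f \<in> V \<Longrightarrow> h \<in> Hol \<Longrightarrow> differentiable_along \<Phi> f h"
    "continuous_map (prod_topology (subtopology compact_open_topology V) compact_open_topology) euclidean
        (\<lambda>(f, h). directional_derivative \<Phi> f h)"
    and L: "\<And>h. h \<in> Hol \<Longrightarrow> L h = directional_derivative \<Phi> F h"
    using D unfolding has_complex_derivative_def by blast
  define seg where "seg n \<tau> = (\<lambda>z\<in>unit_ball. f n z + \<tau> *\<^sub>R k n z)" for n \<tau>
  have segH: "seg n \<tau> \<in> Hol" for n \<tau>
    unfolding seg_def by (rule Hol_affine[OF f(1) k(1)])
  have lim: "limitin compact_open_topology (\<lambda>n. seg n (\<theta> n)) F sequentially"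
    if \<theta>: "\<And>n. \<theta> n \<in> {0..s n}" for \<theta>
  proof (rule loc_unif_limit_imp_limitin[OF segH f(2)], unfold loc_unif_limit_def, intro allI impI)
    fix r :: real assume r: "r < 1"
    obtain M where M: "M \<ge> 0" "\<And>z. norm z \<le> r \<Longrightarrow> norm (h z) \<le> M" using Hol_bounded_on[OF k(2) r] by metis
    have uf: "uniform_limit (cball 0 r) f F sequentially" "uniform_limit (cball 0 r) k h sequentially"
      using f(3) k(3) r by (simp_all add: loc_unif_limit_def)
    show "uniform_limit (cball 0 r) (\<lambda>n. seg n (\<theta> n)) F sequentially"
    proof (rule uniform_limit_by_bound)
      have "\<forall>\<^sub>F n in sequentially. \<forall>z\<in>cball 0 r. dist (k n z) (h z) < 1" using uniform_limitD[OF uf(2), of 1] by simp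
      then show "\<forall>\<^sub>F n in sequentially. \<forall>z\<in>cball 0 r. norm (seg n (\<theta> n) z - F z) \<le> norm (f n z - F z) + s n * (M + 1)"
      proof eventually_elim
        case (elim n)
        show ?case
        proof
          fix z :: "complex^'n" assume z: "z \<in> cball 0 r"
          have "norm (k n z - h z) < 1" using elim z by (simp add: dist_norm)
          then have "norm (k n z) \<le> M + 1"
            using norm_triangle_ineq[of "k n z - h z" "h z"] M(2)[of z] z by simp
          then have "\<theta> n * norm (k n z) \<le> s n * (M + 1)"
            using \<theta>[of n] by (intro mult_mono) auto
          then have "norm (\<theta> n *\<^sub>R k n z) \<le> s n * (M + 1)" using \<theta>[of n] by simp
          moreover have "seg n (\<theta> n) z - F z = (f n z - F z) + \<theta> n *\<^sub>R k n z"
            using z r by (simp add: seg_def)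
          ultimately show "norm (seg n (\<theta> n) z - F z) \<le> norm (f n z - F z) + s n * (M + 1)"
            by (metis add_left_mono norm_triangle_ineq order_trans)
        qed
      qed
      have "uniform_limit (cball 0 r) (\<lambda>n z. norm (f n z - F z) + s n * (M + 1)) (\<lambda>z. 0 + 0) sequentially"
        by (intro uniform_limit_add uniform_limit_norm_diff uf uniform_limit_of_tendsto tendsto_mult_left_zero s)
      then show "uniform_limit (cball 0 r) (\<lambda>n z. norm (f n z - F z) + s n * (M + 1)) (\<lambda>_. 0) sequentially" by simp
    qed
  qed
  have klim: "limitin compact_open_topology k h sequentially"
    by (rule loc_unif_limit_imp_limitin[OF k])
  have conv: "(\<lambda>n. directional_derivative \<Phi> (seg n (\<theta> n)) (k n)) \<longlonglongrightarrow> L h"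
    "\<forall>\<^sub>F n in sequentially. seg n (\<theta> n) \<in> V"
    if \<theta>: "\<And>n. \<theta> n \<in> {0..s n}" for \<theta>
  proof -
    show ev: "\<forall>\<^sub>F n in sequentially. seg n (\<theta> n) \<in> V"
      using lim[OF \<theta>] V(1,2) unfolding limitin_def by blast
    have "limitin (prod_topology (subtopology compact_open_topology V) compact_open_topology)
       (\<lambda>n. (seg n (\<theta> n), k n)) (F, h) sequentially"
      unfolding limitin_pairwise limitin_subtopology using lim[OF \<theta>] ev V(2) klim by (simp add: o_def)
    from continuous_map_limit[OF V(4) this]
    show "(\<lambda>n. directional_derivative \<Phi> (seg n (\<theta> n)) (k n)) \<longlonglongrightarrow> L h"
      by (simp add: o_def L[OF k(2)])
  qed
  \<comment> \<open>\<open>bad n\<close> is a parameter at which the segment leaves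
    \<open>V\<close>, if there is one. Any choice of parameters gives maps that are eventually in
    \<open>V\<close>; applied to this worst choice, that puts whole segments into \<open>V\<close>
    eventually.\<close>
  define bad where "bad n = (if \<exists>\<tau>\<in>{0..s n}. seg n \<tau> \<notin> V then SOME \<tau>. \<tau> \<in> {0..s n} \<and> seg n \<tau> \<notin> V else 0)" for n
  have bad: "bad n \<in> {0..s n} \<and> ((\<exists>\<tau>\<in>{0..s n}. seg n \<tau> \<notin> V) \<longrightarrow> seg n (bad n) \<notin> V)" for n
  proof (cases "\<exists>\<tau>\<in>{0..s n}. seg n \<tau> \<notin> V")
    case True
    then have "\<exists>\<tau>. \<tau> \<in> {0..s n} \<and> seg n \<tau> \<notin> V" by blast
    from someI_ex[OF this] show ?thesis using True by (simp add: bad_def)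
  next
    case False
    then show ?thesis using s(1)[of n] by (simp add: bad_def)
  qed
  have "\<forall>\<^sub>F n in sequentially. seg n (bad n) \<in> V" using conv(2)[of bad] bad by blast
  then have inV: "\<forall>\<^sub>F n in sequentially. \<forall>\<tau>\<in>{0..s n}. seg n \<tau> \<in> V"
    by eventually_elim (use bad in blast)
  let ?q = "\<lambda>n. (\<Phi> (seg n (s n)) - \<Phi> (seg n 0)) / of_real (s n)"
  have mvt: "\<exists>\<theta>\<in>{0..s n}. norm (?q n - L h) \<le> norm (directional_derivative \<Phi> (seg n \<theta>) (k n) - L h)"
    if n: "\<forall>\<tau>\<in>{0..s n}. seg n \<tau> \<in> V" for n
  proof -
    \<comment> \<open>After subtraction of the linear term, the mean value inequality bounds the
      distance of the quotient from \<open>L h\<close> by that of a single directional derivative at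
      an intermediate parameter.\<close>
    let ?g = "\<lambda>\<tau>. \<Phi> (seg n \<tau>) - \<tau> *\<^sub>R L h" and ?D = "\<lambda>\<tau>. directional_derivative \<Phi> (seg n \<tau>) (k n) - L h"
    have d: "(?g has_vector_derivative ?D \<tau>) (at \<tau>)" if "\<tau> \<in> {0..s n}" for \<tau>
    proof (rule has_vector_derivative_diff)
      have "differentiable_along \<Phi> (seg n \<tau>) (k n)" using V(3) n that k(1) by blast
      then show "((\<lambda>\<tau>. \<Phi> (seg n \<tau>)) has_vector_derivative directional_derivative \<Phi> (seg n \<tau>) (k n)) (at \<tau>)"
        unfolding seg_def by (rule derivative_along_segment)
      show "((\<lambda>\<tau>. \<tau> *\<^sub>R L h) has_vector_derivative L h) (at \<tau>)"
        by (auto intro!: derivative_eq_intros)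
    qed
    have "\<exists>x\<in>{0<..<s n}. norm (?g (s n) - ?g 0) \<le> norm ((s n - 0) *\<^sub>R ?D x)"
    proof (rule mvt_general[where f'="\<lambda>x t. t *\<^sub>R ?D x"])
      show "continuous_on {0..s n} ?g"
        using d has_vector_derivative_continuous by (intro continuous_at_imp_continuous_on) blast
    qed (use s(1) d in \<open>auto simp: has_vector_derivative_def\<close>)
    then obtain x where x: "x \<in> {0<..<s n}" "norm (?g (s n) - ?g 0) \<le> norm ((s n - 0) *\<^sub>R ?D x)" by blast
    have "?g (s n) - ?g 0 = of_real (s n) * (?q n - L h)"
      using s(1)[of n] by (simp add: field_simps scaleR_conv_of_real)
    then have "s n * norm (?q n - L h) \<le> s n * norm (?D x)"
      using x(2) s(1)[of n] by (simp add: norm_mult)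
    then have "norm (?q n - L h) \<le> norm (?D x)" using s(1)[of n] by simp
    then show ?thesis using x(1) by (intro bexI[of _ x]) auto
  qed
  \<comment> \<open>For the finitely many \<open>n\<close> whose segment leaves \<open>V\<close>,
    the parameter 0 serves as default, which keeps the whole sequence in the range where convergence
    is known.\<close>
  have "\<exists>\<theta>. \<theta> \<in> {0..s n} \<and> ((\<forall>\<tau>\<in>{0..s n}. seg n \<tau> \<in> V) \<longrightarrow>
      norm (?q n - L h) \<le> norm (directional_derivative \<Phi> (seg n \<theta>) (k n) - L h))" for n
  proof (cases "\<forall>\<tau>\<in>{0..s n}. seg n \<tau> \<in> V")
    case True
    then show ?thesis using mvt[OF True] by blast
  next
    case False
    then show ?thesis using s(1)[of n] by (intro exI[of _ 0]) auto
  qed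
  then obtain \<theta> where \<theta>: "\<And>n. \<theta> n \<in> {0..s n}" "\<And>n. (\<forall>\<tau>\<in>{0..s n}. seg n \<tau> \<in> V) \<Longrightarrow>
      norm (?q n - L h) \<le> norm (directional_derivative \<Phi> (seg n (\<theta> n)) (k n) - L h)" by metis
  have "?q \<longlonglongrightarrow> L h"
  proof (rule LIM_zero_cancel, rule Lim_null_comparison)
    show "\<forall>\<^sub>F n in sequentially. norm (?q n - L h) \<le> norm (directional_derivative \<Phi> (seg n (\<theta> n)) (k n) - L h)"
      using inV by eventually_elim (rule \<theta>(2))
    show "(\<lambda>n. norm (directional_derivative \<Phi> (seg n (\<theta> n)) (k n) - L h)) \<longlonglongrightarrow> 0"
      by (intro tendsto_norm_zero LIM_zero conv(1) \<theta>(1))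
  qed
  moreover have "seg n 0 = f n" for n
  proof -
    have "seg n 0 = restrict (f n) unit_ball" unfolding seg_def by (intro restrict_ext) simp
    then show ?thesis using extensional_restrict[OF Hol_extensional[OF f(1)]] by simp
  qed
  ultimately show ?thesis by (simp add: seg_def)
qed

lemma uniform_limit_cmult_zero:
  assumes "uniform_limit S b (\<lambda>_. 0 :: real) F" shows "uniform_limit S (\<lambda>n z. c * b n z) (\<lambda>_. 0) F"
  using bounded_linear.uniform_limit[OF bounded_linear_mult_right assms, of c] by simp

lemma uniform_limit_add_zero:
  assumes "uniform_limit S a (\<lambda>_. 0 :: real) F" "uniform_limit S b (\<lambda>_. 0) F"
  shows "uniform_limit S (\<lambda>n z. a n z + b n z) (\<lambda>_. 0) F"
  using uniform_limit_add[OF assms] by simp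

lemma loc_unif_limit_const: "loc_unif_limit (\<lambda>n. f) f"
  by (simp add: loc_unif_limit_def uniform_limit_const)

text \<open>The step from \<open>F\<close> to F + s (a + b) is split at F + s a. The second part has
  the direction \<open>b\<close> and base points that tend to \<open>F\<close>, so the derivative
  along moving base points evaluates it.\<close>

lemma complex_derivative_additive:
  fixes F :: "complex^'n \<Rightarrow> complex^'n"
  assumes D: "has_complex_derivative U \<Phi> F L" and F: "F \<in> Hol" and a: "a \<in> Hol" and b: "b \<in> Hol"
  shows "L (\<lambda>z\<in>unit_ball. a z + b z) = L a + L b"
proof -
  define s where "s n = inverse (real (Suc n))" for n
  have s: "s n > 0" "s \<longlonglongrightarrow> 0" for n
    unfolding s_def using LIMSEQ_inverse_real_of_nat by auto
  define f where "f n = (\<lambda>z\<in>unit_ball. F z + s n *\<^sub>R a z)" for n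
  define ab where "ab = (\<lambda>z\<in>unit_ball. a z + b z)"
  have f: "f n \<in> Hol" for n unfolding f_def by (rule Hol_affine[OF F a])
  have ab: "ab \<in> Hol" unfolding ab_def using Hol_affine[OF a b, of 1] by simp
  have lim: "loc_unif_limit f F"
    unfolding loc_unif_limit_def
  proof (intro allI impI)
    fix r :: real assume r: "r < 1"
    obtain M where M: "\<And>z. norm z \<le> r \<Longrightarrow> norm (a z) \<le> M" using Hol_bounded_on[OF a r] by metis
    show "uniform_limit (cball 0 r) f F sequentially"
    proof (rule uniform_limit_by_bound)
      show "\<forall>\<^sub>F n in sequentially. \<forall>z\<in>cball 0 r. norm (f n z - F z) \<le> s n * M"
      proof (intro always_eventually allI ballI)
        fix n and z :: "complex^'n" assume z: "z \<in> cball 0 r"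
        have "norm (f n z - F z) = s n * norm (a z)" using z r s(1)[of n] by (simp add: f_def)
        also have "\<dots> \<le> s n * M" using M[of z] z s(1)[of n] by simp
        finally show "norm (f n z - F z) \<le> s n * M" .
      qed
      show "uniform_limit (cball 0 r) (\<lambda>n z. s n * M) (\<lambda>_. 0) sequentially"
        by (intro uniform_limit_of_tendsto tendsto_mult_left_zero s)
    qed
  qed
  note seq = derivative_along_sequence[OF D _ F _ _ _ _ s]
  have q1: "(\<lambda>n. (\<Phi> (f n) - \<Phi> F) / of_real (s n)) \<longlonglongrightarrow> L a"
    unfolding f_def by (rule seq[of "\<lambda>_. F" "\<lambda>_. a"]) (use F a loc_unif_limit_const in auto)
  have q2: "(\<lambda>n. (\<Phi> (\<lambda>z\<in>unit_ball. f n z + s n *\<^sub>R b z) - \<Phi> (f n)) / of_real (s n)) \<longlonglongrightarrow> L b"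
    by (rule seq[of f "\<lambda>_. b"]) (use f b lim loc_unif_limit_const in auto)
  have q3: "(\<lambda>n. (\<Phi> (\<lambda>z\<in>unit_ball. F z + s n *\<^sub>R ab z) - \<Phi> F) / of_real (s n)) \<longlonglongrightarrow> L ab"
    by (rule seq[of "\<lambda>_. F" "\<lambda>_. ab"]) (use F ab loc_unif_limit_const in auto)
  have eq: "(\<lambda>z\<in>unit_ball. f n z + s n *\<^sub>R b z) = (\<lambda>z\<in>unit_ball. F z + s n *\<^sub>R ab z)" for n
    by (intro restrict_ext) (simp add: f_def ab_def scaleR_add_right)
  have "(\<lambda>n. (\<Phi> (\<lambda>z\<in>unit_ball. F z + s n *\<^sub>R ab z) - \<Phi> F) / of_real (s n)) \<longlonglongrightarrow> L a + L b"
    using tendsto_add[OF q1 q2] unfolding eq by (simp flip: add_divide_distrib)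
  from LIMSEQ_unique[OF q3 this] show ?thesis by (simp only: ab_def)
qed

section \<open>Difference quotients along flows, and normal families\<close>

lemma directional_quotient_loc_unif:
  fixes F :: "complex^'n \<Rightarrow> complex^'n"
  assumes F: "F \<in> Hol" and B: "loc_unif_limit B h"
    and bd: "\<And>r. r < 1 \<Longrightarrow> \<exists>C. \<forall>n z. norm z \<le> r \<longrightarrow> norm (B n z) \<le> C"
    and t: "\<And>n. t n > 0" "t \<longlonglongrightarrow> 0"
  shows "loc_unif_limit (\<lambda>n z. (1 / t n) *\<^sub>R (F (z + t n *\<^sub>R B n z) - F z)) (derivative_applied F h)"
  unfolding loc_unif_limit_def
proof (intro allI impI)
  fix r :: real assume r: "r < 1"
  define \<rho> where "\<rho> = (1 - r) / 2"
  have \<rho>: "\<rho> > 0" "r + \<rho> < 1" using r by (auto simp: \<rho>_def field_simps)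
  obtain M where M: "M \<ge> 0" "\<And>z. norm z \<le> r + \<rho> \<Longrightarrow> norm (F z) \<le> M" using Hol_bounded_on[OF F \<rho>(2)] by metis
  obtain C0 where C0: "\<And>n z. norm z \<le> r \<Longrightarrow> norm (B n z) \<le> C0" using bd[OF r] by blast
  define C where "C = \<bar>C0\<bar> + 1"
  have C: "C > 0" "norm (B n z) \<le> C" if "norm z \<le> r" for n z
    using C0[OF that, of n] by (auto simp: C_def)
  have C_pos: "C > 0" by (simp add: C_def)
  \<comment> \<open>The first term is the Taylor error divided by \<open>t n\<close>; the second is
    the Cauchy bound for the derivative of \<open>F\<close> applied to the replacement of
    \<open>B n z\<close> by \<open>h z\<close>.\<close>
  let ?b = "\<lambda>n z. 18 * M / \<rho>\<^sup>2 * C\<^sup>2 * t n + 2 * M / \<rho> * norm (B n z - h z)"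
  show "uniform_limit (cball 0 r) (\<lambda>n z. (1 / t n) *\<^sub>R (F (z + t n *\<^sub>R B n z) - F z)) (derivative_applied F h) sequentially"
  proof (rule uniform_limit_by_bound[where b="?b"])
    have "uniform_limit (cball 0 r) B h sequentially" using B r by (simp add: loc_unif_limit_def)
    then show "uniform_limit (cball 0 r) ?b (\<lambda>_. 0) sequentially"
      by (intro uniform_limit_add_zero uniform_limit_cmult_zero uniform_limit_norm_diff
          uniform_limit_of_tendsto t)
    have "\<forall>\<^sub>F n in sequentially. t n < \<rho> / (2 * C)"
      using order_tendstoD(2)[OF t(2)] \<rho> C_pos by simp
    then show "\<forall>\<^sub>F n in sequentially. \<forall>z\<in>cball 0 r.
        norm ((1 / t n) *\<^sub>R (F (z + t n *\<^sub>R B n z) - F z) - derivative_applied F h z) \<le> ?b n z"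
    proof eventually_elim
      case (elim n)
      show ?case
      proof
        fix z :: "complex^'n" assume "z \<in> cball 0 r"
        then have z: "norm z \<le> r" by simp
        then have zb: "z \<in> unit_ball" using r by simp
        have mem: "norm x \<le> r + \<rho>" if "x \<in> ball z \<rho>" for x
          using that z norm_triangle_ineq[of z "x - z"] by (simp add: dist_norm norm_minus_commute)
        have sub: "ball z \<rho> \<subseteq> unit_ball"
        proof
          fix x assume "x \<in> ball z \<rho>"
          from mem[OF this] show "x \<in> unit_ball" using \<rho> by simp
        qed
        define D where "D = frechet_derivative F (at z)"
        have lin: "linear D" unfolding D_def by (rule has_derivative_linear[OF Hol_has_derivative[OF F zb]])
        have nB: "norm (t n *\<^sub>R B n z) \<le> t n * C" using C(2)[OF z, of n] t(1)[of n] by simp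
        have "t n * C \<le> \<rho> / 2" using elim C_pos by (simp add: field_simps)
        then have "norm (F (z + t n *\<^sub>R B n z) - F z - D (t n *\<^sub>R B n z)) \<le> 18 * M / \<rho>\<^sup>2 * (norm (t n *\<^sub>R B n z))\<^sup>2"
          unfolding D_def by (intro Hol_Taylor[OF F sub \<rho>(1) M(2)[OF mem]]) (use nB in auto)
        also have "\<dots> \<le> 18 * M / \<rho>\<^sup>2 * (t n * C)\<^sup>2"
          using nB M \<rho> by (intro mult_left_mono power_mono) auto
        finally have T: "norm (F (z + t n *\<^sub>R B n z) - F z - t n *\<^sub>R D (B n z)) \<le> t n * (18 * M / \<rho>\<^sup>2 * C\<^sup>2 * t n)"
          by (simp add: linear_scale[OF lin] power2_eq_square mult_ac)
        have e: "t n *\<^sub>R ((1 / t n) *\<^sub>R (F (z + t n *\<^sub>R B n z) - F z) - D (B n z)) = F (z + t n *\<^sub>R B n z) - F z - t n *\<^sub>R D (B n z)"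
          using t(1)[of n] by (simp add: scaleR_diff_right)
        have "t n * norm ((1 / t n) *\<^sub>R (F (z + t n *\<^sub>R B n z) - F z) - D (B n z)) =
            norm (t n *\<^sub>R ((1 / t n) *\<^sub>R (F (z + t n *\<^sub>R B n z) - F z) - D (B n z)))"
          using t(1)[of n] by simp
        with T have "t n * norm ((1 / t n) *\<^sub>R (F (z + t n *\<^sub>R B n z) - F z) - D (B n z)) \<le> t n * (18 * M / \<rho>\<^sup>2 * C\<^sup>2 * t n)"
          unfolding e by linarith
        then have 1: "norm ((1 / t n) *\<^sub>R (F (z + t n *\<^sub>R B n z) - F z) - D (B n z)) \<le> 18 * M / \<rho>\<^sup>2 * C\<^sup>2 * t n"
          using t(1)[of n] by (simp only: mult_le_cancel_left_pos)
        have 2: "norm (D (B n z) - D (h z)) \<le> 2 * M / \<rho> * norm (B n z - h z)"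
          unfolding linear_diff[OF lin, symmetric] unfolding D_def
          by (rule Hol_derivative_bound[OF F sub \<rho>(1) M(2)[OF mem]])
        have dD: "derivative_applied F h z = D (h z)" using zb by (simp add: derivative_applied_def D_def)
        have "norm ((1 / t n) *\<^sub>R (F (z + t n *\<^sub>R B n z) - F z) - D (h z)) \<le>
           norm ((1 / t n) *\<^sub>R (F (z + t n *\<^sub>R B n z) - F z) - D (B n z)) + norm (D (B n z) - D (h z))"
          using norm_triangle_ineq[of "(1 / t n) *\<^sub>R (F (z + t n *\<^sub>R B n z) - F z) - D (B n z)" "D (B n z) - D (h z)"] by simp
        then show "norm ((1 / t n) *\<^sub>R (F (z + t n *\<^sub>R B n z) - F z) - derivative_applied F h z) \<le> ?b n z"
          unfolding dD using 1 2 by linarith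
      qed
    qed
  qed
qed

text \<open>By Cauchy's estimate a locally bounded sequence is equi-Lipschitz on each closed ball,
  so Arzela-Ascoli yields a subsequence there, and a diagonal sequence serves the balls of radii
  \<open>R i\<close>, which increase to 1.\<close>

lemma Hol_Montel:
  fixes f :: "nat \<Rightarrow> complex^'n \<Rightarrow> complex^'n"
  assumes f: "\<And>n. f n \<in> Hol" and bd: "\<And>r. r < 1 \<Longrightarrow> \<exists>C. \<forall>n z. norm z \<le> r \<longrightarrow> norm (f n z) \<le> C"
  obtains k h where "strict_mono k" "h \<in> Hol" "loc_unif_limit (f \<circ> k) h"
proof -
  obtain C where C: "\<And>r n z. r < 1 \<Longrightarrow> norm z \<le> r \<Longrightarrow> norm (f n z) \<le> C r" using bd by metis
  define R where "R i = 1 - 1 / (real i + 2)" for i :: nat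
  have R: "R i < 1" for i by (simp add: R_def)
  define P where "P i \<sigma> \<longleftrightarrow> (\<exists>l. uniform_limit (cball 0 (R i)) (\<lambda>n. f (\<sigma> n)) l sequentially)"
    for i and \<sigma> :: "nat \<Rightarrow> nat"
  have sub: "\<exists>k. strict_mono (k :: nat \<Rightarrow> nat) \<and> P i (\<sigma> \<circ> k)" for i \<sigma>
  proof -
    let ?g = "\<lambda>n. f (\<sigma> n)"
    define r' where "r' = (1 + R i) / 2"
    have r': "R i < r'" "r' < 1" using R[of i] by (auto simp: r'_def field_simps)
    have b: "norm (?g n z) \<le> C r" if "r < 1" "norm z \<le> r" for n z r
      using C that by blast
    have "0 \<le> r'" by (simp add: R_def r'_def divide_le_eq)
    then have "norm (?g 0 0) \<le> C r'" by (intro b r') simp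
    from order_trans[OF norm_ge_zero this] have "C r' \<ge> 0" .
    define K where "K = 2 * C r' / (r' - R i)"
    have K: "K \<ge> 0" using \<open>C r' \<ge> 0\<close> r' by (simp add: K_def)
    have Lip: "norm (?g n x - ?g n y) \<le> K * norm (x - y)" if "norm x \<le> R i" "norm y \<le> R i" for n x y
      unfolding K_def
    proof (rule Hol_Lipschitz[OF _ r'(1) _ _ that])
      show "?g n \<in> Hol" by (rule f)
      show "norm (?g n x) \<le> C r'" if "norm x < r'" for x using b[OF r'(2), of x n] that by simp
    qed (use r' in simp)
    have equi: "\<exists>d. 0 < d \<and> (\<forall>n y. y \<in> cball 0 (R i) \<and> norm (x - y) < d \<longrightarrow> norm (?g n x - ?g n y) < e)"
      if x: "x \<in> cball 0 (R i)" and e: "0 < e" for x e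
    proof (intro exI[of _ "e / (K + 1)"] conjI allI impI)
      show "0 < e / (K + 1)" using e K by simp
      fix n y assume y: "y \<in> cball 0 (R i) \<and> norm (x - y) < e / (K + 1)"
      have "norm (?g n x - ?g n y) \<le> K * norm (x - y)" using Lip x y by simp
      also have "\<dots> \<le> K * (e / (K + 1))" using y K by (intro mult_left_mono) auto
      also have "\<dots> < e" using e K by (simp add: field_simps)
      finally show "norm (?g n x - ?g n y) < e" .
    qed
    have bound: "norm (?g n x) \<le> C (R i)" if "x \<in> cball 0 (R i)" for n x using b[OF R] that by simp
    obtain l k where k: "strict_mono (k :: nat \<Rightarrow> nat)"
      and l: "\<And>e. 0 < e \<Longrightarrow> \<exists>N. \<forall>n x. n \<ge> N \<and> x \<in> cball 0 (R i) \<longrightarrow> norm (?g (k n) x - l x) < e"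
    proof (rule Arzela_Ascoli[of "cball 0 (R i)" ?g "C (R i)"])
      show "compact (cball (0 :: complex^'n) (R i))" by (rule compact_cball)
    next
      fix n x assume "x \<in> cball (0 :: complex^'n) (R i)"
      then show "norm (?g n x) \<le> C (R i)" by (rule bound)
    next
      fix x e assume "x \<in> cball (0 :: complex^'n) (R i)" "0 < (e :: real)"
      then show "\<exists>d>0. \<forall>n y. y \<in> cball 0 (R i) \<and> norm (x - y) < d \<longrightarrow> norm (?g n x - ?g n y) < e"
        by (rule equi)
    qed (rule that)
    have "uniform_limit (cball 0 (R i)) (\<lambda>n. ?g (k n)) l sequentially"
      unfolding uniform_limit_sequentially_iff dist_norm using l by blast
    then show ?thesis using k unfolding P_def o_def by blast
  qed
  \<comment> \<open>A sequence that from some index on selects terms of \<open>k1\<close> with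
    indices at least as large inherits uniform convergence. The diagonal sequence stands in this
    relation to each of its predecessors.\<close>
  have PP: "P i (\<sigma> \<circ> k2)" if P1: "P i (\<sigma> \<circ> k1)" and k: "\<And>j. N \<le> j \<Longrightarrow> \<exists>j'. j \<le> j' \<and> k2 j = k1 j'"
    for i \<sigma> k1 k2 N
  proof -
    obtain l where l: "uniform_limit (cball 0 (R i)) (\<lambda>n. f (\<sigma> (k1 n))) l sequentially"
      using P1 unfolding P_def o_def by blast
    have "uniform_limit (cball 0 (R i)) (\<lambda>n. f (\<sigma> (k2 n))) l sequentially"
      unfolding uniform_limit_sequentially_iff
    proof (intro allI impI)
      fix e :: real assume "e > 0"
      then obtain M where M: "\<forall>n\<ge>M. \<forall>x\<in>cball 0 (R i). dist (f (\<sigma> (k1 n)) x) (l x) < e"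
        using l unfolding uniform_limit_sequentially_iff by blast
      show "\<exists>M. \<forall>n\<ge>M. \<forall>x\<in>cball 0 (R i). dist (f (\<sigma> (k2 n)) x) (l x) < e"
      proof (intro exI[of _ "max M N"] allI impI)
        fix n assume n: "n \<ge> max M N"
        then obtain n' where "n \<le> n'" "k2 n = k1 n'" using k[of n] by auto
        then show "\<forall>x\<in>cball 0 (R i). dist (f (\<sigma> (k2 n)) x) (l x) < e" using M n by simp
      qed
    qed
    then show ?thesis unfolding P_def o_def by blast
  qed
  obtain k where k: "strict_mono (k :: nat \<Rightarrow> nat)" "\<And>i. P i (id \<circ> k)"
    using subsequence_diagonalization_lemma[of P id] sub PP by blast
  have "\<exists>l. uniform_limit (cball 0 (R i)) (f \<circ> k) l sequentially" for i
    using k(2)[of i] unfolding P_def o_def id_def by blast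
  then obtain l where l: "\<And>i. uniform_limit (cball 0 (R i)) (f \<circ> k) (l i) sequentially" by metis
  have ex: "\<exists>i. r \<le> R i" if "r < 1" for r
  proof -
    obtain i where "1 / (1 - r) < real i" using reals_Archimedean2 by blast
    then have "1 \<le> (1 - r) * (real i + 2)" using that by (simp add: field_simps)
    then have "r \<le> R i" by (simp add: R_def field_simps)
    then show ?thesis by blast
  qed
  \<comment> \<open>The limits \<open>l i\<close> on the nested balls are pointwise limits of one
    sequence, hence restrictions of a single map.\<close>
  define h where "h = (\<lambda>z\<in>unit_ball. lim (\<lambda>n. (f \<circ> k) n z))"
  have h: "l i z = h z" if "norm z \<le> R i" for i z
  proof -
    have "(\<lambda>n. (f \<circ> k) n z) \<longlonglongrightarrow> l i z" using tendsto_uniform_limitI[OF l[of i], of z] that by simp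
    moreover have "norm z < 1" using that R[of i] by simp
    ultimately show ?thesis by (simp add: h_def limI)
  qed
  have lim: "loc_unif_limit (f \<circ> k) h"
    unfolding loc_unif_limit_def
  proof (intro allI impI)
    fix r :: real assume "r < 1"
    then obtain i where i: "r \<le> R i" using ex by blast
    have "uniform_limit (cball 0 (R i)) (f \<circ> k) h sequentially"
      using l[of i] h by (subst uniform_limit_cong'[of _ _ "f \<circ> k" _ "l i"]) auto
    then show "uniform_limit (cball 0 r) (f \<circ> k) h sequentially"
      by (rule uniform_limit_on_subset) (use i in auto)
  qed
  have "h \<in> Hol"
    by (rule Hol_loc_unif_limit[OF _ _ lim]) (use f in \<open>auto simp: h_def\<close>)
  with k lim show ?thesis using that by blast
qed

section \<open>Variations of maps in \<open>S\<^sub>n\<^sup>0\<close>\<close>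

lemma inverse_Suc_tendsto: "inverse (real (Suc n)) > 0" "(\<lambda>n. inverse (real (Suc n))) \<longlonglongrightarrow> 0"
  using LIMSEQ_inverse_real_of_nat by auto

text \<open>Prepending the field \<open>h\<close> on a short time interval to the field that generates \<open>F\<close>.\<close>

lemma forward_variation:
  fixes F h :: "complex^'n \<Rightarrow> complex^'n"
  assumes S0: "class_S0 \<subseteq> (Hol :: (complex^'n \<Rightarrow> complex^'n) set)" and F: "F \<in> class_S0" and h: "h \<in> class_M"
  obtains f k s where "\<And>n. s n > 0" "s \<longlonglongrightarrow> 0" "\<And>n. f n \<in> class_S0" "\<And>n. k n \<in> Hol"
    "\<And>n. f n = (\<lambda>z\<in>unit_ball. F z + s n *\<^sub>R k n z)"
    "loc_unif_limit k (\<lambda>z\<in>unit_ball. F z + derivative_applied F h z)"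
proof -
  have FH: "F \<in> Hol" using F S0 by blast
  define s where "s n = inverse (real (Suc n))" for n
  have s: "s n > 0" "s \<longlonglongrightarrow> 0" for n unfolding s_def by (rule inverse_Suc_tendsto)+
  have H: "regular_field (\<lambda>z t. h z)" by (rule regular_field_autonomous[OF h])
  obtain \<xi> where \<xi>: "evolution (\<lambda>z t. h z) \<xi>" using evolution_exists[OF H] .
  define f where "f n = (\<lambda>z\<in>unit_ball. exp (s n) *\<^sub>R F (\<xi> (s n) z))" for n
  define k where "k n = (\<lambda>z\<in>unit_ball. (1 / s n) *\<^sub>R (f n z - F z))" for n
  define B where "B n z = (1 / s n) *\<^sub>R (\<xi> (s n) z - z)" for n z
  have sB: "z + s n *\<^sub>R B n z = \<xi> (s n) z" for n z using s(1)[of n] by (simp add: B_def)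
  have f: "f n \<in> class_S0" for n
    unfolding f_def by (rule class_S0_concat[OF H \<xi> F]) (use s(1)[of n] in simp)
  have k: "k n \<in> Hol" for n unfolding k_def by (rule Hol_scale_diff) (use f S0 FH in auto)
  have fk: "f n = (\<lambda>z\<in>unit_ball. F z + s n *\<^sub>R k n z)" for n
  proof -
    have "(\<lambda>z\<in>unit_ball. F z + s n *\<^sub>R k n z) = restrict (f n) unit_ball"
      using s(1)[of n] by (intro restrict_ext) (simp add: k_def)
    also have "\<dots> = f n" by (rule extensional_restrict) (simp add: f_def)
    finally show ?thesis by simp
  qed
  have Bbd: "\<exists>C. \<forall>n z. norm z \<le> r \<longrightarrow> norm (B n z) \<le> C" if r: "r < 1" for r
  proof -
    obtain C where C: "C \<ge> 0" "\<And>z t. norm z \<le> r \<Longrightarrow> 0 \<le> t \<Longrightarrow> norm (\<xi> t z - z) \<le> C * t"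
      using evolution_small_time[OF r] H \<xi> by metis
    have "norm (B n z) \<le> C" if "norm z \<le> r" for n z
      using C(2)[OF that, of "s n"] s(1)[of n] by (simp add: B_def divide_le_eq)
    then show ?thesis by blast
  qed
  have Bh: "loc_unif_limit B h"
    unfolding loc_unif_limit_def
  proof (intro allI impI)
    fix r :: real assume r: "r < 1"
    obtain C where C: "C \<ge> 0" "\<And>z t. norm z \<le> r \<Longrightarrow> 0 \<le> t \<Longrightarrow> norm (\<xi> t z) \<le> norm z \<and> norm (\<xi> t z - z) \<le> C * t"
      using evolution_small_time[OF r] H \<xi> by metis
    obtain C' where C': "C' \<ge> 0" "\<And>x y. norm x \<le> r \<Longrightarrow> norm y \<le> r \<Longrightarrow> norm (h x - h y) \<le> C' * norm (x - y)"
      using class_M_bounds[OF r] h by metis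
    show "uniform_limit (cball 0 r) B h sequentially"
    proof (rule uniform_limit_by_bound)
      show "uniform_limit (cball 0 r) (\<lambda>n z. C' * C * s n) (\<lambda>_. 0) sequentially"
        by (intro uniform_limit_of_tendsto tendsto_mult_right_zero s)
      show "\<forall>\<^sub>F n in sequentially. \<forall>z\<in>cball 0 r. norm (B n z - h z) \<le> C' * C * s n"
      proof (intro always_eventually allI ballI)
        fix n and z :: "complex^'n" assume "z \<in> cball 0 r"
        then have z: "norm z \<le> r" by simp
        have sol: "solution (\<lambda>z t. h z) (\<lambda>t. \<xi> t z)" "\<xi> 0 z = z" using \<xi> z r by (auto simp: evolution_def)
        \<comment> \<open>The trajectory is compared with the straight motion of velocity
          \<open>h z\<close>. Up to time \<open>s n\<close> the velocities differ by at most
          \<open>C' * (C * s n)\<close>, so the displacements differ to second order and the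
          quotients to first order.\<close>
        have line: "lip_primitive (\<lambda>t. t *\<^sub>R h z) (\<lambda>t. h z)"
          unfolding lip_primitive_def
        proof (intro conjI allI)
          show "\<exists>C\<ge>0. \<forall>s\<in>{0..T}. \<forall>t\<in>{0..T}. norm (s *\<^sub>R h z - t *\<^sub>R h z) \<le> C * \<bar>s - t\<bar>" for T
            by (intro exI[of _ "norm (h z)"]) (simp add: mult.commute flip: scaleR_diff_left)
          have "((\<lambda>t. t *\<^sub>R h z) has_vector_derivative h z) (at t)" for t
            by (auto intro!: derivative_eq_intros)
          then show "negligible {t. 0 < t \<and> \<not> ((\<lambda>t. t *\<^sub>R h z) has_vector_derivative h z) (at t)}" by simp
        qed
        have "norm ((\<xi> (s n) z - s n *\<^sub>R h z) - (\<xi> 0 z - 0 *\<^sub>R h z)) \<le> C' * (C * s n) * (s n - 0)"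
        proof (rule lip_primitive_norm_le[OF lip_primitive_diff[OF _ line] order_refl])
          show "lip_primitive (\<lambda>t. \<xi> t z) (\<lambda>t. h (\<xi> t z))" using sol by (simp add: solution_def)
          show "0 \<le> s n" "0 \<le> C' * (C * s n)" using s(1)[of n] C C' by auto
          fix t assume t: "t \<in> {0..s n}"
          have "norm (h (\<xi> t z) - h z) \<le> C' * norm (\<xi> t z - z)"
            using C'(2)[OF _ z, of "\<xi> t z"] C(2)[OF z, of t] t z by simp
          also have "\<dots> \<le> C' * (C * t)" using C(2)[OF z, of t] t C' by (intro mult_left_mono) auto
          also have "\<dots> \<le> C' * (C * s n)" using t C C' by (intro mult_left_mono) auto
          finally show "norm (h (\<xi> t z) - h z) \<le> C' * (C * s n)" .
        qed
        moreover have "(\<xi> (s n) z - s n *\<^sub>R h z) - (\<xi> 0 z - 0 *\<^sub>R h z) = s n *\<^sub>R (B n z - h z)"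
          using s(1)[of n] by (simp add: B_def sol(2) scaleR_diff_right)
        ultimately have "s n * norm (B n z - h z) \<le> s n * (C' * C * s n)"
          using s(1)[of n] by (simp add: mult_ac)
        then show "norm (B n z - h z) \<le> C' * C * s n" using s(1)[of n] by (simp only: mult_le_cancel_left_pos)
      qed
    qed
  qed
  let ?q = "\<lambda>n z. (1 / s n) *\<^sub>R (F (z + s n *\<^sub>R B n z) - F z)"
  have q: "loc_unif_limit ?q (derivative_applied F h)"
    by (rule directional_quotient_loc_unif[OF FH Bh Bbd s])
  have "loc_unif_limit k (\<lambda>z\<in>unit_ball. F z + derivative_applied F h z)"
    unfolding loc_unif_limit_def
  proof (intro allI impI)
    fix r :: real assume r: "r < 1"
    obtain M where M: "M \<ge> 0" "\<And>z. norm z \<le> r \<Longrightarrow> norm (F z) \<le> M" using Hol_bounded_on[OF FH r] by metis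
    define r' where "r' = (1 + r) / 2"
    have r': "r < r'" "r' < 1" using r by (auto simp: r'_def field_simps)
    obtain M' where M': "M' \<ge> 0" "\<And>z. norm z \<le> r' \<Longrightarrow> norm (F z) \<le> M'" using Hol_bounded_on[OF FH r'(2)] by metis
    define K where "K = 2 * M' / (r' - r)"
    have K0: "K \<ge> 0" using M'(1) r' by (simp add: K_def)
    have K: "norm (F x - F y) \<le> K * norm (x - y)" if "norm x \<le> r" "norm y \<le> r" for x y
      unfolding K_def by (rule Hol_Lipschitz[OF FH r'(1) _ _ that]) (use M'(2) r' in auto)
    obtain C where C: "C \<ge> 0" "\<And>z t. norm z \<le> r \<Longrightarrow> 0 \<le> t \<Longrightarrow> norm (\<xi> t z) \<le> norm z \<and> norm (\<xi> t z - z) \<le> C * t"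
      using evolution_small_time[OF r] H \<xi> by metis
    let ?a = "\<lambda>n. (exp (s n) - 1) / s n"
    have a: "?a \<longlonglongrightarrow> 1" unfolding s_def by real_asymp
    let ?b = "\<lambda>n z. norm (?q n z - derivative_applied F h z) + (\<bar>?a n - 1\<bar> * M + K * C * s n)"
    show "uniform_limit (cball 0 r) k (\<lambda>z\<in>unit_ball. F z + derivative_applied F h z) sequentially"
    proof (rule uniform_limit_by_bound[where b="?b"])
      have "(\<lambda>n. \<bar>?a n - 1\<bar> * M + K * C * s n) \<longlonglongrightarrow> \<bar>1 - 1\<bar> * M + K * C * 0"
        by (intro tendsto_intros a s)
      then show "uniform_limit (cball 0 r) ?b (\<lambda>_. 0) sequentially"
        using q r unfolding loc_unif_limit_def
        by (intro uniform_limit_add_zero uniform_limit_norm_diff uniform_limit_of_tendsto) auto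
      show "\<forall>\<^sub>F n in sequentially. \<forall>z\<in>cball 0 r. norm (k n z - (\<lambda>z\<in>unit_ball. F z + derivative_applied F h z) z) \<le> ?b n z"
      proof (intro always_eventually allI ballI)
        fix n and z :: "complex^'n" assume "z \<in> cball 0 r"
        then have z: "norm z \<le> r" by simp
        then have zb: "z \<in> unit_ball" using r by simp
        define y where "y = \<xi> (s n) z"
        have y: "norm y \<le> r" "norm (y - z) \<le> C * s n" using C(2)[OF z, of "s n"] s(1)[of n] z by (auto simp: y_def)
        \<comment> \<open>The quotient of e^s F(y) - F(z) splits into (e^s - 1)/s times F(y), which
          tends to F(z), and the quotient of \<open>F\<close> along the flow, which tends to dF
          h.\<close>
        have "k n z = ?a n *\<^sub>R F y + ?q n z"
          using zb s(1)[of n] unfolding sB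
          by (simp add: k_def f_def y_def[symmetric] algebra_simps diff_divide_distrib)
        then have e: "k n z - (\<lambda>z\<in>unit_ball. F z + derivative_applied F h z) z =
            (?q n z - derivative_applied F h z) + ((?a n - 1) *\<^sub>R F y + (F y - F z))"
          using zb by (simp add: algebra_simps)
        have "norm ((?a n - 1) *\<^sub>R F y) \<le> \<bar>?a n - 1\<bar> * M"
          using M(2)[OF y(1)] by (simp add: mult_left_mono)
        moreover have "norm (F y - F z) \<le> K * C * s n"
        proof -
          have "norm (F y - F z) \<le> K * norm (y - z)" by (rule K[OF y(1) z])
          also have "\<dots> \<le> K * (C * s n)" using y(2) K0 by (rule mult_left_mono)
          finally show ?thesis by (simp add: mult.assoc)
        qed
        ultimately show "norm (k n z - (\<lambda>z\<in>unit_ball. F z + derivative_applied F h z) z) \<le> ?b n z"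
          unfolding e by (intro order_trans[OF norm_triangle_ineq add_mono] order_refl)
      qed
    qed
  qed
  then show ?thesis using that s f k fk by blast
qed

text \<open>Contraction gives <\<phi>(z) - z, z> \<le> |\<phi>(z)| |z| - |z|^2 \<le> 0, and this
  sign passes to the limit. So does the quadratic estimate: it becomes |h(z) + z| \<le> C |z|^2,
  which determines the derivative at 0.\<close>

lemma class_M_quotient_limit:
  fixes \<phi> :: "nat \<Rightarrow> complex^'n \<Rightarrow> complex^'n"
  assumes t: "\<And>n. t n > 0" "t \<longlonglongrightarrow> 0" and h: "h \<in> Hol"
    and lim: "\<And>z. norm z < 1 \<Longrightarrow> (\<lambda>n. (1 / t n) *\<^sub>R (\<phi> n z - z)) \<longlonglongrightarrow> h z"
    and contr: "\<And>n z. norm z < 1 \<Longrightarrow> norm (\<phi> n z) \<le> norm z"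
    and quad: "\<And>n z. norm z \<le> 1 / 2 \<Longrightarrow> norm (exp (t n) *\<^sub>R \<phi> n z - z) \<le> C * exp (t n) * (norm z)\<^sup>2 * t n"
  shows "h \<in> class_M"
  unfolding class_M_def
proof (intro CollectI conjI ballI h)
  let ?B = "\<lambda>n z. (1 / t n) *\<^sub>R (\<phi> n z - z)"
  have "\<phi> n 0 = 0" for n using contr[of 0 n] by simp
  then have "(\<lambda>n. 0) \<longlonglongrightarrow> h 0" using lim[of 0] by simp
  then show h0: "h 0 = 0" using LIMSEQ_unique tendsto_const by blast
  show "Re (cinner (h z) z) \<le> 0" if "z \<in> unit_ball" for z
    unfolding Re_cinner
  proof (rule LIMSEQ_le_const2)
    show "(\<lambda>n. inner (?B n z) z) \<longlonglongrightarrow> inner (h z) z"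
      using lim[of z] that by (intro tendsto_intros) simp
    have "inner (?B n z) z \<le> 0" for n
    proof -
      have "inner (\<phi> n z) z \<le> norm (\<phi> n z) * norm z" by (rule norm_cauchy_schwarz)
      also have "\<dots> \<le> norm z * norm z" using contr[of z n] that by (intro mult_right_mono) auto
      finally have "inner (\<phi> n z - z) z \<le> 0"
        by (simp add: inner_diff_left power2_eq_square flip: power2_norm_eq_inner)
      then show ?thesis using t(1)[of n] by (simp add: divide_nonpos_pos)
    qed
    then show "\<exists>N. \<forall>n\<ge>N. inner (?B n z) z \<le> 0" by blast
  qed
  have hq: "norm (h z + z) \<le> C * (norm z)\<^sup>2" if z: "norm z \<le> 1 / 2" for z
  proof (rule LIMSEQ_le_const2)
    \<comment> \<open>This weight tends to 1, and with it the sum of the quotient and the multiple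
      of \<open>z\<close> is exactly e^(-t)/t times e^t \<phi> - z, the quantity that
      \<open>quad\<close> bounds.\<close>
    let ?c = "\<lambda>n. (1 - exp (- t n)) / t n"
    have "((\<lambda>x::real. (1 - exp (- x)) / x) \<longlongrightarrow> 1) (at 0)" by real_asymp
    moreover have "filterlim t (at 0) sequentially"
      using t unfolding filterlim_at by (auto intro!: always_eventually simp: less_imp_neq[symmetric])
    ultimately have c: "?c \<longlonglongrightarrow> 1" by (rule filterlim_compose)
    show "(\<lambda>n. norm (?B n z + ?c n *\<^sub>R z)) \<longlonglongrightarrow> norm (h z + z)"
    proof -
      have "(\<lambda>n. norm (?B n z + ?c n *\<^sub>R z)) \<longlonglongrightarrow> norm (h z + 1 *\<^sub>R z)"
        using z by (intro tendsto_intros lim c) auto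
      then show ?thesis by simp
    qed
    have "norm (?B n z + ?c n *\<^sub>R z) \<le> C * (norm z)\<^sup>2" for n
    proof -
      have e: "?B n z + ?c n *\<^sub>R z = (exp (- t n) / t n) *\<^sub>R (exp (t n) *\<^sub>R \<phi> n z - z)"
        using t(1)[of n] by (simp add: scaleR_diff_right scaleR_diff_left diff_divide_distrib flip: exp_add)
      have "norm (?B n z + ?c n *\<^sub>R z) = exp (- t n) / t n * norm (exp (t n) *\<^sub>R \<phi> n z - z)"
        unfolding e using t(1)[of n] by simp
      also have "\<dots> \<le> exp (- t n) / t n * (C * exp (t n) * (norm z)\<^sup>2 * t n)"
        using t(1)[of n] by (intro mult_left_mono quad z) auto
      also have "\<dots> = C * (norm z)\<^sup>2" using t(1)[of n] by (simp add: exp_minus field_simps)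
      finally show ?thesis .
    qed
    then show "\<exists>N. \<forall>n\<ge>N. norm (?B n z + ?c n *\<^sub>R z) \<le> C * (norm z)\<^sup>2" by blast
  qed
  show "(h has_derivative (\<lambda>v. - v)) (at 0)"
    unfolding has_derivative_at
  proof
    show "bounded_linear (\<lambda>v::complex^'n. - v)" by (intro bounded_linear_minus bounded_linear_ident)
    show "(\<lambda>v. norm (h (0 + v) - h 0 - - v) / norm v) \<midarrow>0\<rightarrow> 0"
    proof (rule Lim_null_comparison)
      show "((\<lambda>v::complex^'n. C * norm v) \<longlongrightarrow> 0) (at 0)"
        by (rule tendsto_mult_right_zero[OF tendsto_norm_zero[OF tendsto_ident_at]])
      have "\<forall>\<^sub>F v in at 0. norm v < 1 / 2 \<and> v \<noteq> (0::complex^'n)"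
        by (auto simp: eventually_at dist_norm intro!: exI[of _ "1/2"])
      then show "\<forall>\<^sub>F v in at 0. norm (norm (h (0 + v) - h 0 - - v) / norm v) \<le> C * norm v"
        by eventually_elim (use hq h0 in \<open>simp add: field_simps power2_eq_square\<close>)
    qed
  qed
qed

text \<open>The quotients \<open>(\<phi>\<^sub>t - id) / t\<close> of the evolution generating \<open>F\<close> accumulate at some \<open>h\<close> of the
  class; restarting the evolution at time \<open>t\<close> gives the comparison maps.\<close>

lemma backward_variation:
  fixes F :: "complex^'n \<Rightarrow> complex^'n"
  assumes S0: "class_S0 \<subseteq> (Hol :: (complex^'n \<Rightarrow> complex^'n) set)" and F: "F \<in> class_S0"
  obtains h f k s where "h \<in> class_M" "\<And>n. s n > 0" "s \<longlonglongrightarrow> 0" "\<And>n. f n \<in> class_S0" "loc_unif_limit f F"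
    "\<And>n. k n \<in> Hol" "\<And>n. F = (\<lambda>z\<in>unit_ball. f n z + s n *\<^sub>R k n z)"
    "loc_unif_limit k (\<lambda>z\<in>unit_ball. F z + derivative_applied F h z)"
proof -
  have FH: "F \<in> Hol" using F S0 by blast
  obtain G \<phi> where lim: "evolution_limit G \<phi> F" using F unfolding class_S0_iff by blast
  then have G: "regular_field G" and \<phi>: "evolution G \<phi>" by (auto simp: evolution_limit_def)
  define t where "t n = inverse (real (Suc n))" for n
  have t: "t n > 0" "t \<longlonglongrightarrow> 0" for n unfolding t_def by (rule inverse_Suc_tendsto)+
  have t1: "t n \<le> 1" for n by (simp add: t_def inverse_le_1_iff)
  define B0 where "B0 n = (\<lambda>z\<in>unit_ball. (1 / t n) *\<^sub>R (\<phi> (t n) z - z))" for n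
  have B0: "B0 n \<in> Hol" for n
  proof -
    \<comment> \<open>Holomorphy is available for members of the class, such as e^t \<phi>_t and the
      identity; the quotient is assembled from these two by affine operations.\<close>
    have E: "(\<lambda>z\<in>unit_ball. exp (t n) *\<^sub>R \<phi> (t n) z) \<in> Hol"
      using evolution_in_class_S0[OF G \<phi>, of "t n"] t(1)[of n] S0 by auto
    have I: "(\<lambda>z\<in>unit_ball. z) \<in> (Hol :: (complex^'n \<Rightarrow> complex^'n) set)" using id_in_class_S0 S0 by blast
    have "(\<lambda>z\<in>unit_ball. (exp (- t n) / t n) *\<^sub>R ((\<lambda>z\<in>unit_ball. exp (t n) *\<^sub>R \<phi> (t n) z) z -
        (\<lambda>z\<in>unit_ball. (\<lambda>z\<in>unit_ball. z) z + (exp (t n) - 1) *\<^sub>R (\<lambda>z\<in>unit_ball. z) z) z)) \<in> Hol"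
      by (intro Hol_scale_diff E Hol_affine I)
    also have "(\<lambda>z\<in>unit_ball. (exp (- t n) / t n) *\<^sub>R ((\<lambda>z\<in>unit_ball. exp (t n) *\<^sub>R \<phi> (t n) z) z -
        (\<lambda>z\<in>unit_ball. (\<lambda>z\<in>unit_ball. z) z + (exp (t n) - 1) *\<^sub>R (\<lambda>z\<in>unit_ball. z) z) z)) = B0 n"
      unfolding B0_def
    proof (rule restrict_ext)
      fix z :: "complex^'n" assume z: "z \<in> unit_ball"
      have "(exp (- t n) / t n) *\<^sub>R (exp (t n) *\<^sub>R \<phi> (t n) z - exp (t n) *\<^sub>R z) = (1 / t n) *\<^sub>R (\<phi> (t n) z - z)"
        by (simp add: exp_minus flip: scaleR_diff_right)
      moreover have "z + (exp (t n) - 1) *\<^sub>R z = exp (t n) *\<^sub>R z" by (simp add: scaleR_diff_left)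
      ultimately show "(exp (- t n) / t n) *\<^sub>R ((\<lambda>z\<in>unit_ball. exp (t n) *\<^sub>R \<phi> (t n) z) z -
        (\<lambda>z\<in>unit_ball. (\<lambda>z\<in>unit_ball. z) z + (exp (t n) - 1) *\<^sub>R (\<lambda>z\<in>unit_ball. z) z) z) = (1 / t n) *\<^sub>R (\<phi> (t n) z - z)"
        using z by simp
    qed
    finally show ?thesis .
  qed
  have B0bd: "\<exists>C. \<forall>n z. norm z \<le> r \<longrightarrow> norm (B0 n z) \<le> C" if r: "r < 1" for r
  proof -
    obtain C where C: "C \<ge> 0" "\<And>z t. norm z \<le> r \<Longrightarrow> 0 \<le> t \<Longrightarrow> norm (\<phi> t z - z) \<le> C * t"
      using evolution_small_time[OF r] G \<phi> by metis
    have "norm (B0 n z) \<le> C" if "norm z \<le> r" for n z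
      using C(2)[OF that, of "t n"] t(1)[of n] that r by (simp add: B0_def divide_le_eq)
    then show ?thesis by blast
  qed
  obtain \<sigma> h where \<sigma>: "strict_mono \<sigma>" and hH: "h \<in> Hol" and Bh: "loc_unif_limit (B0 \<circ> \<sigma>) h"
    using Hol_Montel[OF B0 B0bd] by blast
  define s where "s n = t (\<sigma> n)" for n
  have s: "s n > 0" "s \<longlonglongrightarrow> 0" "s n \<le> 1" for n
    using t t1 LIMSEQ_subseq_LIMSEQ[OF t(2) \<sigma>] by (simp_all add: s_def[abs_def] o_def)
  have hM: "h \<in> class_M"
  proof -
    have contr: "norm (\<phi> t z) \<le> norm z" if "norm z < 1" "0 \<le> t" for z t
      using solution_norm_antimono[OF G, of "\<lambda>t. \<phi> t z" 0 t] \<phi> that by (simp add: evolution_def)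
    obtain C where C: "\<And>z t. norm z \<le> 1 / 2 \<Longrightarrow> 0 \<le> t \<Longrightarrow> norm (exp t *\<^sub>R \<phi> t z - z) \<le> C * exp t * (norm z)\<^sup>2 * t"
      using evolution_small_time[of "1/2"] G \<phi> by (metis half_gt_zero_iff less_numeral_extra(1) field_sum_of_halves less_add_same_cancel1)
    show ?thesis
    proof (rule class_M_quotient_limit[OF s(1,2) hH])
      show "(\<lambda>n. (1 / s n) *\<^sub>R (\<phi> (s n) z - z)) \<longlonglongrightarrow> h z" if "norm z < 1" for z
        using loc_unif_limit_pointwise[OF Bh that] that by (simp add: B0_def s_def)
      show "norm (\<phi> (s n) z) \<le> norm z" if "norm z < 1" for n z
        using contr[OF that] s(1)[of n] by simp
      show "norm (exp (s n) *\<^sub>R \<phi> (s n) z - z) \<le> C * exp (s n) * (norm z)\<^sup>2 * s n" if "norm z \<le> 1 / 2" for n z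
        using C[OF that] s(1)[of n] by simp
    qed
  qed
  have "\<exists>f. f \<in> class_S0 \<and> (\<forall>z\<in>unit_ball. F z = exp (s n) *\<^sub>R f (\<phi> (s n) z))" for n
    using class_S0_factor[OF lim, of "s n"] s(1)[of n] by (metis less_imp_le)
  then obtain f where f: "\<And>n. f n \<in> class_S0" and Ff: "\<And>n z. z \<in> unit_ball \<Longrightarrow> F z = exp (s n) *\<^sub>R f n (\<phi> (s n) z)"
    by metis
  have fH: "f n \<in> Hol" for n using f S0 by blast
  define k where "k n = (\<lambda>z\<in>unit_ball. (1 / s n) *\<^sub>R (F z - f n z))" for n
  have k: "k n \<in> Hol" for n unfolding k_def by (rule Hol_scale_diff[OF FH fH])
  have Fk: "F = (\<lambda>z\<in>unit_ball. f n z + s n *\<^sub>R k n z)" for n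
  proof -
    have "(\<lambda>z\<in>unit_ball. f n z + s n *\<^sub>R k n z) = restrict F unit_ball"
      using s(1)[of n] by (intro restrict_ext) (simp add: k_def)
    also have "\<dots> = F" by (rule extensional_restrict[OF Hol_extensional[OF FH]])
    finally show ?thesis by simp
  qed
  \<comment> \<open>From F = e^s f_n \<circ> \<phi>_s, the difference f_n - F consists of an
    increment of f_n over a distance of order s and of (e^s - 1) f_n. As f_n varies with n, both are
    controlled by the bound common to the class.\<close>
  have close: "\<exists>K\<ge>0. \<forall>n z. norm z \<le> r \<longrightarrow> norm (f n z - F z) \<le> K * s n" if r: "r < 1" for r
  proof -
    define r' where "r' = (1 + r) / 2"
    have r': "r < r'" "r' < 1" using r by (auto simp: r'_def field_simps)
    obtain M where M: "\<And>f z. f \<in> class_S0 \<Longrightarrow> norm (z :: complex^'n) \<le> r' \<Longrightarrow> norm (f z) \<le> M"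
      using class_S0_bound[OF r'(2)] by blast
    obtain C where C: "C \<ge> 0" "\<And>z t. norm z \<le> r \<Longrightarrow> 0 \<le> t \<Longrightarrow> norm (\<phi> t z) \<le> norm z \<and> norm (\<phi> t z - z) \<le> C * t"
      using evolution_small_time[OF r] G \<phi> by metis
    define K where "K = 2 * \<bar>M\<bar> / (r' - r)"
    have K: "K \<ge> 0" using r' by (simp add: K_def)
    have "norm (f n z - F z) \<le> (K * C + 2 * \<bar>M\<bar>) * s n" if z: "norm z \<le> r" for n z
    proof -
      define y where "y = \<phi> (s n) z"
      have y: "norm y \<le> r" "norm (y - z) \<le> C * s n" using C(2)[OF z, of "s n"] s(1)[of n] z by (auto simp: y_def)
      have Fy: "F z = exp (s n) *\<^sub>R f n y" using Ff[of z n] z r by (simp add: y_def)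
      have "norm (f n z - f n y) \<le> K * norm (z - y)"
        unfolding K_def
      proof (rule Hol_Lipschitz[OF fH r'(1) _ _ z y(1)])
        show "norm (f n x) \<le> \<bar>M\<bar>" if "norm x < r'" for x using M[OF f, of x n] that by simp
      qed (use r' in simp)
      also have "\<dots> \<le> K * (C * s n)" using y(2) K by (simp add: norm_minus_commute mult_left_mono)
      finally have 1: "norm (f n z - f n y) \<le> K * C * s n" by (simp add: mult.assoc)
      have "exp (s n) \<le> 1 + s n + (s n)\<^sup>2" by (rule exp_bound) (use s(1)[of n] s(3)[of n] in auto)
      also have "(s n)\<^sup>2 \<le> s n"
        using s(1)[of n] s(3)[of n] by (simp add: power2_eq_square mult_left_le)
      finally have "exp (s n) - 1 \<le> 2 * s n" by simp
      moreover have "norm (f n y) \<le> \<bar>M\<bar>" using M[OF f, of y n] y(1) r' by simp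
      ultimately have "(exp (s n) - 1) * norm (f n y) \<le> 2 * s n * \<bar>M\<bar>"
        using s(1)[of n] by (intro mult_mono) auto
      then have 2: "norm ((exp (s n) - 1) *\<^sub>R f n y) \<le> 2 * \<bar>M\<bar> * s n"
        using s(1)[of n] by (simp add: mult_ac)
      have e: "f n z - F z = (f n z - f n y) - (exp (s n) - 1) *\<^sub>R f n y"
        by (simp add: Fy scaleR_diff_left)
      show ?thesis
        unfolding e distrib_right by (rule order_trans[OF norm_triangle_ineq4 add_mono[OF 1 2]])
    qed
    then show ?thesis using K C by (intro exI[of _ "K * C + 2 * \<bar>M\<bar>"]) simp
  qed
  have fF: "loc_unif_limit f F"
    unfolding loc_unif_limit_def
  proof (intro allI impI)
    fix r :: real assume r: "r < 1"
    from close[OF r] obtain K where K: "\<forall>n z. norm z \<le> r \<longrightarrow> norm (f n z - F z) \<le> K * s n" by blast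
    show "uniform_limit (cball 0 r) f F sequentially"
    proof (rule uniform_limit_by_bound[where b="\<lambda>n z. K * s n"])
      show "\<forall>\<^sub>F n in sequentially. \<forall>z\<in>cball 0 r. norm (f n z - F z) \<le> K * s n"
        using K by simp
      show "uniform_limit (cball 0 r) (\<lambda>n z. K * s n) (\<lambda>_. 0) sequentially"
        by (intro uniform_limit_of_tendsto tendsto_mult_right_zero s)
    qed
  qed
  define B where "B n z = (1 / s n) *\<^sub>R (\<phi> (s n) z - z)" for n z
  have sB: "z + s n *\<^sub>R B n z = \<phi> (s n) z" for n z using s(1)[of n] by (simp add: B_def)
  have BB: "B n z = (B0 \<circ> \<sigma>) n z" if "norm z < 1" for n z using that by (simp add: B_def B0_def s_def)
  have Bbd: "\<exists>C. \<forall>n z. norm z \<le> r \<longrightarrow> norm (B n z) \<le> C" if r: "r < 1" for r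
  proof -
    obtain C where "\<And>n z. norm z \<le> r \<Longrightarrow> norm (B0 n z) \<le> C" using B0bd[OF r] by blast
    then show ?thesis using BB r by (intro exI[of _ C]) simp
  qed
  have Bh': "loc_unif_limit B h"
    unfolding loc_unif_limit_def
  proof (intro allI impI)
    fix r :: real assume r: "r < 1"
    have "uniform_limit (cball 0 r) (B0 \<circ> \<sigma>) h sequentially" using Bh r by (simp add: loc_unif_limit_def)
    then show "uniform_limit (cball 0 r) B h sequentially"
      by (subst uniform_limit_cong'[of _ B "B0 \<circ> \<sigma>" h h]) (use BB r in auto)
  qed
  let ?q = "\<lambda>n z. (1 / s n) *\<^sub>R (F (z + s n *\<^sub>R B n z) - F z)"
  have q: "loc_unif_limit ?q (derivative_applied F h)"
    by (rule directional_quotient_loc_unif[OF FH Bh' Bbd s(1,2)])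
  have "loc_unif_limit k (\<lambda>z\<in>unit_ball. F z + derivative_applied F h z)"
    unfolding loc_unif_limit_def
  proof (intro allI impI)
    fix r :: real assume r: "r < 1"
    define r' where "r' = (1 + r) / 2"
    have r': "r < r'" "r' < 1" using r by (auto simp: r'_def field_simps)
    obtain M where M: "M \<ge> 0" "\<And>z. norm z \<le> r \<Longrightarrow> norm (F z) \<le> M" using Hol_bounded_on[OF FH r] by metis
    obtain K1 where K1: "K1 \<ge> 0" "\<And>n z. norm z \<le> r' \<Longrightarrow> norm (f n z - F z) \<le> K1 * s n" using close[OF r'(2)] by blast
    define K where "K = 2 * K1 / (r' - r)"
    have K: "K \<ge> 0" using K1(1) r' by (simp add: K_def)
    obtain C where C: "C \<ge> 0" "\<And>z t. norm z \<le> r \<Longrightarrow> 0 \<le> t \<Longrightarrow> norm (\<phi> t z) \<le> norm z \<and> norm (\<phi> t z - z) \<le> C * t"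
      using evolution_small_time[OF r] G \<phi> by metis
    let ?a = "\<lambda>n. (1 - exp (- s n)) / s n"
    have a: "?a \<longlonglongrightarrow> 1"
    proof -
      have "(\<lambda>n. (1 - exp (- t n)) / t n) \<longlonglongrightarrow> 1" unfolding t_def by real_asymp
      from LIMSEQ_subseq_LIMSEQ[OF this \<sigma>] show ?thesis by (simp add: o_def s_def)
    qed
    let ?b = "\<lambda>n z. norm (?q n z - derivative_applied F h z) + (\<bar>?a n - 1\<bar> * M + K * C * s n)"
    show "uniform_limit (cball 0 r) k (\<lambda>z\<in>unit_ball. F z + derivative_applied F h z) sequentially"
    proof (rule uniform_limit_by_bound[where b="?b"])
      have "(\<lambda>n. \<bar>?a n - 1\<bar> * M + K * C * s n) \<longlonglongrightarrow> \<bar>1 - 1\<bar> * M + K * C * 0"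
        by (intro tendsto_intros a s)
      then show "uniform_limit (cball 0 r) ?b (\<lambda>_. 0) sequentially"
        using q r unfolding loc_unif_limit_def
        by (intro uniform_limit_add_zero uniform_limit_norm_diff uniform_limit_of_tendsto) auto
      show "\<forall>\<^sub>F n in sequentially. \<forall>z\<in>cball 0 r. norm (k n z - (\<lambda>z\<in>unit_ball. F z + derivative_applied F h z) z) \<le> ?b n z"
      proof (intro always_eventually allI ballI)
        fix n and z :: "complex^'n" assume "z \<in> cball 0 r"
        then have z: "norm z \<le> r" by simp
        then have zb: "z \<in> unit_ball" using r by simp
        define y where "y = \<phi> (s n) z"
        have y: "norm y \<le> r" "norm (y - z) \<le> C * s n" using C(2)[OF z, of "s n"] s(1)[of n] z by (auto simp: y_def)
        have yb: "y \<in> unit_ball" using y(1) r by simp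
        \<comment> \<open>Since f_n - F is of order s, so is its Lipschitz constant on a smaller
          ball, and its increment from \<open>z\<close> to \<open>y\<close> is of order s^2.
          Division by s still leaves a null sequence, which lets the fixed map \<open>F\<close>
          replace the varying f_n in the quotient along the flow.\<close>
        define E where "E = (\<lambda>z\<in>unit_ball. 1 *\<^sub>R (f n z - F z))"
        have E: "E \<in> Hol" unfolding E_def by (rule Hol_scale_diff[OF fH FH])
        have "norm (E y - E z) \<le> 2 * (K1 * s n) / (r' - r) * norm (y - z)"
        proof (rule Hol_Lipschitz[OF E r'(1) _ _ y(1) z])
          show "norm (E x) \<le> K1 * s n" if "norm x < r'" for x
            using K1(2)[of x n] that r' by (simp add: E_def)
        qed (use r' in simp)
        also have "\<dots> = s n * (K * norm (y - z))" by (simp add: K_def)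
        also have "\<dots> \<le> s n * (K * (C * s n))"
          using y(2) K s(1)[of n] by (intro mult_left_mono) auto
        finally have "norm (E y - E z) / s n \<le> K * C * s n"
          using s(1)[of n] by (simp add: divide_le_eq mult_ac)
        then have 3: "norm ((1 / s n) *\<^sub>R (E y - E z)) \<le> K * C * s n" using s(1)[of n] by simp
        have fy: "f n y = exp (- s n) *\<^sub>R F z" using Ff[OF zb, of n] by (simp add: y_def flip: exp_add)
        have "norm ((?a n - 1) *\<^sub>R F z) \<le> \<bar>?a n - 1\<bar> * M"
          using M(2)[OF z] by (simp add: mult_left_mono)
        moreover have e: "k n z - (\<lambda>z\<in>unit_ball. F z + derivative_applied F h z) z =
            (?q n z - derivative_applied F h z) + ((?a n - 1) *\<^sub>R F z + (1 / s n) *\<^sub>R (E y - E z))"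
        proof -
          \<comment> \<open>Here c = 1/s, a = F(z), b = f_n(z), p = F(y), d = dF h at z, and A =
            e^(-s) F(z), which equals f_n(y) by the factorisation. The right side isolates the three
            errors estimated separately.\<close>
          have alg: "c *\<^sub>R (a - b) - (a + d) = (c *\<^sub>R (p - a) - d) + ((c *\<^sub>R (a - A) - a) + c *\<^sub>R (A - p - b + a))"
            for c :: real and a b p d A :: "complex^'n"
            by (simp add: scaleR_diff_right scaleR_add_right)
          have 1: "?q n z = (1 / s n) *\<^sub>R (F y - F z)" unfolding sB y_def ..
          have 2: "E y - E z = exp (- s n) *\<^sub>R F z - F y - f n z + F z" using zb yb by (simp add: E_def fy)
          have 3: "(?a n - 1) *\<^sub>R F z = (1 / s n) *\<^sub>R (F z - exp (- s n) *\<^sub>R F z) - F z"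
            by (simp add: scaleR_diff_left scaleR_diff_right diff_divide_distrib)
          show ?thesis
            unfolding 1 2 3 alg[symmetric] using zb by (simp add: k_def)
        qed
        ultimately show "norm (k n z - (\<lambda>z\<in>unit_ball. F z + derivative_applied F h z) z) \<le> ?b n z"
          unfolding e using 3 by (intro order_trans[OF norm_triangle_ineq add_mono] order_refl)
      qed
    qed
  qed
  then show ?thesis using that hM s(1,2) f fF k Fk by blast
qed

theorem theorem1p6:
  fixes U :: "(complex^'n \<Rightarrow> complex^'n) set"
    and \<Phi> L :: "(complex^'n \<Rightarrow> complex^'n) \<Rightarrow> complex"
    and F :: "complex^'n \<Rightarrow> complex^'n"
  assumes "openin compact_open_topology U"
    and "class_S0 \<subseteq> U"
    and "continuous_map (subtopology compact_open_topology U) euclidean \<Phi>"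
    and "F \<in> class_S0"
    and "\<And>f. f \<in> class_S0 \<Longrightarrow> Re (\<Phi> f) \<le> Re (\<Phi> F)"
    and "has_complex_derivative U \<Phi> F L"
  shows "(\<exists>h\<in>class_M. Re (L (derivative_applied F h)) = - Re (L F)) \<and>
         (\<forall>h\<in>class_M. Re (L (derivative_applied F h)) \<le> - Re (L F))"
proof -
  have S0: "class_S0 \<subseteq> (Hol :: (complex^'n \<Rightarrow> complex^'n) set)"
    using assms(2) openin_subset[OF assms(1)] by simp
  have FH: "F \<in> Hol" using assms(4) S0 by blast
  note D = assms(6) and ext = assms(5)
  let ?g = "\<lambda>h. \<lambda>z\<in>unit_ball. F z + derivative_applied F h z"
  have gH: "?g h \<in> Hol" if "\<And>n. k n \<in> Hol" "loc_unif_limit k (?g h)" for h k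
    by (rule Hol_loc_unif_limit[OF that(1) _ that(2)]) simp
  have Lg: "L (?g h) = L F + L (derivative_applied F h)" if g: "?g h \<in> Hol" for h
  proof -
    \<comment> \<open>The map dF h is holomorphic as the difference of a locally uniform limit and
      \<open>F\<close>, which avoids second derivatives of \<open>F\<close>.\<close>
    have "(\<lambda>z\<in>unit_ball. 1 *\<^sub>R (?g h z - F z)) \<in> Hol" by (rule Hol_scale_diff[OF g FH])
    also have "(\<lambda>z\<in>unit_ball. 1 *\<^sub>R (?g h z - F z)) = derivative_applied F h"
      unfolding derivative_applied_def by (intro restrict_ext) simp
    finally show ?thesis using complex_derivative_additive[OF D FH FH] by blast
  qed
  have upper: "Re (L (derivative_applied F h)) \<le> - Re (L F)" if h: "h \<in> class_M" for h
  proof -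
    obtain f k s where s: "\<And>n. s n > 0" "s \<longlonglongrightarrow> 0" and f: "\<And>n. f n \<in> class_S0" and k: "\<And>n. k n \<in> Hol"
      and fk: "\<And>n. f n = (\<lambda>z\<in>unit_ball. F z + s n *\<^sub>R k n z)" and lim: "loc_unif_limit k (?g h)"
      by (rule forward_variation[OF S0 assms(4) h]) (rule that)
    have "(\<lambda>n. (\<Phi> (f n) - \<Phi> F) / of_real (s n)) \<longlonglongrightarrow> L (?g h)"
      unfolding fk by (rule derivative_along_sequence[OF D FH FH loc_unif_limit_const k gH[OF k lim] lim s])
    then have "(\<lambda>n. Re ((\<Phi> (f n) - \<Phi> F) / of_real (s n))) \<longlonglongrightarrow> Re (L (?g h))" by (rule tendsto_Re)
    moreover have "Re ((\<Phi> (f n) - \<Phi> F) / of_real (s n)) \<le> 0" for n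
      using ext[OF f] s(1)[of n] by (simp add: divide_nonpos_pos)
    ultimately have "Re (L (?g h)) \<le> 0" by (intro LIMSEQ_le_const2) auto
    then show ?thesis using Lg[OF gH[OF k lim]] by simp
  qed
  obtain h f k s where h: "h \<in> class_M" and s: "\<And>n. s n > 0" "s \<longlonglongrightarrow> 0" and f: "\<And>n. f n \<in> class_S0"
    and fF: "loc_unif_limit f F" and k: "\<And>n. k n \<in> Hol" and Fk: "\<And>n. F = (\<lambda>z\<in>unit_ball. f n z + s n *\<^sub>R k n z)"
    and lim: "loc_unif_limit k (?g h)"
    by (rule backward_variation[OF S0 assms(4)]) (rule that)
  have fH: "f n \<in> Hol" for n using f S0 by blast
  have "(\<lambda>n. (\<Phi> (\<lambda>z\<in>unit_ball. f n z + s n *\<^sub>R k n z) - \<Phi> (f n)) / of_real (s n)) \<longlonglongrightarrow> L (?g h)"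
    by (rule derivative_along_sequence[OF D fH FH fF k gH[OF k lim] lim s])
  then have "(\<lambda>n. (\<Phi> F - \<Phi> (f n)) / of_real (s n)) \<longlonglongrightarrow> L (?g h)" unfolding Fk[symmetric] .
  then have "(\<lambda>n. Re ((\<Phi> F - \<Phi> (f n)) / of_real (s n))) \<longlonglongrightarrow> Re (L (?g h))" by (rule tendsto_Re)
  moreover have "Re ((\<Phi> F - \<Phi> (f n)) / of_real (s n)) \<ge> 0" for n
    using ext[OF f] s(1)[of n] by simp
  ultimately have "Re (L (?g h)) \<ge> 0" by (intro LIMSEQ_le_const) auto
  then have "Re (L (derivative_applied F h)) = - Re (L F)"
    using Lg[OF gH[OF k lim]] upper[OF h] by simp
  then show ?thesis using upper h by blast
qed

end
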